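(* Let $\lambda\in\mathbb{C}^N$ and let $\Phi_\lambda$ be the spherical function $\Phi_\lambda(x)=\int_U\Delta_{\lambda+\delta}(u\cdot x)\,du$ on $M$. Then, for $x\in M$ with eigenvalues $(\rho_1,\dots,\rho_N)$, $$\Phi_\lambda(x)=\prod_{k=1}^{N-1}k!\times\frac{\det\!\left[\rho_k^{\lambda_\ell+(N-1)/2}\right]_{k,\ell=1}^N}{V(\lambda)\,V(\rho)} ,$$ where the right-hand side is understood by continuous extension when two of the $\lambda_k$ or two of the $\rho_k$ coincide.
   Context: $N\ge1$ is an integer. $M$ is the space of $N\times N$ Hermitian positive definite complex matrices; $U$ is the group of $N\times N$ unitary matrices, acting on $M$ by $u\cdot x=uxu^\dagger$; $du$ is the normalized Haar measure on $U$. For $s\in\mathbb{C}^N$ the power function is $\Delta_s(x)=\Delta_1(x)^{s_1-s_2}\Delta_2(x)^{s_2-s_3}\cdots\Delta_N(x)^{s_N}$, where $\Delta_k(x)$ is the $k$-th leading principal minor of $x\in M$. $\delta=(\delta_1,\dots,\delta_N)$ with $\delta_k=\tfrac12(2k-N-1)$. $V(\mu)=\prod_{k<\ell}(\mu_\ell-\mu_k)$ is the Vandermonde polynomial. For $\rho>0$ and $z\in\mathbb{C}$, $\rho^z=e^{z\log\rho}$. *)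

theory Defs
  imports
    "HOL-Probability.Probability"
    "Jordan_Normal_Form.Schur_Decomposition"
begin

text \<open>
  Matrices are those of \<^theory>\<open>Jordan_Normal_Form.Matrix\<close>, whose entries are indexed from 0.
  \<open>N\<close>-tuples are functions on \<^typ>\<open>nat\<close> of which only the values at \<open>1, \<dots>, N\<close> matter, so that
  tuples carry the same indices as on paper.
\<close>

definition unitary_group :: "nat \<Rightarrow> complex mat set" where
  "unitary_group N = {u \<in> carrier_mat N N. u * mat_adjoint u = 1\<^sub>m N \<and> mat_adjoint u * u = 1\<^sub>m N}"

definition hermitian_pos_def :: "nat \<Rightarrow> complex mat set" where
  "hermitian_pos_def N = {x \<in> carrier_mat N N. mat_adjoint x = x \<and>
     (\<forall>v \<in> carrier_vec N. v \<noteq> 0\<^sub>v N \<longrightarrow> Re ((x *\<^sub>v v) \<bullet>c v) > 0)}"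

text \<open>
  The type of matrices has no topology of its own.  The Borel sets of the unitary group, as a
  subspace of the space of all tuples of \<open>N \<times> N\<close> entries, are the preimages of the Borel sets
  of that space under the map sending a matrix to the family of its entries.
\<close>

definition unitary_borel :: "nat \<Rightarrow> complex mat measure" where
  "unitary_borel N = vimage_algebra (unitary_group N)
     (\<lambda>u. \<lambda>ij \<in> {..<N} \<times> {..<N}. u $$ ij)
     (Pi\<^sub>M ({..<N} \<times> {..<N}) (\<lambda>_. borel))"

text \<open>
  The normalized Haar measure is the unique left-invariant Borel probability measure on the
  unitary group.
\<close>

definition normalized_haar :: "nat \<Rightarrow> complex mat measure \<Rightarrow> bool" where
  "normalized_haar N \<mu> \<longleftrightarrow> prob_space \<mu> \<and> sets \<mu> = sets (unitary_borel N) \<and>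
     (\<forall>v \<in> unitary_group N. distr \<mu> \<mu> (\<lambda>u. v * u) = \<mu>)"

definition leading_minor :: "nat \<Rightarrow> complex mat \<Rightarrow> complex" where
  "leading_minor k x = Determinant.det (Matrix.mat k k (\<lambda>(i, j). x $$ (i, j)))"

text \<open>
  Leading minors of positive definite matrices are positive real numbers, where the complex
  \<^const>\<open>powr\<close> (principal branch) is given by the real logarithm.
\<close>

definition power_function :: "nat \<Rightarrow> (nat \<Rightarrow> complex) \<Rightarrow> complex mat \<Rightarrow> complex" where
  "power_function N s x =
     (\<Prod>k\<in>{1..<N}. leading_minor k x powr (s k - s (Suc k))) * leading_minor N x powr s N"

definition delta :: "nat \<Rightarrow> nat \<Rightarrow> complex" where
  "delta N k = (2 * of_nat k - of_nat N - 1) / 2"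

definition spherical_function ::
  "nat \<Rightarrow> complex mat measure \<Rightarrow> (nat \<Rightarrow> complex) \<Rightarrow> complex mat \<Rightarrow> complex" where
  "spherical_function N \<mu> lam x =
     (LINT u|\<mu>. power_function N (\<lambda>k. lam k + delta N k) (u * x * mat_adjoint u))"

text \<open>The eigenvalues, listed with multiplicity in an arbitrary order.\<close>

definition has_eigenvalues :: "nat \<Rightarrow> complex mat \<Rightarrow> (nat \<Rightarrow> real) \<Rightarrow> bool" where
  "has_eigenvalues N x rho \<longleftrightarrow> char_poly x = (\<Prod>k\<in>{1..N}. [:- of_real (rho k), 1:])"

definition vandermonde :: "nat \<Rightarrow> (nat \<Rightarrow> complex) \<Rightarrow> complex" where
  "vandermonde N m = (\<Prod>k\<in>{1..N}. \<Prod>l\<in>{k<..N}. m l - m k)"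

definition gelfand_naimark_quotient ::
  "nat \<Rightarrow> (nat \<Rightarrow> complex) \<Rightarrow> (nat \<Rightarrow> real) \<Rightarrow> complex" where
  "gelfand_naimark_quotient N lam rho =
     (\<Prod>k\<in>{1..N - 1}. fact k) *
     (Determinant.det (Matrix.mat N N
        (\<lambda>(k, l). of_real (rho (Suc k)) powr (lam (Suc l) + (of_nat N - 1) / 2)))
      / (vandermonde N lam * vandermonde N (\<lambda>k. of_real (rho k))))"

text \<open>The parameters at which the denominator of the quotient does not vanish.\<close>

definition regular_parameters :: "nat \<Rightarrow> ((nat \<Rightarrow> complex) \<times> (nat \<Rightarrow> real)) set" where
  "regular_parameters N = {(lam, rho). inj_on lam {1..N} \<and> inj_on rho {1..N} \<and>
     (\<forall>k\<in>{1..N}. rho k > 0)}"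

end

theory Submission
  imports Defs
begin

text \<open>
  Write \<open>Y = u x u\<^sup>*\<close>, with leading minors \<open>D\<^sub>k\<close> and characteristic polynomials \<open>\<phi>\<^sub>k\<close> of its leading
  blocks.  If the exponents \<open>a\<^sub>k\<close> of the minors are natural numbers, the product of the first \<open>k\<close>
  powers is replaced, inside the Haar integral and up to a constant, by a Schur polynomial of the
  eigenvalues of the block of size \<open>k\<close>, written as a determinant of coefficients of \<open>\<phi>\<^sub>k\<close> and powers of
  \<open>z\<close>.  Multiplying by a power of \<open>D\<^sub>k = (-1)\<^sup>k \<phi>\<^sub>k(0)\<close> shifts the exponents of the Schur polynomial.  The
  passage from \<open>\<phi>\<^sub>k\<close> to \<open>\<phi>\<^sub>k\<^sub>+\<^sub>1\<close> replaces the rows containing \<open>\<phi>\<^sub>k\<close> one by one by derivatives of multiples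
  of \<open>\<phi>\<^sub>k\<^sub>+\<^sub>1\<close>; the error of each replacement is an infinitesimal rotation in the planes of the
  coordinates \<open>i < k\<close> and \<open>k\<close> and hence integrates to \<open>0\<close>.  At \<open>k = N\<close> the integrand has become
  constant, namely the determinant of powers of the eigenvalues of \<open>x\<close> over their Vandermonde
  determinant.

  Since the minors stay in a compact subset of the positive half-line, both sides are, in each of
  the exponents, convergent Newton series, which their values at the natural numbers determine.  This
  gives the formula for complex exponents, and it shows that the spherical function depends on the
  eigenvalues of \<open>x\<close> only.  The continuous extension follows by dominated convergence for
  diagonal matrices.
\<close>

section \<open>Determinants of coefficients\<close>

text \<open>Integrating out the eigenvalues of successive corners would require choosing them
  measurably and knowing the law of a corner. Determinants built from coefficients avoid both, and
  for natural exponents left invariance of the measure then does all the work. It is used through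
  rotations in the planes of \<open>i < k\<close> and \<open>k\<close>: they conjugate every leading
  block of size above \<open>k\<close> and so fix the later minors, which is why the blocks are
  treated in increasing size. The rotations are parametrised by the tangent \<open>t\<close> of the
  angle, so that a rotated test function times a power of \<open>1 + t^2\<close> is a polynomial in
  \<open>t\<close>. Invariance becomes an identity of polynomials, whose linear coefficient replaces
  differentiation under the integral. That the errors of a replacement add up to a single derivative
  rests on the commutation of the coefficient matrices of \<open>adj (z - Y)\<close>.\<close>

definition coeff_det :: "nat \<Rightarrow> (nat \<Rightarrow> complex poly) \<Rightarrow> complex" where
  "coeff_det n R = Determinant.det (Matrix.mat n n (\<lambda>(i, j). coeff (R i) j))"

lemma coeff_det_cong:
  "(\<And>i. i < n \<Longrightarrow> R i = R' i) \<Longrightarrow> coeff_det n R = coeff_det n R'"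
  unfolding coeff_det_def by (intro arg_cong[where f = Determinant.det] eq_matI) auto

text \<open>The cofactors along row \<open>k\<close> do not see that row, so the determinant is a
  fixed linear functional of the polynomial placed there; the linearity rules below are read off
  from this.\<close>

lemma coeff_det_row:
  assumes "k < n"
  shows "\<exists>c. \<forall>p. coeff_det n (R(k := p)) = (\<Sum>j<n. coeff p j * c j)"
proof -
  let ?M = "\<lambda>p. Matrix.mat n n (\<lambda>(i, j). coeff ((R(k := p)) i) j)"
  have "coeff_det n (R(k := p)) = (\<Sum>j<n. coeff p j * cofactor (?M 0) k j)" for p
  proof -
    have "mat_delete (?M p) k j = mat_delete (?M 0) k j" if "j < n" for j
      unfolding mat_delete_def using that assms by (intro eq_matI) auto
    then have "cofactor (?M p) k j = cofactor (?M 0) k j" if "j < n" for j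
      using that by (simp add: cofactor_def)
    moreover have "coeff_det n (R(k := p)) = (\<Sum>j<n. ?M p $$ (k, j) * cofactor (?M p) k j)"
      unfolding coeff_det_def by (rule laplace_expansion_row) (use assms in auto)
    ultimately show ?thesis using assms by simp
  qed
  then show ?thesis by blast
qed

lemma coeff_det_add:
  "k < n \<Longrightarrow> coeff_det n (R(k := p + q)) = coeff_det n (R(k := p)) + coeff_det n (R(k := q))"
  using coeff_det_row[of k n R] by (auto simp: algebra_simps sum.distrib)

lemma coeff_det_smult:
  "k < n \<Longrightarrow> coeff_det n (R(k := Polynomial.smult a p)) = a * coeff_det n (R(k := p))"
  using coeff_det_row[of k n R] by (auto simp: algebra_simps sum_distrib_left)

lemma coeff_det_diff:
  "k < n \<Longrightarrow> coeff_det n (R(k := p - q)) = coeff_det n (R(k := p)) - coeff_det n (R(k := q))"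
  using coeff_det_row[of k n R] by (auto simp: algebra_simps sum_subtractf)

lemma coeff_det_sum:
  "k < n \<Longrightarrow> coeff_det n (R(k := (\<Sum>i\<in>I. p i))) = (\<Sum>i\<in>I. coeff_det n (R(k := p i)))"
  using coeff_det_row[of k n R]
  by (auto simp: coeff_sum sum_distrib_right intro: sum.swap)

lemma coeff_det_equal_rows:
  assumes "i < n" "j < n" "i \<noteq> j" "R i = R j"
  shows "coeff_det n R = 0"
  unfolding coeff_det_def
  by (rule Determinant.det_identical_rows[OF _ assms(3,1,2)]) (use assms in \<open>auto intro!: eq_vecI\<close>)

text \<open>With \<open>\<phi>\<close> the monic polynomial with roots \<open>\<rho>\<^sub>0, \<dots>, \<rho>\<^sub>k\<^sub>-\<^sub>1\<close> this is the quotient of the generalized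
  Vandermonde determinant with exponents \<open>l\<close> by the ordinary one (a Schur polynomial), for every
  \<open>M\<close> that is large enough; see \<open>power_rows_det_vandermonde\<close>.  No eigenvalues have to be
  distinguished in this form: it is a polynomial in the coefficients of \<open>\<phi>\<close>.\<close>

definition power_rows_det :: "nat \<Rightarrow> nat \<Rightarrow> (nat \<Rightarrow> nat) \<Rightarrow> complex poly \<Rightarrow> complex" where
  "power_rows_det k M l \<phi> =
     coeff_det (k + M) (\<lambda>i. if i < k then monom 1 (l i) else \<phi> * monom 1 (i - k))"

lemma coeff_mult_monom_one:
  fixes p :: "'a::comm_semiring_1 poly"
  shows "coeff (p * monom 1 n) k = (if k < n then 0 else coeff p (k - n))"
  by (subst mult.commute) (simp add: coeff_monom_mult)

lemma prod_list_diag_mat: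
  fixes f :: "nat \<times> nat \<Rightarrow> 'a::comm_monoid_mult"
  shows "prod_list (diag_mat (Matrix.mat n n f)) = (\<Prod>i<n. f (i, i))"
  by (simp add: diag_mat_def prod.list_conv_set_nth atLeast0LessThan)

text \<open>After the shift every monomial and every \<open>\<phi> * monom 1 i\<close> with
  \<open>i > 0\<close> has zero constant term, so the first column contains only
  \<open>coeff \<phi> 0\<close>, in row \<open>k\<close>. For a characteristic polynomial the left
  factor is the determinant of the block.\<close>

lemma power_rows_det_absorb:
  "(-1) ^ k * coeff \<phi> 0 * power_rows_det k M l \<phi> = power_rows_det k (Suc M) (\<lambda>i. Suc (l i)) \<phi>"
proof -
  let ?R = "\<lambda>i. if i < k then monom 1 (Suc (l i)) else \<phi> * monom 1 (i - k)"
  let ?A = "Matrix.mat (k + Suc M) (k + Suc M) (\<lambda>(i, j). coeff (?R i) j)"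
  have "Determinant.det ?A = (\<Sum>i<k + Suc M. ?A $$ (i, 0) * cofactor ?A i 0)"
    by (rule laplace_expansion_column) auto
  also have "\<dots> = ?A $$ (k, 0) * cofactor ?A k 0"
  proof -
    have "?A $$ (i, 0) = 0" if "i \<noteq> k" "i < k + Suc M" for i
      using that by (auto simp: coeff_mult_monom_one)
    then have "(\<Sum>i<k + Suc M. ?A $$ (i, 0) * cofactor ?A i 0) =
        (\<Sum>i\<in>{k}. ?A $$ (i, 0) * cofactor ?A i 0)"
      by (intro sum.mono_neutral_right) auto
    then show ?thesis by simp
  qed
  also have "mat_delete ?A k 0 = Matrix.mat (k + M) (k + M) (\<lambda>(i, j).
      coeff ((if i < k then monom 1 (l i) else \<phi> * monom 1 (i - k))) j)"
    by (intro eq_matI) (auto simp: mat_delete_def Suc_diff_le coeff_mult_monom_one)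
  then have "cofactor ?A k 0 = (-1) ^ k * power_rows_det k M l \<phi>"
    by (simp add: cofactor_def power_rows_det_def coeff_det_def)
  finally show ?thesis
    by (simp add: power_rows_det_def coeff_det_def)
qed

text \<open>The row of exponent 0 is a unit vector, which removes the column of constant
  coefficients. On the other columns, shifting and scaling by \<open>j + 1\<close> is
  differentiation; this costs \<open>(k + M)!\<close> on one side and the factors
  \<open>l i + 1\<close> of the differentiated monomials on the other.\<close>

lemma power_rows_det_derivative:
  "fact (k + M) * power_rows_det (Suc k) M (case_nat 0 (\<lambda>i. Suc (l i))) \<phi> =
     (\<Prod>i<k. of_nat (Suc (l i))) *
     coeff_det (k + M) (\<lambda>i. if i < k then monom 1 (l i) else pderiv (\<phi> * monom 1 (i - k)))"
proof -
  define R where "R i = (if i < Suc k then monom 1 (case_nat 0 (\<lambda>i. Suc (l i)) i)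
     else \<phi> * monom 1 (i - Suc k))" for i
  define S where "S i = (if i < k then monom 1 (l i) else pderiv (\<phi> * monom 1 (i - k)))" for i
  let ?n = "k + M"
  let ?A = "Matrix.mat (Suc ?n) (Suc ?n) (\<lambda>(i, j). coeff (R i) j)"
  let ?B = "Matrix.mat ?n ?n (\<lambda>(i, j). coeff (R (Suc i)) (Suc j))"
  let ?D = "Matrix.mat ?n ?n (\<lambda>(i, j). if i = j then of_nat (Suc i) else 0 :: complex)"
  let ?E = "Matrix.mat ?n ?n (\<lambda>(i, j). if i = j then (if i < k then of_nat (Suc (l i)) else 1) else 0 :: complex)"
  let ?S = "Matrix.mat ?n ?n (\<lambda>(i, j). coeff (S i) j)"
  have "Determinant.det ?A = (\<Sum>j<Suc ?n. ?A $$ (0, j) * cofactor ?A 0 j)"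
    by (rule laplace_expansion_row) auto
  also have "\<dots> = (\<Sum>j\<in>{0}. ?A $$ (0, j) * cofactor ?A 0 j)"
    by (intro sum.mono_neutral_right) (auto simp: R_def)
  also have "\<dots> = Determinant.det (mat_delete ?A 0 0)"
    by (simp add: cofactor_def R_def)
  also have "mat_delete ?A 0 0 = ?B"
    by (intro eq_matI) (auto simp: mat_delete_def)
  finally have AB: "Determinant.det ?A = Determinant.det ?B" .
  have detD: "Determinant.det ?D = fact ?n"
  proof -
    have "Determinant.det ?D = prod_list (diag_mat ?D)"
      by (rule det_upper_triangular[where n = ?n]) auto
    also have "\<dots> = (\<Prod>i<?n. of_nat (Suc i))"
      by (simp add: prod_list_diag_mat)
    also have "\<dots> = fact ?n"
      by (simp only: fact_prod_Suc atLeast0LessThan of_nat_prod)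
    finally show ?thesis .
  qed
  have detE: "Determinant.det ?E = (\<Prod>i<k. of_nat (Suc (l i)))"
  proof -
    have "Determinant.det ?E = prod_list (diag_mat ?E)"
      by (rule det_upper_triangular[where n = ?n]) auto
    also have "\<dots> = (\<Prod>i<?n. if i < k then of_nat (Suc (l i)) else 1)"
      by (simp add: prod_list_diag_mat)
    also have "\<dots> = (\<Prod>i<k. if i < k then of_nat (Suc (l i)) else 1)"
      by (rule prod.mono_neutral_right) auto
    finally show ?thesis by simp
  qed
  have "?B * ?D = ?E * ?S"
  proof (rule eq_matI)
    fix i j assume "i < dim_row (?E * ?S)" "j < dim_col (?E * ?S)"
    then have ij: "i < ?n" "j < ?n" by auto
    have "(?B * ?D) $$ (i, j) = (\<Sum>m = 0..<?n. coeff (R (Suc i)) (Suc m) * (if m = j then of_nat (Suc m) else 0))"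
      using ij by (auto simp: scalar_prod_def intro!: sum.cong)
    also have "\<dots> = coeff (R (Suc i)) (Suc j) * of_nat (Suc j)"
      using ij by (subst sum.mono_neutral_right[of _ "{j}"]) auto
    also have "\<dots> = (if i < k then of_nat (Suc (l i)) else 1) * coeff (S i) j"
      by (auto simp: R_def S_def coeff_pderiv)
    also have "\<dots> = (\<Sum>m = 0..<?n. (if i = m then (if i < k then of_nat (Suc (l i)) else 1) else 0) * coeff (S m) j)"
      using ij by (subst sum.mono_neutral_right[of _ "{i}"]) auto
    also have "\<dots> = (?E * ?S) $$ (i, j)"
      using ij by (auto simp: scalar_prod_def intro!: sum.cong)
    finally show "(?B * ?D) $$ (i, j) = (?E * ?S) $$ (i, j)" .
  qed auto
  then have "Determinant.det ?B * Determinant.det ?D = Determinant.det ?E * Determinant.det ?S"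
    using det_mult[of ?B ?n ?D] det_mult[of ?E ?n ?S] by simp
  note BDES = this
  have "fact ?n * Determinant.det ?A = Determinant.det ?B * Determinant.det ?D"
    unfolding AB detD by (rule mult.commute)
  also have "\<dots> = (\<Prod>i<k. of_nat (Suc (l i))) * Determinant.det ?S"
    unfolding BDES detE ..
  finally show ?thesis
    by (simp add: power_rows_det_def coeff_det_def R_def S_def)
qed

text \<open>The change to the Newton basis \<open>p i\<close> is unitriangular, and its evaluation
  matrix is triangular because \<open>p i\<close> vanishes at \<open>\<rho> j\<close> for
  \<open>j < i\<close>.\<close>

lemma det_vandermonde:
  fixes \<rho> :: "nat \<Rightarrow> complex"
  shows "Determinant.det (Matrix.mat n n (\<lambda>(i, j). \<rho> j ^ i)) = (\<Prod>j<n. \<Prod>i<j. \<rho> j - \<rho> i)"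
proof -
  define p where "p i = (\<Prod>m<i. [:- \<rho> m, 1:])" for i
  have deg: "degree (p i) = i" for i
    unfolding p_def by (subst degree_prod_eq_sum_degree) auto
  have lead: "coeff (p i) i = 1" for i
    using deg[of i] monic_prod[of "{..<i}" "\<lambda>m. [:- \<rho> m, 1:]"] by (simp add: p_def)
  let ?L = "Matrix.mat n n (\<lambda>(i, j). coeff (p i) j)"
  let ?V = "Matrix.mat n n (\<lambda>(i, j). \<rho> j ^ i)"
  let ?T = "Matrix.mat n n (\<lambda>(i, j). poly (p i) (\<rho> j))"
  have "?L * ?V = ?T"
  proof (rule eq_matI)
    fix i j assume "i < dim_row ?T" "j < dim_col ?T"
    then have ij: "i < n" "j < n" by auto
    then have "(?L * ?V) $$ (i, j) = (\<Sum>m<n. coeff (p i) m * \<rho> j ^ m)"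
      by (auto simp: scalar_prod_def atLeast0LessThan intro!: sum.cong)
    also have "\<dots> = (\<Sum>m\<le>i. coeff (p i) m * \<rho> j ^ m)"
      by (rule sum.mono_neutral_right) (use ij deg in \<open>auto simp: coeff_eq_0\<close>)
    also have "\<dots> = ?T $$ (i, j)" using ij by (simp add: poly_altdef deg)
    finally show "(?L * ?V) $$ (i, j) = ?T $$ (i, j)" .
  qed auto
  then have "Determinant.det ?L * Determinant.det ?V = Determinant.det ?T"
    using det_mult[of ?L n ?V] by simp
  moreover have "Determinant.det ?L = 1"
  proof -
    have "Determinant.det ?L = prod_list (diag_mat ?L)"
      by (rule det_lower_triangular[where n = n]) (auto simp: coeff_eq_0 deg)
    then show ?thesis by (simp add: prod_list_diag_mat lead)
  qed
  moreover have "Determinant.det ?T = (\<Prod>j<n. \<Prod>i<j. \<rho> j - \<rho> i)"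
  proof -
    have "Determinant.det ?T = prod_list (diag_mat ?T)"
    proof (rule det_upper_triangular[where n = n])
      have "poly (p i) (\<rho> j) = 0" if "j < i" for i j
        unfolding p_def poly_prod using that by (intro prod_zero bexI[of _ j]) auto
      then show "upper_triangular ?T" by auto
    qed auto
    then show ?thesis
      by (simp add: prod_list_diag_mat p_def poly_prod)
  qed
  ultimately show ?thesis by simp
qed

text \<open>Multiplication by \<open>E\<close> evaluates each row at the roots and keeps its
  coefficients of degree at least \<open>N\<close>. The rows containing \<phi> vanish at the roots,
  so \<open>S * E\<close> is block triangular, and the block \<open>L\<close> is unitriangular
  because \<phi> is monic. The bound on \<open>l\<close> ensures that no row polynomial is
  truncated.\<close>

lemma power_rows_det_vandermonde:
  fixes \<rho> :: "nat \<Rightarrow> complex"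
  assumes l: "\<And>i. i < N \<Longrightarrow> l i < N + M"
  shows "power_rows_det N M l (\<Prod>i<N. [:- \<rho> i, 1:]) * (\<Prod>j<N. \<Prod>i<j. \<rho> j - \<rho> i) =
    Determinant.det (Matrix.mat N N (\<lambda>(i, j). \<rho> j ^ l i))"
proof -
  let ?n = "N + M"
  define \<phi> where "\<phi> = (\<Prod>i<N. [:- \<rho> i, 1:])"
  have deg\<phi>: "degree \<phi> = N"
    unfolding \<phi>_def by (subst degree_prod_eq_sum_degree) auto
  have lead: "coeff \<phi> N = 1"
    using deg\<phi> monic_prod[of "{..<N}" "\<lambda>i. [:- \<rho> i, 1:]"] by (simp add: \<phi>_def)
  define R where "R i = (if i < N then monom 1 (l i) else \<phi> * monom 1 (i - N))" for i
  have degR: "degree (R i) < ?n" if "i < ?n" for i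
  proof (cases "i < N")
    case True
    then show ?thesis using l[of i] by (simp add: R_def degree_monom_eq)
  next
    case False
    have "degree (R i) \<le> degree \<phi> + degree (monom (1::complex) (i - N))"
      using False by (simp add: R_def degree_mult_le)
    then show ?thesis using False that by (simp add: deg\<phi> degree_monom_eq)
  qed
  define S where "S = Matrix.mat ?n ?n (\<lambda>(i, j). coeff (R i) j)"
  define V where "V = Matrix.mat N N (\<lambda>(i, j). \<rho> j ^ i)"
  define T where "T = Matrix.mat N N (\<lambda>(i, j). \<rho> j ^ l i)"
  define C where "C = Matrix.mat M N (\<lambda>(i, j). \<rho> j ^ (N + i))"
  define B where "B = Matrix.mat N M (\<lambda>(i, j). coeff (R i) (N + j))"
  define L where "L = Matrix.mat M M (\<lambda>(i, j). coeff (R (N + i)) (N + j))"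
  define E where "E = four_block_mat V (0\<^sub>m N M) C (1\<^sub>m M)"
  have carr: "S \<in> carrier_mat ?n ?n" "V \<in> carrier_mat N N" "T \<in> carrier_mat N N"
    "C \<in> carrier_mat M N" "B \<in> carrier_mat N M" "L \<in> carrier_mat M M"
    "E \<in> carrier_mat ?n ?n"
    by (auto simp: S_def V_def T_def C_def B_def L_def E_def)
  have E_index: "E $$ (c, j) = (if j < N then \<rho> j ^ c else if c = j then 1 else 0)"
    if "c < ?n" "j < ?n" for c j
    using that by (auto simp: E_def V_def C_def)
  have SE: "S * E = four_block_mat T B (0\<^sub>m M N) L"
  proof (rule eq_matI)
    fix i j
    assume "i < dim_row (four_block_mat T B (0\<^sub>m M N) L)"
      "j < dim_col (four_block_mat T B (0\<^sub>m M N) L)"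
    then have ij: "i < ?n" "j < ?n" using carr by auto
    have "(S * E) $$ (i, j) = (\<Sum>c<?n. coeff (R i) c * E $$ (c, j))"
      using ij carr by (auto simp: scalar_prod_def S_def atLeast0LessThan intro!: sum.cong)
    also have "\<dots> = (\<Sum>c<?n. coeff (R i) c * (if j < N then \<rho> j ^ c else if c = j then 1 else 0))"
      by (intro sum.cong refl, subst E_index) (use ij in auto)
    also have "\<dots> = (if j < N then poly (R i) (\<rho> j) else coeff (R i) j)"
    proof (cases "j < N")
      case True
      have "(\<Sum>c<?n. coeff (R i) c * \<rho> j ^ c) = (\<Sum>c\<le>degree (R i). coeff (R i) c * \<rho> j ^ c)"
        by (rule sum.mono_neutral_right) (use degR[OF ij(1)] in \<open>auto simp: coeff_eq_0\<close>)
      then show ?thesis using True by (simp add: poly_altdef)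
    next
      case False
      have "(\<Sum>c<?n. coeff (R i) c * (if c = j then 1 else 0)) =
          (\<Sum>c\<in>{j}. coeff (R i) c * (if c = j then 1 else 0))"
        by (rule sum.mono_neutral_right) (use ij in auto)
      then show ?thesis using False by simp
    qed
    also have "\<dots> = four_block_mat T B (0\<^sub>m M N) L $$ (i, j)"
    proof (cases "i < N")
      case True
      then show ?thesis
        using ij by (auto simp: T_def B_def L_def R_def poly_monom)
    next
      case False
      have "poly \<phi> (\<rho> j) = 0" if "j < N"
        unfolding \<phi>_def poly_prod using that by (intro prod_zero bexI[of _ j]) auto
      then show ?thesis using False ij by (auto simp: T_def B_def L_def R_def)
    qed
    finally show "(S * E) $$ (i, j) = four_block_mat T B (0\<^sub>m M N) L $$ (i, j)" .
  qed (use carr in auto)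
  have "Determinant.det S * Determinant.det E = Determinant.det (S * E)"
    using det_mult[of S ?n E] carr by simp
  also have "\<dots> = Determinant.det T * Determinant.det L"
    unfolding SE by (rule det_four_block_mat_lower_left_zero[OF carr(3,5) refl carr(6)])
  also have "Determinant.det L = 1"
  proof -
    have "Determinant.det L = prod_list (diag_mat L)"
      by (rule det_lower_triangular[where n = M])
        (auto simp: L_def R_def coeff_mult_monom_one coeff_eq_0 deg\<phi>)
    then show ?thesis
      by (simp add: L_def prod_list_diag_mat R_def coeff_mult_monom_one lead)
  qed
  also have "Determinant.det E = Determinant.det V * Determinant.det (1\<^sub>m M)"
    unfolding E_def by (rule det_four_block_mat_upper_right_zero[OF carr(2) refl carr(4)]) simp
  finally show ?thesis
    by (simp add: det_vandermonde V_def T_def S_def R_def power_rows_det_def coeff_det_def flip: \<phi>_def)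
qed

section \<open>Alternating forms on resolvents\<close>

locale alternating_form =
  fixes \<omega> :: "complex poly \<Rightarrow> complex poly \<Rightarrow> complex"
  assumes add_left: "\<omega> (p + p') q = \<omega> p q + \<omega> p' q"
    and add_right: "\<omega> p (q + q') = \<omega> p q + \<omega> p q'"
    and smult_left: "\<omega> (Polynomial.smult c p) q = c * \<omega> p q"
    and smult_right: "\<omega> p (Polynomial.smult c q) = c * \<omega> p q"
    and same: "\<omega> p p = 0"
begin

lemma swap: "\<omega> q p = - \<omega> p q"
proof -
  have "\<omega> (p + q) (p + q) = \<omega> p p + \<omega> p q + \<omega> q p + \<omega> q q"
    by (simp add: add_left add_right)
  then show ?thesis by (simp add: same eq_neg_iff_add_eq_0 add.commute)
qed

lemma zero_left [simp]: "\<omega> 0 q = 0" and zero_right [simp]: "\<omega> p 0 = 0"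
  using smult_left[of 0 0 q] smult_right[of p 0 0] by auto

lemma sum_left: "\<omega> (\<Sum>i\<in>I. f i) q = (\<Sum>i\<in>I. \<omega> (f i) q)"
  by (induction I rule: infinite_finite_induct) (auto simp: add_left)

lemma sum_right: "\<omega> p (\<Sum>i\<in>I. f i) = (\<Sum>i\<in>I. \<omega> p (f i))"
  by (induction I rule: infinite_finite_induct) (auto simp: add_right)

end

definition coeff_mat :: "nat \<Rightarrow> complex poly mat \<Rightarrow> complex mat" where
  "coeff_mat m A = Matrix.mat (dim_row A) (dim_col A) (\<lambda>ij. coeff (A $$ ij) m)"

text \<open>Abstracts from \<open>A = adj (z - Y)\<close> and \<open>\<phi> = det (z - Y)\<close>.\<close>

locale resolvent_polynomial =
  fixes n :: nat and Y :: "complex mat" and A :: "complex poly mat" and \<phi> :: "complex poly"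
  assumes Y: "Y \<in> carrier_mat n n" and A: "A \<in> carrier_mat n n"
    and left: "\<And>i j. i < n \<Longrightarrow> j < n \<Longrightarrow> A $$ (i, j) * monom 1 1 =
      (\<Sum>k<n. Polynomial.smult (Y $$ (i, k)) (A $$ (k, j))) + (if i = j then \<phi> else 0)"
    and right: "\<And>i j. i < n \<Longrightarrow> j < n \<Longrightarrow> A $$ (i, j) * monom 1 1 =
      (\<Sum>k<n. Polynomial.smult (Y $$ (k, j)) (A $$ (i, k))) + (if i = j then \<phi> else 0)"
begin

lemma coeff_mat_carrier [simp]: "coeff_mat m A \<in> carrier_mat n n"
  using A by (simp add: coeff_mat_def)

text \<open>Comparison of coefficients in \<open>(z - Y) A = \<phi>\<close>: the Faddeev-LeVerrier
  recursion, descending from the top coefficient.\<close>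

lemma coeff_mat_left:
  "coeff_mat m A = Y * coeff_mat (Suc m) A + coeff \<phi> (Suc m) \<cdot>\<^sub>m 1\<^sub>m n"
proof (rule eq_matI)
  fix i j assume "i < dim_row (Y * coeff_mat (Suc m) A + coeff \<phi> (Suc m) \<cdot>\<^sub>m 1\<^sub>m n)"
    "j < dim_col (Y * coeff_mat (Suc m) A + coeff \<phi> (Suc m) \<cdot>\<^sub>m 1\<^sub>m n)"
  then have ij: "i < n" "j < n" using Y A by auto
  have "coeff (A $$ (i, j)) m = coeff (A $$ (i, j) * monom 1 1) (Suc m)"
    by (simp add: coeff_mult_monom_one)
  also have "\<dots> = (\<Sum>k<n. Y $$ (i, k) * coeff (A $$ (k, j)) (Suc m)) +
      (if i = j then coeff \<phi> (Suc m) else 0)"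
    unfolding left[OF ij] by (simp add: coeff_sum)
  finally show "coeff_mat m A $$ (i, j) =
      (Y * coeff_mat (Suc m) A + coeff \<phi> (Suc m) \<cdot>\<^sub>m 1\<^sub>m n) $$ (i, j)"
    using ij Y A by (auto simp: coeff_mat_def scalar_prod_def atLeast0LessThan intro!: sum.cong)
qed (use Y A in \<open>auto simp: coeff_mat_def\<close>)

lemma coeff_mat_right:
  "coeff_mat m A = coeff_mat (Suc m) A * Y + coeff \<phi> (Suc m) \<cdot>\<^sub>m 1\<^sub>m n"
proof (rule eq_matI)
  fix i j assume "i < dim_row (coeff_mat (Suc m) A * Y + coeff \<phi> (Suc m) \<cdot>\<^sub>m 1\<^sub>m n)"
    "j < dim_col (coeff_mat (Suc m) A * Y + coeff \<phi> (Suc m) \<cdot>\<^sub>m 1\<^sub>m n)"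
  then have ij: "i < n" "j < n" using Y A by auto
  have "coeff (A $$ (i, j)) m = coeff (A $$ (i, j) * monom 1 1) (Suc m)"
    by (simp add: coeff_mult_monom_one)
  also have "\<dots> = (\<Sum>k<n. Y $$ (k, j) * coeff (A $$ (i, k)) (Suc m)) +
      (if i = j then coeff \<phi> (Suc m) else 0)"
    unfolding right[OF ij] by (simp add: coeff_sum)
  finally show "coeff_mat m A $$ (i, j) =
      (coeff_mat (Suc m) A * Y + coeff \<phi> (Suc m) \<cdot>\<^sub>m 1\<^sub>m n) $$ (i, j)"
    using ij Y A
    by (auto simp: coeff_mat_def scalar_prod_def atLeast0LessThan mult.commute intro!: sum.cong)
qed (use Y A in \<open>auto simp: coeff_mat_def\<close>)

definition coeff_bound :: nat where
  "coeff_bound = (\<Sum>i<n. \<Sum>j<n. Suc (degree (A $$ (i, j))))"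

lemma coeff_bound: "i < n \<Longrightarrow> j < n \<Longrightarrow> degree (A $$ (i, j)) < coeff_bound"
proof -
  assume ij: "i < n" "j < n"
  have "Suc (degree (A $$ (i, j))) \<le> (\<Sum>j<n. Suc (degree (A $$ (i, j))))"
    using ij by (intro member_le_sum) auto
  also have "\<dots> \<le> coeff_bound"
    unfolding coeff_bound_def using ij
    by (intro member_le_sum[of i "{..<n}" "\<lambda>i. \<Sum>j<n. Suc (degree (A $$ (i, j)))"]) auto
  finally show ?thesis by simp
qed

text \<open>Descending from the coefficients beyond \<open>coeff_bound\<close>, which vanish, every
  coefficient matrix is built from \<open>Y\<close> and scalars.\<close>

lemma commute_coeff_mat:
  assumes X: "X \<in> carrier_mat n n" "X * Y = Y * X"
  shows "X * coeff_mat m A = coeff_mat m A * X"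
proof (induction "coeff_bound - m" arbitrary: m)
  case 0
  then have "coeff_mat m A = 0\<^sub>m n n"
    using A coeff_bound by (intro eq_matI) (force simp: coeff_mat_def intro!: coeff_eq_0)+
  then show ?case using X by simp
next
  case (Suc d)
  let ?A = "coeff_mat (Suc m) A" and ?c = "coeff \<phi> (Suc m) \<cdot>\<^sub>m 1\<^sub>m n"
  have IH: "X * ?A = ?A * X" using Suc by simp
  have "X * coeff_mat m A = X * (Y * ?A) + X * ?c"
    unfolding coeff_mat_left[of m] using X Y by (intro mult_add_distrib_mat[of _ n n _ n]) auto
  also have "X * (Y * ?A) = Y * ?A * X"
    using X(2) IH assoc_mult_mat[OF X(1) Y, of ?A n] assoc_mult_mat[OF Y X(1), of ?A n]
      assoc_mult_mat[OF Y _ X(1), of ?A] by simp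
  also have "X * ?c = ?c * X" using X 
    by (simp add: mult_smult_distrib[OF X(1), of "1\<^sub>m n" n] mult_smult_assoc_mat[of "1\<^sub>m n" n n X n])
  also have "Y * ?A * X + ?c * X = coeff_mat m A * X"
    unfolding coeff_mat_left[of m]
    using X Y by (intro add_mult_distrib_mat[symmetric, of _ n n _ _ n]) auto
  finally show ?case .
qed

lemma coeff_mat_commute: "coeff_mat m A * coeff_mat m' A = coeff_mat m' A * coeff_mat m A"
proof (rule commute_coeff_mat)
  show "coeff_mat m A * Y = Y * coeff_mat m A"
    by (rule commute_coeff_mat[symmetric]) (use Y in auto)
qed simp

text \<open>A diagonal entry of \<open>coeff_mat_commute\<close>. Contracted with an alternating
  form, this symmetry makes \<open>pair\<close> antisymmetric.\<close>

lemma sum_coeff_symmetric: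
  assumes "K < n"
  shows "(\<Sum>i<n. coeff (A $$ (i, K)) m * coeff (A $$ (K, i)) m') =
    (\<Sum>i<n. coeff (A $$ (i, K)) m' * coeff (A $$ (K, i)) m)"
proof -
  have "(coeff_mat a A * coeff_mat b A) $$ (K, K) =
      (\<Sum>i<n. coeff (A $$ (i, K)) b * coeff (A $$ (K, i)) a)" for a b
    using assms A by (auto simp: coeff_mat_def scalar_prod_def atLeast0LessThan intro!: sum.cong)
  then show ?thesis using coeff_mat_commute[of m' m] by metis
qed

end

locale resolvent_form = resolvent_polynomial + alternating_form
begin

text \<open>Column and row \<open>K\<close> of the resolvent contracted over \<open>i\<close>: the
  shape in which infinitesimal rotations, summed over the planes, change two rows of a
  determinant.\<close>

definition pair :: "nat \<Rightarrow> nat \<Rightarrow> nat \<Rightarrow> complex" where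
  "pair K p q = (\<Sum>i<n. \<omega> (A $$ (i, K) * monom 1 p) (A $$ (K, i) * monom 1 q))"

text \<open>The coefficient matrices of the resolvent commute, being polynomials in \<open>Y\<close>.\<close>

lemma pair_antisym:
  assumes "K < n"
  shows "pair K p q = - pair K q p"
proof -
  let ?D = coeff_bound
  define G where "G m m' = (\<Sum>i<n. coeff (A $$ (i, K)) m * coeff (A $$ (K, i)) m')" for m m'
  have expand: "A $$ (i, j) * monom 1 p =
      (\<Sum>m<?D. Polynomial.smult (coeff (A $$ (i, j)) m) (monom 1 (m + p)))" if "i < n" "j < n" for i j p
  proof -
    have "A $$ (i, j) = (\<Sum>m\<le>degree (A $$ (i, j)). monom (coeff (A $$ (i, j)) m) m)"
      by (rule poly_as_sum_of_monoms[symmetric])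
    also have "\<dots> = (\<Sum>m<?D. monom (coeff (A $$ (i, j)) m) m)"
      by (rule sum.mono_neutral_left) (use coeff_bound[OF that] in \<open>auto simp: coeff_eq_0\<close>)
    finally have "A $$ (i, j) * monom 1 p = (\<Sum>m<?D. monom (coeff (A $$ (i, j)) m) m) * monom 1 p"
      by simp
    then show ?thesis by (simp add: sum_distrib_right mult_monom smult_monom)
  qed
  have main: "pair K p q = (\<Sum>m<?D. \<Sum>m'<?D. G m m' * \<omega> (monom 1 (m + p)) (monom 1 (m' + q)))"
    for p q
  proof -
    have "pair K p q = (\<Sum>i<n. \<Sum>m<?D. \<Sum>m'<?D. coeff (A $$ (i, K)) m * (coeff (A $$ (K, i)) m' *
        \<omega> (monom 1 (m + p)) (monom 1 (m' + q))))"
      unfolding pair_def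
      using assms by (intro sum.cong refl)
        (simp add: expand sum_left smult_left, simp add: sum_right smult_right sum_distrib_left)
    also have "\<dots> = (\<Sum>m<?D. \<Sum>i<n. \<Sum>m'<?D. coeff (A $$ (i, K)) m * (coeff (A $$ (K, i)) m' *
        \<omega> (monom 1 (m + p)) (monom 1 (m' + q))))"
      by (rule sum.swap)
    also have "\<dots> = (\<Sum>m<?D. \<Sum>m'<?D. \<Sum>i<n. coeff (A $$ (i, K)) m * (coeff (A $$ (K, i)) m' *
        \<omega> (monom 1 (m + p)) (monom 1 (m' + q))))"
      by (intro sum.cong refl sum.swap)
    finally show ?thesis by (simp add: G_def sum_distrib_right mult.assoc)
  qed
  have G_sym: "G m m' = G m' m" for m m'
    unfolding G_def by (rule sum_coeff_symmetric[OF assms])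
  have "pair K p q = (\<Sum>m<?D. \<Sum>m'<?D. G m' m * - \<omega> (monom 1 (m' + q)) (monom 1 (m + p)))"
    unfolding main
    by (intro sum.cong refl arg_cong2[of _ _ _ _ "(*)"] G_sym swap)
  also have "\<dots> = - (\<Sum>m'<?D. \<Sum>m<?D. G m' m * \<omega> (monom 1 (m' + q)) (monom 1 (m + p)))"
    by (subst sum.swap) (simp add: sum_negf)
  finally show ?thesis by (simp add: main)
qed

text \<open>A factor \<open>z\<close> on \<open>A $$ (K, i)\<close> is traded for \<open>Y\<close>,
  which then acts on \<open>A $$ (i, K)\<close> and turns back into \<open>z\<close>. Each exchange
  leaves one term with \<phi>, on the diagonal.\<close>

lemma pair_shift:
  assumes K: "K < n"
  shows "pair K p (Suc q) = pair K (Suc p) q +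
    \<omega> (A $$ (K, K) * monom 1 p) (\<phi> * monom 1 q) + \<omega> (A $$ (K, K) * monom 1 q) (\<phi> * monom 1 p)"
proof -
  have mono: "monom (1::complex) (Suc q) = monom 1 1 * monom 1 q" for q
    by (simp add: mult_monom)
  have "pair K p (Suc q) = (\<Sum>i<n. (\<Sum>l<n. Y $$ (l, i) * \<omega> (A $$ (i, K) * monom 1 p) (A $$ (K, l) * monom 1 q)) +
      (if K = i then \<omega> (A $$ (i, K) * monom 1 p) (\<phi> * monom 1 q) else 0))"
    unfolding pair_def
  proof (intro sum.cong refl)
    fix i assume "i \<in> {..<n}"
    then have i: "i < n" by simp
    have "A $$ (K, i) * monom 1 (Suc q) = (A $$ (K, i) * monom 1 1) * monom 1 q"
      by (simp add: mono[of q] mult.assoc)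
    also have "\<dots> = (\<Sum>l<n. Polynomial.smult (Y $$ (l, i)) (A $$ (K, l) * monom 1 q)) +
        (if K = i then \<phi> * monom 1 q else 0)"
      unfolding right[OF K i] by (simp add: distrib_right sum_distrib_right)
    finally show "\<omega> (A $$ (i, K) * monom 1 p) (A $$ (K, i) * monom 1 (Suc q)) =
        (\<Sum>l<n. Y $$ (l, i) * \<omega> (A $$ (i, K) * monom 1 p) (A $$ (K, l) * monom 1 q)) +
      (if K = i then \<omega> (A $$ (i, K) * monom 1 p) (\<phi> * monom 1 q) else 0)"
      by (auto simp: add_right sum_right smult_right)
  qed
  also have "\<dots> = (\<Sum>i<n. \<Sum>l<n. Y $$ (l, i) * \<omega> (A $$ (i, K) * monom 1 p) (A $$ (K, l) * monom 1 q)) +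
      \<omega> (A $$ (K, K) * monom 1 p) (\<phi> * monom 1 q)"
    using K by (simp add: sum.distrib)
  also have "(\<Sum>i<n. \<Sum>l<n. Y $$ (l, i) * \<omega> (A $$ (i, K) * monom 1 p) (A $$ (K, l) * monom 1 q)) =
      (\<Sum>l<n. \<Sum>i<n. Y $$ (l, i) * \<omega> (A $$ (i, K) * monom 1 p) (A $$ (K, l) * monom 1 q))"
    by (rule sum.swap)
  also have "\<dots> = (\<Sum>l<n. \<omega> (A $$ (l, K) * monom 1 (Suc p)) (A $$ (K, l) * monom 1 q) +
      (if l = K then - \<omega> (\<phi> * monom 1 p) (A $$ (K, l) * monom 1 q) else 0))"
  proof (intro sum.cong refl)
    fix l assume "l \<in> {..<n}"
    then have l: "l < n" by simp
    have "A $$ (l, K) * monom 1 (Suc p) = (A $$ (l, K) * monom 1 1) * monom 1 p"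
      by (simp add: mono[of p] mult.assoc)
    also have "\<dots> = (\<Sum>i<n. Polynomial.smult (Y $$ (l, i)) (A $$ (i, K) * monom 1 p)) +
        (if l = K then \<phi> * monom 1 p else 0)"
      unfolding left[OF l K] by (simp add: distrib_right sum_distrib_right)
    finally show "(\<Sum>i<n. Y $$ (l, i) * \<omega> (A $$ (i, K) * monom 1 p) (A $$ (K, l) * monom 1 q)) =
      \<omega> (A $$ (l, K) * monom 1 (Suc p)) (A $$ (K, l) * monom 1 q) +
      (if l = K then - \<omega> (\<phi> * monom 1 p) (A $$ (K, l) * monom 1 q) else 0)"
      by (auto simp: add_left sum_left smult_left)
  qed
  also have "\<dots> = pair K (Suc p) q - \<omega> (\<phi> * monom 1 p) (A $$ (K, K) * monom 1 q)"
    using K by (simp add: sum.distrib pair_def)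
  finally show ?thesis
    using swap[of "\<phi> * monom 1 p" "A $$ (K, K) * monom 1 q"] by simp
qed

lemma pair_iterate:
  assumes K: "K < n"
  shows "pair K p (q + d) = pair K (p + d) q +
    (\<Sum>e<d. \<omega> (A $$ (K, K) * monom 1 (p + e)) (\<phi> * monom 1 (q + d - 1 - e)) +
      \<omega> (A $$ (K, K) * monom 1 (q + d - 1 - e)) (\<phi> * monom 1 (p + e)))"
proof (induction d arbitrary: p)
  case (Suc d)
  have "pair K p (q + Suc d) = pair K (Suc p) (q + d) +
    \<omega> (A $$ (K, K) * monom 1 p) (\<phi> * monom 1 (q + d)) + \<omega> (A $$ (K, K) * monom 1 (q + d)) (\<phi> * monom 1 p)"
    using pair_shift[OF K, of p "q + d"] by simp
  then show ?case
    unfolding Suc.IH by (subst sum.lessThan_Suc_shift) (simp add: algebra_simps)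
qed simp

text \<open>Moving the powers of \<open>z\<close> from the second slot to the first all the way reverses the roles of
  \<open>j\<close> and \<open>r\<close>, which by antisymmetry changes the sign.\<close>

lemma pair_eq:
  assumes K: "K < n" and jr: "j < r"
    and vanish: "\<And>p q. j < p \<Longrightarrow> p < r \<Longrightarrow> \<omega> (A $$ (K, K) * monom 1 p) q = 0"
  shows "pair K j r = \<omega> (A $$ (K, K) * monom 1 j) (\<phi> * monom 1 (r - 1))"
proof -
  let ?t = "\<lambda>p. \<omega> (A $$ (K, K) * monom 1 p) (\<phi> * monom 1 (j + r - 1 - p))"
  define d where "d = r - j"
  have d: "d > 0" "r = j + d" using jr by (auto simp: d_def)
  have zero: "?t p = 0" if "j < p" "p < r" for p using vanish that by simp
  have "pair K j r = pair K r j + (\<Sum>e<d. ?t (j + e) + ?t (j + d - 1 - e))"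
    using pair_iterate[OF K, of j j d] unfolding d(2)
    by (auto simp: algebra_simps intro!: sum.cong)
  also have "(\<Sum>e<d. ?t (j + e) + ?t (j + d - 1 - e)) = (\<Sum>e<d. ?t (j + e)) + (\<Sum>e<d. ?t (j + d - 1 - e))"
    by (rule sum.distrib)
  \<comment> \<open>Reflecting the index makes the two correction sums equal, and by
    \<open>vanish\<close> only \<open>e = 0\<close> survives, so the correction is twice one term.
    The equation with \<open>pair K r j = - pair K j r\<close> then determines the left
    side.\<close>
  also have "(\<Sum>e<d. ?t (j + d - 1 - e)) = (\<Sum>e<d. ?t (j + (d - Suc e)))"
    by (intro sum.cong refl arg_cong[where f = ?t]) auto
  also have "\<dots> = (\<Sum>e<d. ?t (j + e))"
    by (rule sum.nat_diff_reindex)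
  also have "(\<Sum>e<d. ?t (j + e)) = (\<Sum>e\<in>{0}. ?t (j + e))"
  proof (rule sum.mono_neutral_right)
    show "\<forall>e\<in>{..<d} - {0}. ?t (j + e) = 0"
      using d by (intro ballI zero) auto
  qed (use d in auto)
  finally have "pair K j r = pair K r j + 2 * ?t j" by simp
  moreover have "x = t" if "x = y + 2 * t" "y = - x" for x y t :: complex
  proof -
    have "x + x = x + (- x + 2 * t)" using that by metis
    then have "2 * x = 2 * t" by (simp only: add_minus_cancel mult_2)
    then show ?thesis by simp
  qed
  ultimately have "pair K j r = ?t j"
    using pair_antisym[OF K, of r j] by blast
  then show ?thesis using d by simp
qed

end

section \<open>Determinants depending polynomially on a parameter\<close>

lemma pderiv_det:
  fixes A :: "'a::idom poly mat"
  assumes A: "A \<in> carrier_mat n n"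
  shows "pderiv (Determinant.det A) = (\<Sum>k<n. Determinant.det
    (Matrix.mat n n (\<lambda>(i, j). if i = k then pderiv (A $$ (i, j)) else A $$ (i, j))))"
proof -
  let ?P = "{p. p permutes {0..<n}}"
  let ?B = "\<lambda>k. Matrix.mat n n (\<lambda>(i, j). if i = k then pderiv (A $$ (i, j)) else A $$ (i, j))"
  have inner: "pderiv (signof p * (\<Prod>i = 0..<n. A $$ (i, p i))) =
      (\<Sum>k<n. signof p * (\<Prod>i = 0..<n. ?B k $$ (i, p i)))" if p: "p permutes {0..<n}" for p
  proof -
    have "pderiv (signof p * (\<Prod>i = 0..<n. A $$ (i, p i))) =
        signof p * pderiv (\<Prod>i = 0..<n. A $$ (i, p i))"
      by (cases "sign p = 1") (auto simp: sign_def pderiv_minus)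
    also have "pderiv (\<Prod>i = 0..<n. A $$ (i, p i)) =
        (\<Sum>k = 0..<n. (\<Prod>i\<in>{0..<n} - {k}. A $$ (i, p i)) * pderiv (A $$ (k, p k)))"
      by (rule pderiv_prod)
    also have "\<dots> = (\<Sum>k<n. \<Prod>i = 0..<n. ?B k $$ (i, p i))"
    proof (intro sum.cong)
      fix k assume "k \<in> {..<n}"
      then have k: "k \<in> {0..<n}" by auto
      have "(\<Prod>i = 0..<n. ?B k $$ (i, p i)) =
          ?B k $$ (k, p k) * (\<Prod>i\<in>{0..<n} - {k}. ?B k $$ (i, p i))"
        by (rule prod.remove) (use k in auto)
      also have "(\<Prod>i\<in>{0..<n} - {k}. ?B k $$ (i, p i)) = (\<Prod>i\<in>{0..<n} - {k}. A $$ (i, p i))"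
        using p permutes_in_image[OF p] by (intro prod.cong) auto
      also have "?B k $$ (k, p k) = pderiv (A $$ (k, p k))"
        using k p permutes_in_image[OF p, of k] by auto
      finally show "(\<Prod>i\<in>{0..<n} - {k}. A $$ (i, p i)) * pderiv (A $$ (k, p k)) =
          (\<Prod>i = 0..<n. ?B k $$ (i, p i))"
        by (simp add: mult.commute)
    qed auto
    finally show ?thesis by (simp only: sum_distrib_left)
  qed
  have "pderiv (Determinant.det A) =
      (\<Sum>p\<in>?P. pderiv (signof p * (\<Prod>i = 0..<n. A $$ (i, p i))))"
    unfolding det_def'[OF A] by (rule pderiv_sum)
  also have "\<dots> = (\<Sum>p\<in>?P. \<Sum>k<n. signof p * (\<Prod>i = 0..<n. ?B k $$ (i, p i)))"
    by (intro sum.cong refl inner) simp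
  also have "\<dots> = (\<Sum>k<n. \<Sum>p\<in>?P. signof p * (\<Prod>i = 0..<n. ?B k $$ (i, p i)))"
    by (rule sum.swap)
  also have "\<dots> = (\<Sum>k<n. Determinant.det (?B k))"
    by (intro sum.cong refl det_def'[symmetric]) simp
  finally show ?thesis .
qed

text \<open>The polynomial variable here is a parameter \<open>t\<close>, not the variable
  \<open>z\<close> of the rows: at \<open>t\<close>, row \<open>i\<close> is
  \<open>p i + t q i + t^2 s i\<close>.\<close>

definition quadratic_det ::
  "nat \<Rightarrow> (nat \<Rightarrow> complex poly) \<Rightarrow> (nat \<Rightarrow> complex poly) \<Rightarrow> (nat \<Rightarrow> complex poly) \<Rightarrow> complex poly" where
  "quadratic_det n p q s = Determinant.det
     (Matrix.mat n n (\<lambda>(i, j). [:coeff (p i) j, coeff (q i) j, coeff (s i) j:]))"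

lemma poly_det:
  fixes A :: "'a::comm_ring_1 poly mat"
  shows "poly (Determinant.det A) t = Determinant.det (map_mat (\<lambda>p. poly p t) A)"
  by (rule comm_ring_hom.hom_det[symmetric]) (unfold_locales, auto)

lemma poly_quadratic_det:
  "poly (quadratic_det n p q s) t =
     coeff_det n (\<lambda>i. p i + Polynomial.smult t (q i) + Polynomial.smult (t\<^sup>2) (s i))"
  unfolding quadratic_det_def poly_det coeff_det_def
  by (intro arg_cong[where f = Determinant.det] eq_matI) (auto simp: algebra_simps power2_eq_square)

lemma coeff_quadratic_det_1:
  "coeff (quadratic_det n p q s) 1 = (\<Sum>k<n. coeff_det n (p(k := q k)))"
proof -
  have "coeff (quadratic_det n p q s) 1 = poly (pderiv (quadratic_det n p q s)) 0"
    by (simp add: poly_0_coeff_0 coeff_pderiv)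
  also have "\<dots> = (\<Sum>k<n. coeff_det n (p(k := q k)))"
    unfolding quadratic_det_def
    by (subst pderiv_det[where n = n])
      (auto simp: poly_sum poly_det coeff_det_def pderiv_pCons
        intro!: sum.cong arg_cong[where f = Determinant.det] eq_matI)
  finally show ?thesis .
qed

lemma degree_quadratic_det: "degree (quadratic_det n p q s) \<le> 2 * n"
  unfolding quadratic_det_def by (rule degree_det_le) (auto simp: degree_pCons_le)

lemma coeff_det_smult_rows:
  "coeff_det n (\<lambda>i. Polynomial.smult (d i) (R i)) = (\<Prod>i<n. d i) * coeff_det n R"
proof -
  let ?A = "Matrix.mat n n (\<lambda>(i, j). coeff (R i) j)"
  let ?B = "Matrix.mat n n (\<lambda>(i, j). coeff (Polynomial.smult (d i) (R i)) j)"
  have "Determinant.det ?B =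
      (\<Sum>p\<in>{p. p permutes {0..<n}}. signof p * (\<Prod>i = 0..<n. ?B $$ (i, p i)))"
    by (rule det_def') simp
  also have "\<dots> = (\<Sum>p\<in>{p. p permutes {0..<n}}. (\<Prod>i<n. d i) * (signof p * (\<Prod>i = 0..<n. ?A $$ (i, p i))))"
  proof (intro sum.cong refl)
    fix p assume "p \<in> {p. p permutes {0..<n}}"
    then have p: "p permutes {0..<n}" by simp
    have "(\<Prod>i = 0..<n. ?B $$ (i, p i)) = (\<Prod>i = 0..<n. d i * ?A $$ (i, p i))"
      using permutes_in_image[OF p] by (intro prod.cong) auto
    then show "signof p * (\<Prod>i = 0..<n. ?B $$ (i, p i)) =
        (\<Prod>i<n. d i) * (signof p * (\<Prod>i = 0..<n. ?A $$ (i, p i)))"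
      by (simp add: prod.distrib atLeast0LessThan)
  qed
  also have "\<dots> = (\<Prod>i<n. d i) * Determinant.det ?A"
    by (subst det_def'[of ?A n]) (simp_all add: sum_distrib_left)
  finally show ?thesis by (simp add: coeff_det_def)
qed

section \<open>The adjugate of the characteristic matrix\<close>

abbreviation resolvent :: "complex mat \<Rightarrow> complex poly mat" where
  "resolvent Y \<equiv> adj_mat (char_poly_matrix Y)"

lemma resolvent_carrier: "Y \<in> carrier_mat n n \<Longrightarrow> resolvent Y \<in> carrier_mat n n"
  by (intro adj_mat(1)) simp

lemma resolvent_polynomial_resolvent:
  assumes Y: "Y \<in> carrier_mat n n"
  shows "resolvent_polynomial n Y (resolvent Y) (char_poly Y)"
proof
  let ?M = "char_poly_matrix Y" and ?A = "resolvent Y"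
  have M: "?M \<in> carrier_mat n n" and A: "?A \<in> carrier_mat n n"
    using Y adj_mat(1)[of ?M n] by auto
  have M_index: "?M $$ (i, j) = (if i = j then monom 1 1 else 0) - [:Y $$ (i, j):]"
    if "i < n" "j < n" for i j
    using that Y by (auto simp: char_poly_matrix_def x_as_monom)
  show "?A $$ (i, j) * monom 1 1 =
      (\<Sum>k<n. Polynomial.smult (Y $$ (i, k)) (?A $$ (k, j))) + (if i = j then char_poly Y else 0)"
    if ij: "i < n" "j < n" for i j
  proof -
    have "(?M * ?A) $$ (i, j) = (\<Sum>k<n. ?M $$ (i, k) * ?A $$ (k, j))"
      using ij M A by (simp add: scalar_prod_def atLeast0LessThan)
    also have "\<dots> = (\<Sum>k<n. (if i = k then monom 1 1 * ?A $$ (k, j) else 0) -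
        Polynomial.smult (Y $$ (i, k)) (?A $$ (k, j)))"
      using ij by (intro sum.cong) (auto simp: M_index algebra_simps)
    also have "\<dots> = monom 1 1 * ?A $$ (i, j) - (\<Sum>k<n. Polynomial.smult (Y $$ (i, k)) (?A $$ (k, j)))"
      using ij by (simp add: sum_subtractf)
    finally show ?thesis
      using ij unfolding adj_mat(2)[OF M] by (auto simp: char_poly_def algebra_simps)
  qed
  show "?A $$ (i, j) * monom 1 1 =
      (\<Sum>k<n. Polynomial.smult (Y $$ (k, j)) (?A $$ (i, k))) + (if i = j then char_poly Y else 0)"
    if ij: "i < n" "j < n" for i j
  proof -
    have "(?A * ?M) $$ (i, j) = (\<Sum>k<n. ?A $$ (i, k) * ?M $$ (k, j))"
      using ij M A by (simp add: scalar_prod_def atLeast0LessThan)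
    also have "\<dots> = (\<Sum>k<n. (if k = j then monom 1 1 * ?A $$ (i, k) else 0) -
        Polynomial.smult (Y $$ (k, j)) (?A $$ (i, k)))"
      using ij by (intro sum.cong) (auto simp: M_index algebra_simps)
    also have "\<dots> = monom 1 1 * ?A $$ (i, j) - (\<Sum>k<n. Polynomial.smult (Y $$ (k, j)) (?A $$ (i, k)))"
      using ij by (simp add: sum_subtractf)
    finally show ?thesis
      using ij unfolding adj_mat(3)[OF M] by (auto simp: char_poly_def algebra_simps)
  qed
qed (use Y resolvent_carrier in auto)

text \<open>For the last index this is the characteristic polynomial of the preceding leading block,
  so the resolvent of one block gives access to both successive characteristic polynomials.\<close>

lemma resolvent_diag:
  assumes Y: "Y \<in> carrier_mat n n" and i: "i < n"
  shows "resolvent Y $$ (i, i) = char_poly (mat_delete Y i i)"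
proof -
  have "mat_delete (char_poly_matrix Y) i i = char_poly_matrix (mat_delete Y i i)"
    using Y i by (intro eq_matI) (auto simp: mat_delete_def char_poly_matrix_def)
  moreover have "dim_row (char_poly_matrix Y) = n" "dim_col (char_poly_matrix Y) = n"
    using carrier_matD[OF char_poly_matrix_closed[OF Y]] by auto
  ultimately show ?thesis
    using Y i by (simp add: adj_mat_def cofactor_def char_poly_def)
qed

lemma resolvent_trace:
  assumes Y: "Y \<in> carrier_mat n n"
  shows "(\<Sum>i<n. resolvent Y $$ (i, i)) = pderiv (char_poly Y)"
  using pderiv_char_poly[OF Y] resolvent_diag[OF Y] by simp

text \<open>The conjugated adjugate \<open>?X\<close> satisfies \<open>?M' * ?X = ?d\<close> times
  the identity, as does the adjugate of \<open>?M'\<close>. The determinant \<open>?d\<close> is a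
  nonzero polynomial and cancels entrywise, so \<open>z - Y\<close> never has to be
  inverted.\<close>

lemma resolvent_conj:
  assumes Y: "Y \<in> carrier_mat n n" and v: "v \<in> carrier_mat n n" and w: "w \<in> carrier_mat n n"
    and vw: "v * w = 1\<^sub>m n" and wv: "w * v = 1\<^sub>m n"
  shows "resolvent (v * Y * w) =
      map_mat (\<lambda>a. [:a:]) v * resolvent Y * map_mat (\<lambda>a. [:a:]) w"
proof -
  let ?h = "\<lambda>a::complex. [:a:]"
  interpret h: comm_ring_hom ?h by unfold_locales (auto simp: one_pCons)
  let ?v = "map_mat ?h v" and ?w = "map_mat ?h w"
  let ?M = "char_poly_matrix Y" and ?M' = "char_poly_matrix (v * Y * w)"
  have carr: "?v \<in> carrier_mat n n" "?w \<in> carrier_mat n n" "?M \<in> carrier_mat n n"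
    "?M' \<in> carrier_mat n n" "adj_mat ?M \<in> carrier_mat n n" "adj_mat ?M' \<in> carrier_mat n n"
    using Y v w by (auto intro!: adj_mat(1))
  have VW: "?v * ?w = 1\<^sub>m n" "?w * ?v = 1\<^sub>m n"
    using h.mat_hom_mult[OF v w] h.mat_hom_mult[OF w v] vw wv by (simp_all add: h.mat_hom_one)
  have sim: "similar_mat (v * Y * w) Y"
    unfolding similar_mat_def similar_mat_wit_def
    using Y v w vw wv by (intro exI[of _ v] exI[of _ w]) (auto simp: Let_def)
  have cp: "Determinant.det ?M' = Determinant.det ?M"
    using char_poly_similar[OF sim] by (simp add: char_poly_def)
  have nz: "Determinant.det ?M \<noteq> 0"
    using degree_monic_char_poly[OF Y] by (auto simp: char_poly_def)
  have M: "?M = [:0, 1:] \<cdot>\<^sub>m 1\<^sub>m n + - map_mat ?h Y"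
    using Y by (intro eq_matI) (auto simp: char_poly_matrix_def)
  have vYw: "v * Y * w \<in> carrier_mat n n" using Y v w by auto
  have "?M' = [:0, 1:] \<cdot>\<^sub>m 1\<^sub>m n + - map_mat ?h (v * Y * w)"
    using vYw by (intro eq_matI) (auto simp: char_poly_matrix_def simp del: index_mult_mat(1))
  also have "map_mat ?h (v * Y * w) = ?v * map_mat ?h Y * ?w"
    using Y v w h.mat_hom_mult[OF v Y] h.mat_hom_mult[of "v * Y" n n w n] by simp
  finally have M'': "?M' = [:0, 1:] \<cdot>\<^sub>m 1\<^sub>m n + - (?v * map_mat ?h Y * ?w)" .
  have M': "?M' = ?v * ?M * ?w"
  proof -
    have "?v * ?M * ?w = ?v * ([:0, 1:] \<cdot>\<^sub>m 1\<^sub>m n) * ?w + ?v * (- map_mat ?h Y) * ?w"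
      unfolding M using carr Y
      by (simp add: mult_add_distrib_mat[of ?v n n _ n] add_mult_distrib_mat[of _ n n _ ?w n])
    also have "?v * ([:0, 1:] \<cdot>\<^sub>m 1\<^sub>m n) * ?w = [:0, 1:] \<cdot>\<^sub>m 1\<^sub>m n"
      using carr VW
      by (simp add: mult_smult_distrib[of ?v n n "1\<^sub>m n" n] mult_smult_assoc_mat[of ?v n n ?w n])
    also have "?v * (- map_mat ?h Y) * ?w = - (?v * map_mat ?h Y * ?w)"
      using carr Y
      by (simp add: uminus_mult_right_mat uminus_mult_left_mat)
    finally show ?thesis unfolding M'' ..
  qed
  let ?X = "?v * adj_mat ?M * ?w"
  let ?d = "Determinant.det ?M"
  have X: "?X \<in> carrier_mat n n" using carr by auto
  have "?M' * ?X = ?v * (?M * (?w * ?v) * adj_mat ?M) * ?w"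
    unfolding M' using carr by (simp add: assoc_mult_mat[of _ n n _ n _ n])
  also have "\<dots> = ?d \<cdot>\<^sub>m 1\<^sub>m n"
    using carr VW adj_mat(2)[OF carr(3)]
    by (simp add: mult_smult_distrib[of ?v n n "1\<^sub>m n" n] mult_smult_assoc_mat[of ?v n n ?w n])
  finally have MX: "?M' * ?X = ?d \<cdot>\<^sub>m 1\<^sub>m n" .
  have "?d \<cdot>\<^sub>m ?X = (?d \<cdot>\<^sub>m 1\<^sub>m n) * ?X"
    using left_mult_one_mat[OF X] mult_smult_assoc_mat[of "1\<^sub>m n" n n ?X n ?d] X by simp
  also have "\<dots> = adj_mat ?M' * ?M' * ?X"
    by (simp only: adj_mat(3)[OF carr(4)] cp)
  also have "\<dots> = adj_mat ?M' * (?M' * ?X)"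
    by (rule assoc_mult_mat[of _ n n _ n _ n]) (use carr X in auto)
  also have "\<dots> = ?d \<cdot>\<^sub>m adj_mat ?M'"
    unfolding MX using carr by (simp add: mult_smult_distrib[of _ n n "1\<^sub>m n" n])
  finally have eq: "?d \<cdot>\<^sub>m ?X = ?d \<cdot>\<^sub>m adj_mat ?M'" .
  show ?thesis
  proof (rule eq_matI)
    fix i j assume "i < dim_row ?X" "j < dim_col ?X"
    then have ij: "i < n" "j < n" using carr by auto
    have "(?d \<cdot>\<^sub>m ?X) $$ (i, j) = (?d \<cdot>\<^sub>m adj_mat ?M') $$ (i, j)"
      using eq by simp
    then have "?d * ?X $$ (i, j) = ?d * adj_mat ?M' $$ (i, j)"
      using ij carr X by (simp del: index_mult_mat)
    then show "adj_mat ?M' $$ (i, j) = ?X $$ (i, j)" using nz by simp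
  qed (use carr in auto)
qed

section \<open>Rotations in coordinate planes\<close>

text \<open>Interpolates between \<^const>\<open>power_rows_det\<close> for the block of size \<open>K\<close> (all rows past \<open>K\<close>
  contain \<open>f\<close>) and, up to a constant, for the block of size \<open>K + 1\<close> (all of them are derivatives).\<close>

definition mixed_rows ::
  "nat \<Rightarrow> (nat \<Rightarrow> nat) \<Rightarrow> complex poly \<Rightarrow> complex poly \<Rightarrow> nat \<Rightarrow> nat \<Rightarrow> complex poly" where
  "mixed_rows K l f \<phi> r i =
     (if i < K then monom 1 (l i) else if i - K < r then f * monom 1 (i - K)
      else pderiv (\<phi> * monom 1 (i - K)))"

lemma alternating_form_coeff_det:
  assumes "i < n" "j < n" "i \<noteq> j"
  shows "alternating_form (\<lambda>p q. coeff_det n (R(i := p, j := q)))"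
proof
  fix p p' q q' and c
  show "coeff_det n (R(i := p + p', j := q)) = coeff_det n (R(i := p, j := q)) + coeff_det n (R(i := p', j := q))"
    using assms by (simp add: fun_upd_twist[of i j] coeff_det_add)
  show "coeff_det n (R(i := p, j := q + q')) = coeff_det n (R(i := p, j := q)) + coeff_det n (R(i := p, j := q'))"
    using assms by (simp add: coeff_det_add)
  show "coeff_det n (R(i := Polynomial.smult c p, j := q)) = c * coeff_det n (R(i := p, j := q))"
    using assms by (simp add: fun_upd_twist[of i j] coeff_det_smult)
  show "coeff_det n (R(i := p, j := Polynomial.smult c q)) = c * coeff_det n (R(i := p, j := q))"
    using assms by (simp add: coeff_det_smult)
  show "coeff_det n (R(i := p, j := p)) = 0"
    using assms by (intro coeff_det_equal_rows[of i n j]) auto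
qed

lemma coeff_det_zero_row: "k < n \<Longrightarrow> coeff_det n (R(k := 0)) = 0"
  using coeff_det_smult[of k n R 0 0] by simp

text \<open>The vanishing condition of \<open>pair_eq\<close> holds because
  \<open>A $$ (K, K) * monom 1 p\<close> with \<open>j < p < r\<close>, placed in row
  \<open>K + j\<close>, repeats row \<open>K + p\<close>.\<close>

lemma resolvent_pair_sum:
  fixes R :: "nat \<Rightarrow> complex poly"
  assumes Y: "Y \<in> carrier_mat (Suc K) (Suc K)" and jr: "j < r" and rn: "K + r < n"
    and R: "\<And>p. p < r \<Longrightarrow> R (K + p) = resolvent Y $$ (K, K) * monom 1 p"
  shows "(\<Sum>i<Suc K. coeff_det n (R(K + j := resolvent Y $$ (i, K) * monom 1 j,
      K + r := resolvent Y $$ (K, i) * monom 1 r))) =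
    coeff_det n (R(K + r := char_poly Y * monom 1 (r - 1)))"
proof -
  let ?A = "resolvent Y"
  let ?\<omega> = "\<lambda>p q. coeff_det n (R(K + j := p, K + r := q))"
  interpret resolvent_polynomial "Suc K" Y ?A "char_poly Y"
    by (rule resolvent_polynomial_resolvent[OF Y])
  interpret alternating_form ?\<omega>
    by (rule alternating_form_coeff_det) (use jr rn in auto)
  interpret resolvent_form "Suc K" Y ?A "char_poly Y" ?\<omega> ..
  have "?\<omega> (?A $$ (K, K) * monom 1 p) q = 0" if "j < p" "p < r" for p q
    using that jr rn R[of p] by (intro coeff_det_equal_rows[of "K + j" n "K + p"]) auto
  from pair_eq[OF _ jr this]
  have "pair K j r = ?\<omega> (?A $$ (K, K) * monom 1 j) (char_poly Y * monom 1 (r - 1))"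
    by simp
  also have "R(K + j := ?A $$ (K, K) * monom 1 j) = R"
    using R[OF jr] by (rule fun_upd_idem)
  finally show ?thesis by (simp only: pair_def)
qed

text \<open>The infinitesimal change of \<open>rotation_test\<close> below under rotations in the plane of the
  coordinates \<open>i\<close> and \<open>K\<close>, up to a term that is removed by varying the phase of the rotation.\<close>

definition radial_defect ::
  "nat \<Rightarrow> nat \<Rightarrow> (nat \<Rightarrow> nat) \<Rightarrow> nat \<Rightarrow> complex mat \<Rightarrow> nat \<Rightarrow> complex" where
  "radial_defect K M l r Y i =
    (let A = resolvent Y; R = mixed_rows K l (A $$ (K, K)) (char_poly Y) r in
      coeff_det (K + M) (R(K + r := (A $$ (i, i) - A $$ (K, K)) * monom 1 r)) +
      (\<Sum>j<r. coeff_det (K + M) (R(K + j := A $$ (i, K) * monom 1 j, K + r := A $$ (K, i) * monom 1 r))))"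

text \<open>In row \<open>K + r\<close>, the trace gives \<open>pderiv \<phi> * monom 1 r\<close>
  minus \<open>K + 1\<close> copies of \<open>f * monom 1 r\<close>. Each of the \<open>r\<close>
  pair sums gives \<open>\<phi> * monom 1 (r - 1)\<close> minus one further copy, its term
  \<open>i = K\<close> being split off. The product rule assembles the terms with \<phi> into the
  row of \<open>mixed_rows\<close> at \<open>r\<close>, and \<open>K + 1 + r\<close> counts the
  copies.\<close>

lemma radial_identity:
  assumes Y: "Y \<in> carrier_mat (Suc K) (Suc K)" and r: "r < M"
  defines "f \<equiv> resolvent Y $$ (K, K)"
  shows "coeff_det (K + M) (mixed_rows K l f (char_poly Y) r) -
      of_nat (Suc K + r) * coeff_det (K + M) (mixed_rows K l f (char_poly Y) (Suc r)) =
    (\<Sum>i<K. radial_defect K M l r Y i)"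
proof -
  let ?A = "resolvent Y" and ?n = "K + M"
  define \<phi> where "\<phi> = char_poly Y"
  define R where "R = mixed_rows K l f \<phi> r"
  let ?d = "\<lambda>p. coeff_det ?n (R(K + r := p))"
  have n: "K + r < ?n" using r by simp
  have trace: "(\<Sum>i<K. ?A $$ (i, i)) + f = pderiv \<phi>"
    using resolvent_trace[OF Y] by (simp add: f_def \<phi>_def)
  have pair: "(\<Sum>i<K. coeff_det ?n (R(K + j := ?A $$ (i, K) * monom 1 j, K + r := ?A $$ (K, i) * monom 1 r))) =
      ?d (\<phi> * monom 1 (r - 1)) - ?d (f * monom 1 r)" if j: "j < r" for j
  proof -
    have R: "R (K + p) = f * monom 1 p" if "p < r" for p
      using that by (simp add: R_def mixed_rows_def)
    have "R(K + j := ?A $$ (K, K) * monom 1 j) = R"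
      using R[OF j] by (intro fun_upd_idem) (simp add: f_def)
    then show ?thesis
      using resolvent_pair_sum[OF Y j n, of R] R by (simp add: f_def \<phi>_def algebra_simps)
  qed
  have "(\<Sum>i<K. radial_defect K M l r Y i) =
      (\<Sum>i<K. ?d ((?A $$ (i, i) - f) * monom 1 r)) +
      (\<Sum>i<K. \<Sum>j<r. coeff_det ?n (R(K + j := ?A $$ (i, K) * monom 1 j, K + r := ?A $$ (K, i) * monom 1 r)))"
    by (simp add: radial_defect_def R_def f_def \<phi>_def sum.distrib Let_def)
  also have "(\<Sum>i<K. \<Sum>j<r. coeff_det ?n (R(K + j := ?A $$ (i, K) * monom 1 j, K + r := ?A $$ (K, i) * monom 1 r))) =
      of_nat r * (?d (\<phi> * monom 1 (r - 1)) - ?d (f * monom 1 r))"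
    by (subst sum.swap) (simp add: pair)
  also have "(\<Sum>i<K. ?d ((?A $$ (i, i) - f) * monom 1 r)) =
      ?d (\<Sum>i<K. (?A $$ (i, i) - f) * monom 1 r)"
    using n by (rule coeff_det_sum[symmetric])
  also have "(\<Sum>i<K. (?A $$ (i, i) - f) * monom 1 r) =
      pderiv \<phi> * monom 1 r - Polynomial.smult (of_nat (Suc K)) (f * monom 1 r)"
    unfolding trace[symmetric]
    by (simp add: algebra_simps sum_distrib_left sum_subtractf of_nat_poly smult_add_left)
  also have "?d \<dots> = ?d (pderiv \<phi> * monom 1 r) - of_nat (Suc K) * ?d (f * monom 1 r)"
    using n by (simp only: coeff_det_diff coeff_det_smult)
  finally have rhs: "(\<Sum>i<K. radial_defect K M l r Y i) =
      ?d (pderiv \<phi> * monom 1 r) + of_nat r * ?d (\<phi> * monom 1 (r - 1)) -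
      of_nat (Suc K + r) * ?d (f * monom 1 r)"
    by (simp add: algebra_simps fun_upd_def)
  have "pderiv (\<phi> * monom 1 r) = pderiv \<phi> * monom 1 r + Polynomial.smult (of_nat r) (\<phi> * monom 1 (r - 1))"
  proof -
    have "\<phi> * monom (of_nat r) (r - 1) = \<phi> * Polynomial.smult (of_nat r) (monom 1 (r - 1))"
      by (simp add: smult_monom)
    also have "\<dots> = Polynomial.smult (of_nat r) (\<phi> * monom 1 (r - 1))"
      by (rule mult_smult_right)
    finally show ?thesis by (simp add: pderiv_mult pderiv_monom)
  qed
  then have "?d (pderiv (\<phi> * monom 1 r)) =
      ?d (pderiv \<phi> * monom 1 r) + of_nat r * ?d (\<phi> * monom 1 (r - 1))"
    using n by (simp only: coeff_det_add coeff_det_smult)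
  moreover have "R(K + r := pderiv (\<phi> * monom 1 r)) = R"
    by (rule fun_upd_idem) (simp add: R_def mixed_rows_def)
  moreover have "R(K + r := f * monom 1 r) = mixed_rows K l f \<phi> (Suc r)"
    by (auto simp: R_def mixed_rows_def fun_eq_iff)
  ultimately show ?thesis using rhs by (simp add: R_def \<phi>_def)
qed

lemma product_index:
  fixes A B :: "'a::comm_semiring_0 mat"
  assumes "A \<in> carrier_mat n n" "B \<in> carrier_mat n n" "p < n" "q < n"
  shows "(A * B) $$ (p, q) = (\<Sum>b<n. A $$ (p, b) * B $$ (b, q))"
  using assms by (auto simp: scalar_prod_def atLeast0LessThan)

lemma triple_product_index:
  fixes A B C :: "'a::comm_semiring_0 mat"
  assumes "A \<in> carrier_mat n n" "B \<in> carrier_mat n n" "C \<in> carrier_mat n n" "p < n" "q < n"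
  shows "(A * B * C) $$ (p, q) = (\<Sum>b<n. (\<Sum>a<n. A $$ (p, a) * B $$ (a, b)) * C $$ (b, q))"
proof -
  have "A * B \<in> carrier_mat n n" using assms by simp
  then have "(A * B * C) $$ (p, q) = (\<Sum>b<n. (A * B) $$ (p, b) * C $$ (b, q))"
    using assms(3-5) by (rule product_index)
  also have "\<dots> = (\<Sum>b<n. (\<Sum>a<n. A $$ (p, a) * B $$ (a, b)) * C $$ (b, q))"
    by (intro sum.cong refl arg_cong2[where f = "(*)"] product_index[OF assms(1,2,4)]) auto
  finally show ?thesis .
qed

lemma mat_adjoint_carrier [simp]: "A \<in> carrier_mat n m \<Longrightarrow> mat_adjoint A \<in> carrier_mat m n"
  by (auto simp: mat_adjoint_def mat_of_rows_def)

lemma mat_adjoint_dim [simp]: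
  "dim_row (mat_adjoint A) = dim_col A" "dim_col (mat_adjoint A) = dim_row A"
  by (auto simp: mat_adjoint_def mat_of_rows_def)

lemma mat_adjoint_index [simp]:
  fixes A :: "complex mat"
  shows "i < dim_col A \<Longrightarrow> j < dim_row A \<Longrightarrow> mat_adjoint A $$ (i, j) = cnj (A $$ (j, i))"
  by (simp add: mat_adjoint_def mat_of_rows_def)

text \<open>The cosine of the angle with tangent \<open>t\<close>. Only its square will enter the
  rotated resolvent, which is therefore rational in \<open>t\<close>.\<close>

definition rotation_cos :: "real \<Rightarrow> complex" where
  "rotation_cos t = of_real (1 / sqrt (1 + t\<^sup>2))"

lemma rotation_cos_square: "rotation_cos t * rotation_cos t * (1 + (of_real t)\<^sup>2) = 1"
proof -
  have "1 + t\<^sup>2 > 0" by (simp add: add_pos_nonneg)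
  then have "1 / sqrt (1 + t\<^sup>2) * (1 / sqrt (1 + t\<^sup>2)) * (1 + t\<^sup>2) = 1"
    by (simp add: real_sqrt_mult_self)
  then have "complex_of_real (1 / sqrt (1 + t\<^sup>2) * (1 / sqrt (1 + t\<^sup>2)) * (1 + t\<^sup>2)) = 1"
    by (simp only: of_real_1)
  then show ?thesis
    by (simp only: rotation_cos_def of_real_mult of_real_add of_real_1 of_real_power)
qed

lemma cnj_rotation_cos [simp]: "cnj (rotation_cos t) = rotation_cos t"
  by (simp add: rotation_cos_def)

text \<open>The phase \<open>a\<close> remains free because the first-order change has one part
  proportional to \<open>a\<close> and one to \<open>cnj a\<close>, which have to be
  separated.\<close>

definition plane_rotation :: "nat \<Rightarrow> nat \<Rightarrow> nat \<Rightarrow> real \<Rightarrow> complex \<Rightarrow> complex mat" where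
  "plane_rotation n i K t a = Matrix.mat n n (\<lambda>(p, q).
     if p = K then (if q = K then rotation_cos t else if q = i then rotation_cos t * of_real t * a else 0)
     else if p = i then
       (if q = i then rotation_cos t else if q = K then - (rotation_cos t * of_real t * cnj a) else 0)
     else if p = q then 1 else 0)"

lemma plane_rotation_carrier [simp]: "plane_rotation n i K t a \<in> carrier_mat n n"
  by (simp add: plane_rotation_def)

lemma plane_rotation_dim [simp]:
  "dim_row (plane_rotation n i K t a) = n" "dim_col (plane_rotation n i K t a) = n"
  by (simp_all add: plane_rotation_def)

text \<open>Polynomial values of \<open>g\<close> cover the entries of the resolvent and, as
  constants, the entries of the rotation itself in the proof of unitarity.\<close>

lemma plane_rotation_row_sum:
  fixes g :: "nat \<Rightarrow> complex poly"
  assumes "i < n" "K < n" "i \<noteq> K" "p < n"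
  shows "(\<Sum>q<n. Polynomial.smult (plane_rotation n i K t a $$ (p, q)) (g q)) =
    (if p = K then Polynomial.smult (rotation_cos t) (g K + Polynomial.smult (of_real t * a) (g i))
     else if p = i then
       Polynomial.smult (rotation_cos t) (g i - Polynomial.smult (of_real t * cnj a) (g K))
     else g p)"
proof -
  let ?h = "\<lambda>q. Polynomial.smult (plane_rotation n i K t a $$ (p, q)) (g q)"
  have "(\<Sum>q<n. ?h q) = (\<Sum>q\<in>{p, i, K}. ?h q)"
    by (rule sum.mono_neutral_right) (use assms in \<open>auto simp: plane_rotation_def\<close>)
  also have "{p, i, K} = (if p = K \<or> p = i then {i, K} else {p, i, K})"
    by auto
  finally show ?thesis
    using assms by (auto simp: plane_rotation_def smult_add_right smult_diff_right algebra_simps)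
qed

lemma plane_rotation_cnj:
  "p < n \<Longrightarrow> q < n \<Longrightarrow>
    cnj (plane_rotation n i K t a $$ (p, q)) = plane_rotation n i K t (cnj a) $$ (p, q)"
  by (auto simp: plane_rotation_def)

lemma plane_rotation_unitary:
  assumes ik: "i < n" "K < n" "i \<noteq> K" and a: "a * cnj a = 1"
  shows "plane_rotation n i K t a \<in> unitary_group n"
proof -
  let ?v = "plane_rotation n i K t a"
  have c: "rotation_cos t * rotation_cos t +
      rotation_cos t * (rotation_cos t * (of_real t * of_real t)) = 1"
    "rotation_cos t * rotation_cos t +
      of_real t * (of_real t * (rotation_cos t * rotation_cos t)) = 1"
    using rotation_cos_square[of t] by (simp_all add: algebra_simps power2_eq_square)
  have a': "a * (cnj a * z) = z" for z
    using a by (simp add: mult.assoc[symmetric])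
  have v: "?v \<in> carrier_mat n n" by simp
  have "?v * mat_adjoint ?v = 1\<^sub>m n"
  proof (rule eq_matI)
    fix p q assume "p < dim_row (1\<^sub>m n)" "q < dim_col (1\<^sub>m n)"
    then have pq: "p < n" "q < n" by auto
    let ?g = "\<lambda>m. [:plane_rotation n i K t (cnj a) $$ (q, m):]"
    have "(?v * mat_adjoint ?v) $$ (p, q) = (\<Sum>m<n. ?v $$ (p, m) * cnj (?v $$ (q, m)))"
      using pq by (subst product_index[OF v mat_adjoint_carrier[OF v] pq]) (auto intro!: sum.cong)
    also have "\<dots> = coeff (\<Sum>m<n. Polynomial.smult (?v $$ (p, m)) (?g m)) 0"
      using pq by (auto simp: coeff_sum plane_rotation_cnj)
    also have "\<dots> = (if p = q then 1 else 0)"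
      unfolding plane_rotation_row_sum[OF ik pq(1), where g = ?g]
      using pq ik by (auto simp: plane_rotation_def algebra_simps a' c)
    finally show "(?v * mat_adjoint ?v) $$ (p, q) = 1\<^sub>m n $$ (p, q)"
      using pq by simp
  qed auto
  then show ?thesis
    using mat_mult_left_right_inverse[of ?v n "mat_adjoint ?v"] v
    by (simp add: unitary_group_def)
qed

section \<open>Leading blocks and resolvents under rotations\<close>

definition leading_block :: "nat \<Rightarrow> complex mat \<Rightarrow> complex mat" where
  "leading_block k Y = Matrix.mat k k (\<lambda>(i, j). Y $$ (i, j))"

lemma leading_block_carrier [simp]: "leading_block k Y \<in> carrier_mat k k"
  by (simp add: leading_block_def)

lemma leading_block_dim [simp]: "dim_row (leading_block k Y) = k" "dim_col (leading_block k Y) = k"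
  by (simp_all add: leading_block_def)

lemma leading_block_index [simp]:
  "i < k \<Longrightarrow> j < k \<Longrightarrow> leading_block k Y $$ (i, j) = Y $$ (i, j)"
  by (simp add: leading_block_def)

lemma leading_minor_eq_det: "leading_minor k Y = Determinant.det (leading_block k Y)"
  by (simp add: leading_minor_def leading_block_def)

lemma leading_block_plane_rotation:
  "i < m \<Longrightarrow> K < m \<Longrightarrow> m \<le> n \<Longrightarrow>
    leading_block m (plane_rotation n i K t a) = plane_rotation m i K t a"
  by (intro eq_matI) (auto simp: plane_rotation_def Let_def)

lemma leading_block_conj:
  assumes v: "v \<in> carrier_mat N N" and Y: "Y \<in> carrier_mat N N" and m: "m \<le> N"
    and zero: "\<And>p b. p < m \<Longrightarrow> m \<le> b \<Longrightarrow> b < N \<Longrightarrow> v $$ (p, b) = 0"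
  shows "leading_block m (v * Y * mat_adjoint v) =
    leading_block m v * leading_block m Y * mat_adjoint (leading_block m v)"
proof (rule eq_matI)
  let ?R = "leading_block m v * leading_block m Y * mat_adjoint (leading_block m v)"
  fix p q assume "p < dim_row ?R" "q < dim_col ?R"
  then have pq: "p < m" "q < m" by auto
  have "leading_block m (v * Y * mat_adjoint v) $$ (p, q) = (v * Y * mat_adjoint v) $$ (p, q)"
    using pq by (simp del: index_mult_mat(1))
  also have "\<dots> = (\<Sum>b<N. (\<Sum>a<N. v $$ (p, a) * Y $$ (a, b)) * mat_adjoint v $$ (b, q))"
    using pq m v Y by (intro triple_product_index) auto
  also have "\<dots> = (\<Sum>b<N. (\<Sum>a<N. v $$ (p, a) * Y $$ (a, b)) * cnj (v $$ (q, b)))"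
    using pq m v by (intro sum.cong) auto
  also have "\<dots> = (\<Sum>b<m. (\<Sum>a<N. v $$ (p, a) * Y $$ (a, b)) * cnj (v $$ (q, b)))"
    by (rule sum.mono_neutral_right) (use zero pq m in auto)
  also have "\<dots> = (\<Sum>b<m. (\<Sum>a<m. v $$ (p, a) * Y $$ (a, b)) * cnj (v $$ (q, b)))"
    by (intro sum.cong refl arg_cong2[where f = "(*)"] sum.mono_neutral_right)
      (use zero pq m in auto)
  also have "\<dots> = ?R $$ (p, q)"
    using pq by (subst triple_product_index[where n = m]) auto
  finally show "leading_block m (v * Y * mat_adjoint v) $$ (p, q) = ?R $$ (p, q)" .
qed auto

lemma leading_block_rotation:
  fixes t :: real and a :: complex
  assumes "i < m" "K < m" "m \<le> N" "Y \<in> carrier_mat N N"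
  defines "v \<equiv> plane_rotation N i K t a" and "w \<equiv> plane_rotation m i K t a"
  shows "leading_block m (v * Y * mat_adjoint v) = w * leading_block m Y * mat_adjoint w"
  using leading_block_conj[of v N Y m] assms leading_block_plane_rotation[of i m K N t a]
  by (auto simp: plane_rotation_def Let_def)

lemma char_poly_unitary_conj:
  assumes "v \<in> unitary_group n" "Y \<in> carrier_mat n n"
  shows "char_poly (v * Y * mat_adjoint v) = char_poly Y"
proof (rule char_poly_similar)
  show "similar_mat (v * Y * mat_adjoint v) Y"
    unfolding similar_mat_def similar_mat_wit_def
    using assms by (intro exI[of _ v] exI[of _ "mat_adjoint v"]) (auto simp: Let_def unitary_group_def)
qed

lemma det_unitary_conj:
  assumes v: "v \<in> unitary_group n" and Y: "Y \<in> carrier_mat n n"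
  shows "Determinant.det (v * Y * mat_adjoint v) = Determinant.det Y"
proof (rule det_similar)
  show "similar_mat (v * Y * mat_adjoint v) Y"
    unfolding similar_mat_def similar_mat_wit_def
    using assms by (intro exI[of _ v] exI[of _ "mat_adjoint v"]) (auto simp: Let_def unitary_group_def)
qed

text \<open>Both rotated coordinates lie in the block of size \<open>m\<close>, which therefore
  undergoes a unitary conjugation. For \<open>m > K > i\<close> this holds although the block of
  size \<open>K\<close> changes.\<close>

lemma leading_minor_rotation:
  fixes t :: real
  assumes "i < m" "K < m" "i \<noteq> K" "m \<le> N" "Y \<in> carrier_mat N N" "a * cnj a = 1"
  defines "v \<equiv> plane_rotation N i K t a"
  shows "leading_minor m (v * Y * mat_adjoint v) = leading_minor m Y"
  unfolding leading_minor_eq_det v_def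
  by (subst leading_block_rotation) (use assms det_unitary_conj[OF plane_rotation_unitary] in auto)

text \<open>The characteristic polynomial is invariant, and these are the only other entries that
  occur in \<open>rotation_test\<close>. Both are \<open>c * c\<close> times a quadratic polynomial
  in \<open>t\<close>.\<close>

lemma resolvent_rotation:
  fixes t :: real
  assumes Y: "Y \<in> carrier_mat (Suc K) (Suc K)" and i: "i < K" and a: "a * cnj a = 1"
  defines "Y' \<equiv> plane_rotation (Suc K) i K t a * Y * mat_adjoint (plane_rotation (Suc K) i K t a)"
    and "A \<equiv> resolvent Y" and "c \<equiv> rotation_cos t"
  shows "resolvent Y' $$ (K, K) = Polynomial.smult (c * c) (A $$ (K, K) +
      Polynomial.smult (of_real t) (Polynomial.smult a (A $$ (i, K)) + Polynomial.smult (cnj a) (A $$ (K, i))) +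
      Polynomial.smult ((of_real t)\<^sup>2) (A $$ (i, i)))"
    and "resolvent Y' $$ (K, i) = Polynomial.smult (c * c) (A $$ (K, i) +
      Polynomial.smult (of_real t) (Polynomial.smult a (A $$ (i, i) - A $$ (K, K))) +
      Polynomial.smult ((of_real t)\<^sup>2) (Polynomial.smult (- (a * a)) (A $$ (i, K))))"
proof -
  let ?n = "Suc K"
  let ?v = "plane_rotation ?n i K t a"
  let ?h = "\<lambda>z::complex. [:z:]"
  have ik: "i < ?n" "K < ?n" "i \<noteq> K" using i by auto
  have U: "?v \<in> unitary_group ?n" by (rule plane_rotation_unitary[OF ik a])
  have R: "resolvent Y' = map_mat ?h ?v * A * map_mat ?h (mat_adjoint ?v)"
    unfolding Y'_def A_def using U
    by (intro resolvent_conj[of _ ?n]) (use Y in \<open>auto simp: unitary_group_def\<close>)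
  have A: "A \<in> carrier_mat ?n ?n" unfolding A_def by (rule resolvent_carrier[OF Y])
  define B where "B b = Polynomial.smult c (A $$ (K, b) + Polynomial.smult (of_real t * a) (A $$ (i, b)))" for b
  have B: "(\<Sum>p<?n. map_mat ?h ?v $$ (K, p) * A $$ (p, b)) = B b" for b
    using plane_rotation_row_sum[OF ik ik(2), where g = "\<lambda>p. A $$ (p, b)" and t = t and a = a]
    by (simp add: B_def c_def del: sum.lessThan_Suc)
  have entry: "resolvent Y' $$ (K, q) =
      (\<Sum>b<?n. Polynomial.smult (plane_rotation ?n i K t (cnj a) $$ (q, b)) (B b))" if q: "q < ?n" for q
  proof -
    have "resolvent Y' $$ (K, q) = (\<Sum>b<?n. (\<Sum>p<?n. map_mat ?h ?v $$ (K, p) * A $$ (p, b)) *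
        map_mat ?h (mat_adjoint ?v) $$ (b, q))"
      unfolding R using A q by (intro triple_product_index) auto
    also have "\<dots> = (\<Sum>b<?n. B b * map_mat ?h (mat_adjoint ?v) $$ (b, q))"
      by (simp only: B)
    also have "\<dots> = (\<Sum>b<?n. Polynomial.smult (plane_rotation ?n i K t (cnj a) $$ (q, b)) (B b))"
      using q by (intro sum.cong) (auto simp: plane_rotation_cnj)
    finally show ?thesis .
  qed
  have a': "a * (c * (c * (cnj a * z))) = c * (c * z)" for z
  proof -
    have "a * (c * (c * (cnj a * z))) = (a * cnj a) * (c * (c * z))" by (simp only: ac_simps)
    then show ?thesis by (simp add: a)
  qed
  show "resolvent Y' $$ (K, K) = Polynomial.smult (c * c) (A $$ (K, K) +
      Polynomial.smult (of_real t) (Polynomial.smult a (A $$ (i, K)) + Polynomial.smult (cnj a) (A $$ (K, i))) +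
      Polynomial.smult ((of_real t)\<^sup>2) (A $$ (i, i)))"
    unfolding entry[OF ik(2)] plane_rotation_row_sum[OF ik ik(2)]
    by (simp add: B_def c_def[symmetric] smult_add_right algebra_simps power2_eq_square a')
  show "resolvent Y' $$ (K, i) = Polynomial.smult (c * c) (A $$ (K, i) +
      Polynomial.smult (of_real t) (Polynomial.smult a (A $$ (i, i) - A $$ (K, K))) +
      Polynomial.smult ((of_real t)\<^sup>2) (Polynomial.smult (- (a * a)) (A $$ (i, K))))"
    unfolding entry[OF ik(1)] plane_rotation_row_sum[OF ik ik(1)]
    using ik by (simp add: B_def c_def[symmetric] smult_add_right smult_diff_right algebra_simps power2_eq_square a')
qed

text \<open>Chosen for its derivative: to first order a rotation moves \<open>A $$ (K, i)\<close> by
  \<open>a\<close> times \<open>A $$ (i, i) - A $$ (K, K)\<close>, the first term of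
  \<open>radial_defect\<close>; the rows \<open>K + j\<close> with \<open>j < r\<close> supply the
  other terms.\<close>

definition rotation_test ::
  "nat \<Rightarrow> nat \<Rightarrow> (nat \<Rightarrow> nat) \<Rightarrow> nat \<Rightarrow> nat \<Rightarrow> complex mat \<Rightarrow> complex" where
  "rotation_test K M l r i Y = (let A = resolvent Y in
     coeff_det (K + M) ((mixed_rows K l (A $$ (K, K)) (char_poly Y) r)(K + r := A $$ (K, i) * monom 1 r)))"

text \<open>Here and in \<open>quadratic_row\<close>: the coefficients of \<open>t\<close> and
  \<open>t^2\<close> in the rotated rows, once the factor \<open>c * c\<close> of
  \<open>resolvent_rotation\<close> is taken out.\<close>

definition linear_row :: "nat \<Rightarrow> nat \<Rightarrow> nat \<Rightarrow> complex \<Rightarrow> complex poly mat \<Rightarrow> nat \<Rightarrow> complex poly" where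
  "linear_row K r i a A n =
     (if n < K then 0
      else if n < K + r then
        (Polynomial.smult a (A $$ (i, K)) + Polynomial.smult (cnj a) (A $$ (K, i))) * monom 1 (n - K)
      else if n = K + r then Polynomial.smult a (A $$ (i, i) - A $$ (K, K)) * monom 1 r else 0)"

definition quadratic_row :: "nat \<Rightarrow> nat \<Rightarrow> nat \<Rightarrow> complex \<Rightarrow> complex poly mat \<Rightarrow> nat \<Rightarrow> complex poly" where
  "quadratic_row K r i a A n =
     (if n < K then 0 else if n < K + r then A $$ (i, i) * monom 1 (n - K)
      else if n = K + r then Polynomial.smult (- (a * a)) (A $$ (i, K)) * monom 1 r else 0)"

definition rotation_poly ::
  "nat \<Rightarrow> nat \<Rightarrow> (nat \<Rightarrow> nat) \<Rightarrow> nat \<Rightarrow> nat \<Rightarrow> complex \<Rightarrow> complex mat \<Rightarrow> complex poly" where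
  "rotation_poly K M l r i a Y = (let A = resolvent Y in
     quadratic_det (K + M)
       ((mixed_rows K l (A $$ (K, K)) (char_poly Y) r)(K + r := A $$ (K, i) * monom 1 r))
       (linear_row K r i a A) (quadratic_row K r i a A))"

text \<open>The \<open>r + 1\<close> rows \<open>K, ..., K + r\<close> each carry a factor
  \<open>c * c = 1 / (1 + t^2)\<close>; this fixes the power that clears the denominator.\<close>

lemma rotation_test_rotated:
  fixes t :: real
  assumes Y: "Y \<in> carrier_mat (Suc K) (Suc K)" and i: "i < K" and a: "a * cnj a = 1" and r: "r < M"
  defines "v \<equiv> plane_rotation (Suc K) i K t a"
  shows "(1 + (of_real t)\<^sup>2) ^ Suc r * rotation_test K M l r i (v * Y * mat_adjoint v) =
    poly (rotation_poly K M l r i a Y) (of_real t)"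
proof -
  let ?Y' = "v * Y * mat_adjoint v" and ?A = "resolvent Y"
  let ?c = "rotation_cos t"
  define d where "d m = (if K \<le> m \<and> m < K + Suc r then ?c * ?c else 1)" for m
  have U: "v \<in> unitary_group (Suc K)"
    unfolding v_def by (rule plane_rotation_unitary) (use i a in auto)
  note cp = char_poly_unitary_conj[OF U Y]
  note rot = resolvent_rotation[OF Y i a, of t, folded v_def]
  have "rotation_test K M l r i ?Y' = coeff_det (K + M) (\<lambda>m. Polynomial.smult (d m)
     (((mixed_rows K l (?A $$ (K, K)) (char_poly Y) r)(K + r := ?A $$ (K, i) * monom 1 r)) m +
      Polynomial.smult (of_real t) (linear_row K r i a ?A m) +
      Polynomial.smult ((of_real t)\<^sup>2) (quadratic_row K r i a ?A m)))"
    unfolding rotation_test_def Let_def cp rot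
    by (intro coeff_det_cong)
      (auto simp: mixed_rows_def linear_row_def quadratic_row_def d_def distrib_right
        left_diff_distrib smult_add_right smult_diff_right)
  also have "\<dots> = (\<Prod>m<K + M. d m) * poly (rotation_poly K M l r i a Y) (of_real t)"
    unfolding coeff_det_smult_rows rotation_poly_def Let_def poly_quadratic_det ..
  also have "(\<Prod>m<K + M. d m) = (?c * ?c) ^ Suc r"
  proof -
    have "(\<Prod>m<K + M. d m) = (\<Prod>m\<in>{K..<K + Suc r}. d m)"
      by (rule prod.mono_neutral_right) (use r in \<open>auto simp: d_def\<close>)
    also have "\<dots> = (\<Prod>m\<in>{K..<K + Suc r}. ?c * ?c)"
      by (rule prod.cong) (auto simp: d_def)
    finally show ?thesis by simp
  qed
  finally have "rotation_test K M l r i ?Y' =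
      (?c * ?c) ^ Suc r * poly (rotation_poly K M l r i a Y) (of_real t)" .
  moreover have "(1 + (of_real t)\<^sup>2) ^ Suc r * (?c * ?c) ^ Suc r = 1"
    using rotation_cos_square[of t] by (metis mult.commute power_mult_distrib power_one)
  ultimately show ?thesis by (simp only: mult.assoc[symmetric] mult_1_left)
qed

definition rotation_remainder ::
  "nat \<Rightarrow> nat \<Rightarrow> (nat \<Rightarrow> nat) \<Rightarrow> nat \<Rightarrow> nat \<Rightarrow> complex mat \<Rightarrow> complex" where
  "rotation_remainder K M l r i Y =
    (let A = resolvent Y; R = mixed_rows K l (A $$ (K, K)) (char_poly Y) r in
      \<Sum>j<r. coeff_det (K + M) (R(K + j := A $$ (K, i) * monom 1 j, K + r := A $$ (K, i) * monom 1 r)))"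

text \<open>Product rule over the rows: row \<open>K + r\<close> contributes the difference of
  diagonal entries, and every row \<open>K + j\<close> with \<open>j < r\<close> contributes one
  term with \<open>a\<close> and one with \<open>cnj a\<close>.\<close>

lemma coeff_rotation_poly_1:
  assumes r: "r < M"
  shows "coeff (rotation_poly K M l r i a Y) 1 =
    a * radial_defect K M l r Y i + cnj a * rotation_remainder K M l r i Y"
proof -
  let ?A = "resolvent Y" and ?n = "K + M"
  let ?R = "mixed_rows K l (?A $$ (K, K)) (char_poly Y) r"
  define p where "p = ?R(K + r := ?A $$ (K, i) * monom 1 r)"
  define q where "q = linear_row K r i a ?A"
  have "coeff (rotation_poly K M l r i a Y) 1 = (\<Sum>m<?n. coeff_det ?n (p(m := q m)))"
    unfolding rotation_poly_def Let_def coeff_quadratic_det_1 p_def q_def ..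
  also have "\<dots> = (\<Sum>m\<in>{K..<K + Suc r}. coeff_det ?n (p(m := q m)))"
    by (rule sum.mono_neutral_right) (use r in \<open>auto simp: q_def linear_row_def coeff_det_zero_row\<close>)
  also have "\<dots> = (\<Sum>j<Suc r. coeff_det ?n (p(K + j := q (K + j))))"
    by (rule sum.reindex_bij_witness[of _ "\<lambda>j. K + j" "\<lambda>m. m - K"]) auto
  also have "\<dots> = (\<Sum>j<r. coeff_det ?n (p(K + j := q (K + j)))) + coeff_det ?n (p(K + r := q (K + r)))"
    by simp
  also have "p(K + r := q (K + r)) =
      ?R(K + r := Polynomial.smult a ((?A $$ (i, i) - ?A $$ (K, K)) * monom 1 r))"
    by (auto simp: p_def q_def linear_row_def)
  also have "coeff_det ?n \<dots> = a * coeff_det ?n (?R(K + r := (?A $$ (i, i) - ?A $$ (K, K)) * monom 1 r))"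
    using r by (intro coeff_det_smult) auto
  also have "(\<Sum>j<r. coeff_det ?n (p(K + j := q (K + j)))) = (\<Sum>j<r.
      a * coeff_det ?n (?R(K + j := ?A $$ (i, K) * monom 1 j, K + r := ?A $$ (K, i) * monom 1 r)) +
      cnj a * coeff_det ?n (?R(K + j := ?A $$ (K, i) * monom 1 j, K + r := ?A $$ (K, i) * monom 1 r)))"
  proof (intro sum.cong refl)
    fix j assume "j \<in> {..<r}"
    then have j: "j < r" "K + j < ?n" using r by auto
    have "q (K + j) = Polynomial.smult a (?A $$ (i, K) * monom 1 j) +
        Polynomial.smult (cnj a) (?A $$ (K, i) * monom 1 j)"
      using j by (simp add: q_def linear_row_def distrib_right)
    then have "coeff_det ?n (p(K + j := q (K + j))) =
        a * coeff_det ?n (p(K + j := ?A $$ (i, K) * monom 1 j)) +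
        cnj a * coeff_det ?n (p(K + j := ?A $$ (K, i) * monom 1 j))"
      using j by (simp only: coeff_det_add coeff_det_smult)
    then show "coeff_det ?n (p(K + j := q (K + j))) =
      a * coeff_det ?n (?R(K + j := ?A $$ (i, K) * monom 1 j, K + r := ?A $$ (K, i) * monom 1 r)) +
      cnj a * coeff_det ?n (?R(K + j := ?A $$ (K, i) * monom 1 j, K + r := ?A $$ (K, i) * monom 1 r))"
      using j by (simp only: p_def fun_upd_twist[of "K + r" "K + j"] add_left_cancel less_imp_neq)
  qed
  finally show ?thesis
    by (simp add: radial_defect_def rotation_remainder_def Let_def sum.distrib sum_distrib_left algebra_simps fun_upd_def)
qed

section \<open>Integration over the unitary group\<close>

text \<open>In contrast to integrability this is stable under products, and on a finite measure
  space it implies integrability.\<close>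

definition bounded_measurable :: "'a measure \<Rightarrow> ('a \<Rightarrow> complex) \<Rightarrow> bool" where
  "bounded_measurable M f \<longleftrightarrow> f \<in> borel_measurable M \<and> (\<exists>B. \<forall>u\<in>space M. norm (f u) \<le> B)"

lemma bounded_measurable_const [intro]: "bounded_measurable M (\<lambda>u. c)"
  by (auto simp: bounded_measurable_def)

lemma bounded_measurable_add [intro]:
  assumes "bounded_measurable M f" "bounded_measurable M g"
  shows "bounded_measurable M (\<lambda>u. f u + g u)"
proof -
  from assms obtain B C where "\<forall>u\<in>space M. norm (f u) \<le> B" "\<forall>u\<in>space M. norm (g u) \<le> C"
    by (auto simp: bounded_measurable_def)
  then have "\<forall>u\<in>space M. norm (f u + g u) \<le> B + C"
    by (auto intro: norm_triangle_mono)
  then show ?thesis using assms by (auto simp: bounded_measurable_def)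
qed

lemma bounded_measurable_mult [intro]:
  assumes "bounded_measurable M f" "bounded_measurable M g"
  shows "bounded_measurable M (\<lambda>u. f u * g u)"
proof -
  from assms obtain B C where "\<forall>u\<in>space M. norm (f u) \<le> B" "\<forall>u\<in>space M. norm (g u) \<le> C"
    by (auto simp: bounded_measurable_def)
  then have "\<forall>u\<in>space M. norm (f u * g u) \<le> B * C"
    by (metis norm_mult mult_mono' norm_ge_zero)
  then show ?thesis using assms by (auto simp: bounded_measurable_def)
qed

lemma bounded_measurable_sum [intro]:
  "(\<And>i. i \<in> I \<Longrightarrow> bounded_measurable M (f i)) \<Longrightarrow> bounded_measurable M (\<lambda>u. \<Sum>i\<in>I. f i u)"
  by (induction I rule: infinite_finite_induct) auto

lemma bounded_measurable_prod [intro]: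
  "(\<And>i. i \<in> I \<Longrightarrow> bounded_measurable M (f i)) \<Longrightarrow> bounded_measurable M (\<lambda>u. \<Prod>i\<in>I. f i u)"
  by (induction I rule: infinite_finite_induct) auto

lemma bounded_measurable_power [intro]:
  "bounded_measurable M f \<Longrightarrow> bounded_measurable M (\<lambda>u. f u ^ k)"
  by (induction k) auto

lemma bounded_measurable_cnj [intro]:
  "bounded_measurable M f \<Longrightarrow> bounded_measurable M (\<lambda>u. cnj (f u))"
  by (auto simp: bounded_measurable_def intro!: borel_measurable_continuous_on[of cnj] continuous_intros)

lemma bounded_measurable_cong:
  "(\<And>u. u \<in> space M \<Longrightarrow> f u = g u) \<Longrightarrow> bounded_measurable M f \<longleftrightarrow> bounded_measurable M g"
  unfolding bounded_measurable_def by (metis (no_types, lifting) measurable_cong)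

lemma bounded_measurable_eq:
  "bounded_measurable M g \<Longrightarrow> (\<And>u. u \<in> space M \<Longrightarrow> f u = g u) \<Longrightarrow> bounded_measurable M f"
  using bounded_measurable_cong[of M f g] by simp

lemma (in finite_measure) integrable_bounded_measurable:
  "bounded_measurable M f \<Longrightarrow> integrable M f"
  unfolding bounded_measurable_def
  by (auto intro: integrable_const_bound AE_I2)

text \<open>Working coefficientwise avoids sigma-algebras on polynomials; Leibniz expansions then
  carry the property to characteristic polynomials and adjugates.\<close>

definition bounded_coeffs :: "'a measure \<Rightarrow> ('a \<Rightarrow> complex poly) \<Rightarrow> bool" where
  "bounded_coeffs M P \<longleftrightarrow> (\<forall>k. bounded_measurable M (\<lambda>u. coeff (P u) k))"

lemma bounded_coeffs_const [intro]: "bounded_coeffs M (\<lambda>u. p)"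
  by (auto simp: bounded_coeffs_def)

lemma bounded_coeffs_pCons [intro]:
  "bounded_measurable M f \<Longrightarrow> bounded_coeffs M P \<Longrightarrow>
    bounded_coeffs M (\<lambda>u. pCons (f u) (P u))"
  unfolding bounded_coeffs_def
proof
  fix k
  assume "bounded_measurable M f" "\<forall>k. bounded_measurable M (\<lambda>u. coeff (P u) k)"
  then show "bounded_measurable M (\<lambda>u. coeff (pCons (f u) (P u)) k)"
    by (cases k) auto
qed

lemma bounded_coeffs_add [intro]:
  "bounded_coeffs M P \<Longrightarrow> bounded_coeffs M Q \<Longrightarrow>
    bounded_coeffs M (\<lambda>u. P u + Q u)"
  by (auto simp: bounded_coeffs_def)

lemma bounded_coeffs_mult [intro]:
  "bounded_coeffs M P \<Longrightarrow> bounded_coeffs M Q \<Longrightarrow>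
    bounded_coeffs M (\<lambda>u. P u * Q u)"
  unfolding bounded_coeffs_def coeff_mult
  by (intro allI bounded_measurable_sum bounded_measurable_mult) auto

lemma bounded_coeffs_smult [intro]:
  "bounded_coeffs M P \<Longrightarrow> bounded_coeffs M (\<lambda>u. Polynomial.smult c (P u))"
  by (auto simp: bounded_coeffs_def)

lemma bounded_coeffs_diff [intro]:
  "bounded_coeffs M P \<Longrightarrow> bounded_coeffs M Q \<Longrightarrow>
    bounded_coeffs M (\<lambda>u. P u - Q u)"
  using bounded_coeffs_add[OF _ bounded_coeffs_smult[of M Q "- 1"], of P]
  by simp

lemma bounded_coeffs_pderiv [intro]:
  "bounded_coeffs M P \<Longrightarrow> bounded_coeffs M (\<lambda>u. pderiv (P u))"
  by (auto simp: bounded_coeffs_def coeff_pderiv)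

lemma bounded_coeffs_sum [intro]:
  "(\<And>i. i \<in> I \<Longrightarrow> bounded_coeffs M (f i)) \<Longrightarrow>
    bounded_coeffs M (\<lambda>u. \<Sum>i\<in>I. f i u)"
  by (induction I rule: infinite_finite_induct) auto

lemma bounded_coeffs_prod [intro]:
  "(\<And>i. i \<in> I \<Longrightarrow> bounded_coeffs M (f i)) \<Longrightarrow>
    bounded_coeffs M (\<lambda>u. \<Prod>i\<in>I. f i u)"
  by (induction I rule: infinite_finite_induct) auto

lemma bounded_coeffs_if:
  "bounded_coeffs M P \<Longrightarrow> bounded_coeffs M Q \<Longrightarrow>
    bounded_coeffs M (\<lambda>u. if b then P u else Q u)"
  by (cases b) auto

lemma bounded_coeffs_cong:
  "(\<And>u. u \<in> space M \<Longrightarrow> P u = Q u) \<Longrightarrow>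
    bounded_coeffs M P \<longleftrightarrow> bounded_coeffs M Q"
  unfolding bounded_coeffs_def
  by (intro iff_allI bounded_measurable_cong) simp

lemma bounded_coeffs_eq:
  "bounded_coeffs M Q \<Longrightarrow> (\<And>u. u \<in> space M \<Longrightarrow> P u = Q u) \<Longrightarrow>
    bounded_coeffs M P"
  using bounded_coeffs_cong[of M P Q] by simp

lemma bounded_coeffs_det:
  assumes A: "\<And>u. u \<in> space M \<Longrightarrow> A u \<in> carrier_mat n n"
    and entry: "\<And>i j. i < n \<Longrightarrow> j < n \<Longrightarrow> bounded_coeffs M (\<lambda>u. A u $$ (i, j))"
  shows "bounded_coeffs M (\<lambda>u. Determinant.det (A u))"
proof -
  have "bounded_coeffs M
      (\<lambda>u. \<Sum>p\<in>{p. p permutes {0..<n}}. signof p * (\<Prod>i = 0..<n. A u $$ (i, p i)))"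
  proof (intro bounded_coeffs_sum bounded_coeffs_mult
      bounded_coeffs_const bounded_coeffs_prod entry)
    fix p i assume "p \<in> {p. p permutes {0..<n}}" "i \<in> {0..<n}"
    then show "i < n" "p i < n" using permutes_in_image[of p "{0..<n}" i] by auto
  qed
  then show ?thesis
    by (rule bounded_coeffs_eq) (simp add: det_def'[OF A])
qed

lemma bounded_measurable_det:
  assumes "\<And>i j. i < n \<Longrightarrow> j < n \<Longrightarrow> bounded_measurable M (\<lambda>u. F u i j)"
  shows "bounded_measurable M (\<lambda>u. Determinant.det (Matrix.mat n n (\<lambda>(i, j). F u i j)))"
proof -
  have "bounded_measurable M (\<lambda>u. \<Sum>p\<in>{p. p permutes {0..<n}}. signof p *
      (\<Prod>i = 0..<n. Matrix.mat n n (\<lambda>(i, j). F u i j) $$ (i, p i)))"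
  proof (intro bounded_measurable_sum bounded_measurable_mult
      bounded_measurable_const bounded_measurable_prod)
    fix p i assume "p \<in> {p. p permutes {0..<n}}" "i \<in> {0..<n}"
    then have "i < n" "p i < n" using permutes_in_image[of p "{0..<n}" i] by auto
    then show "bounded_measurable M (\<lambda>u. Matrix.mat n n (\<lambda>(i, j). F u i j) $$ (i, p i))"
      using assms by simp
  qed
  then show ?thesis by (simp add: det_def'[where n = n])
qed

lemma bounded_measurable_coeff_det:
  assumes "\<And>i. i < n \<Longrightarrow> bounded_coeffs M (\<lambda>u. R u i)"
  shows "bounded_measurable M (\<lambda>u. coeff_det n (R u))"
  unfolding coeff_det_def using assms
  by (intro bounded_measurable_det) (auto simp: bounded_coeffs_def)

lemma bounded_coeffs_char_poly:
  assumes Y: "\<And>u. u \<in> space M \<Longrightarrow> Y u \<in> carrier_mat n n"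
    and entry: "\<And>i j. i < n \<Longrightarrow> j < n \<Longrightarrow> bounded_measurable M (\<lambda>u. Y u $$ (i, j))"
  shows "bounded_coeffs M (\<lambda>u. char_poly (Y u))"
    and "i < n \<Longrightarrow> j < n \<Longrightarrow> bounded_coeffs M (\<lambda>u. resolvent (Y u) $$ (i, j))"
proof -
  have C: "char_poly_matrix (Y u) \<in> carrier_mat n n" if "u \<in> space M" for u
    using Y[OF that] by simp
  have E: "bounded_coeffs M (\<lambda>u. char_poly_matrix (Y u) $$ (i, j))"
    if ij: "i < n" "j < n" for i j
  proof -
    have eq: "char_poly_matrix (Y u) $$ (i, j) = (if i = j then [:0, 1:] else 0) + Polynomial.smult (- 1) [:Y u $$ (i, j):]"
      if "u \<in> space M" for u
      using Y[OF that] ij by (auto simp: char_poly_matrix_def)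
    have "bounded_coeffs M
        (\<lambda>u. (if i = j then [:0, 1:] else 0) + Polynomial.smult (- 1) [:Y u $$ (i, j):])"
      using entry[OF ij]
      by (intro bounded_coeffs_add bounded_coeffs_smult
          bounded_coeffs_pCons bounded_coeffs_const)
    from bounded_coeffs_eq[OF this eq] show ?thesis .
  qed
  show "bounded_coeffs M (\<lambda>u. char_poly (Y u))"
    unfolding char_poly_def by (rule bounded_coeffs_det[OF C E])
  show "bounded_coeffs M (\<lambda>u. resolvent (Y u) $$ (i, j))" if ij: "i < n" "j < n"
  proof -
    have "bounded_coeffs M
        (\<lambda>u. (- 1) ^ (j + i) * Determinant.det (mat_delete (char_poly_matrix (Y u)) j i))"
    proof (intro bounded_coeffs_mult bounded_coeffs_const
        bounded_coeffs_det[where n = "n - 1"])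
      show "mat_delete (char_poly_matrix (Y u)) j i \<in> carrier_mat (n - 1) (n - 1)" if "u \<in> space M" for u
        by (rule mat_delete_carrier[OF C[OF that]])
      fix p q assume pq: "p < n - 1" "q < n - 1"
      have "mat_delete (char_poly_matrix (Y u)) j i $$ (p, q) =
          char_poly_matrix (Y u) $$ (if p < j then p else Suc p, if q < i then q else Suc q)"
        if "u \<in> space M" for u
        using carrier_matD[OF C[OF that]] pq by (simp add: mat_delete_def)
      then show "bounded_coeffs M (\<lambda>u. mat_delete (char_poly_matrix (Y u)) j i $$ (p, q))"
        by (rule bounded_coeffs_eq[rotated]) (use pq in \<open>auto intro!: E\<close>)
    qed
    moreover have "resolvent (Y u) $$ (i, j) =
        (- 1) ^ (j + i) * Determinant.det (mat_delete (char_poly_matrix (Y u)) j i)"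
      if "u \<in> space M" for u
      using carrier_matD[OF C[OF that]] ij unfolding adj_mat_def cofactor_def by simp
    ultimately show ?thesis
      by (rule bounded_coeffs_eq)
  qed
qed

section \<open>The unitary group and its Haar measure\<close>

lemma unitary_group_mult:
  assumes "v \<in> unitary_group N" "u \<in> unitary_group N"
  shows "v * u \<in> unitary_group N"
    and "x \<in> carrier_mat N N \<Longrightarrow>
      v * u * x * mat_adjoint (v * u) = v * (u * x * mat_adjoint u) * mat_adjoint v"
proof -
  note U = assms[unfolded unitary_group_def]
  have c: "v \<in> carrier_mat N N" "u \<in> carrier_mat N N" "mat_adjoint v \<in> carrier_mat N N"
    "mat_adjoint u \<in> carrier_mat N N"
    using U by auto
  have adj: "mat_adjoint (v * u) = mat_adjoint u * mat_adjoint v"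
  proof (rule eq_matI)
    fix i j assume "i < dim_row (mat_adjoint u * mat_adjoint v)" "j < dim_col (mat_adjoint u * mat_adjoint v)"
    then have ij: "i < N" "j < N" using c by auto
    have "mat_adjoint (v * u) $$ (i, j) = cnj ((v * u) $$ (j, i))"
      using ij c by (simp del: index_mult_mat(1))
    also have "\<dots> = (mat_adjoint u * mat_adjoint v) $$ (i, j)"
      using ij c by (simp add: product_index[where n = N] mult.commute del: index_mult_mat(1))
    finally show "mat_adjoint (v * u) $$ (i, j) = (mat_adjoint u * mat_adjoint v) $$ (i, j)" .
  qed (use c in auto)
  note assoc = assoc_mult_mat[of _ N N _ N _ N] mult_carrier_mat[of _ N N _ N]
  have "v * u * (mat_adjoint u * mat_adjoint v) = v * (u * mat_adjoint u) * mat_adjoint v"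
    using c by (simp add: assoc)
  moreover have "mat_adjoint u * mat_adjoint v * (v * u) = mat_adjoint u * (mat_adjoint v * v) * u"
    using c by (simp add: assoc)
  ultimately show "v * u \<in> unitary_group N"
    using U c by (simp add: unitary_group_def adj)
  show "v * u * x * mat_adjoint (v * u) = v * (u * x * mat_adjoint u) * mat_adjoint v"
    if "x \<in> carrier_mat N N"
    unfolding adj using c that by (simp add: assoc)
qed

lemma unitary_group_entry_norm:
  assumes u: "u \<in> unitary_group N" and ij: "i < N" "j < N"
  shows "norm (u $$ (i, j)) \<le> 1"
proof -
  have c: "u \<in> carrier_mat N N" "u * mat_adjoint u = 1\<^sub>m N" using u by (auto simp: unitary_group_def)
  have "complex_of_real (\<Sum>k<N. (norm (u $$ (i, k)))\<^sup>2) = (\<Sum>k<N. u $$ (i, k) * mat_adjoint u $$ (k, i))"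
    using ij c by (simp add: complex_norm_square del: of_real_power)
  also have "\<dots> = (u * mat_adjoint u) $$ (i, i)"
    using ij c by (subst product_index[where n = N]) auto
  also have "\<dots> = 1" using c ij by simp
  finally have sum: "(\<Sum>k<N. (norm (u $$ (i, k)))\<^sup>2) = 1"
    by (metis of_real_eq_1_iff)
  have "(norm (u $$ (i, j)))\<^sup>2 \<le> (\<Sum>k<N. (norm (u $$ (i, k)))\<^sup>2)"
    using ij by (intro member_le_sum) auto
  then have "(norm (u $$ (i, j)))\<^sup>2 \<le> 1\<^sup>2" unfolding sum by simp
  then show ?thesis by (rule power2_le_imp_le) simp
qed

locale haar_measure =
  fixes N :: nat and \<mu> :: "complex mat measure"
  assumes haar: "normalized_haar N \<mu>"
begin

sublocale prob_space \<mu>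
  using haar by (simp add: normalized_haar_def)

lemma sets_haar: "sets \<mu> = sets (unitary_borel N)"
  using haar by (simp add: normalized_haar_def)

lemma space_haar: "space \<mu> = unitary_group N"
  using sets_eq_imp_space_eq[OF sets_haar] by (simp add: unitary_borel_def)

text \<open>Measurability holds by construction of the generated sigma-algebra; the bound holds
  because the rows of a unitary matrix are unit vectors.\<close>

lemma bounded_measurable_entry:
  assumes ij: "i < N" "j < N"
  shows "bounded_measurable \<mu> (\<lambda>u. u $$ (i, j))"
proof -
  let ?I = "{..<N} \<times> {..<N}"
  have "(\<lambda>u. \<lambda>ij\<in>?I. u $$ ij) \<in> measurable (unitary_borel N) (Pi\<^sub>M ?I (\<lambda>_. borel :: complex measure))"
    unfolding unitary_borel_def by (rule measurable_vimage_algebra1) (auto simp: space_PiM)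
  moreover have "(\<lambda>f. f (i, j)) \<in> measurable (Pi\<^sub>M ?I (\<lambda>_. borel :: complex measure)) borel"
    using ij by (intro measurable_component_singleton) auto
  ultimately have "(\<lambda>f. f (i, j)) \<circ> (\<lambda>u. \<lambda>ij\<in>?I. u $$ ij) \<in> borel_measurable (unitary_borel N)"
    by (rule measurable_comp)
  then have "(\<lambda>u. u $$ (i, j)) \<in> borel_measurable (unitary_borel N)"
    using ij by (simp add: comp_def)
  then have "(\<lambda>u. u $$ (i, j)) \<in> borel_measurable \<mu>"
    using measurable_cong_sets[OF sets_haar refl, of borel] by auto
  then show ?thesis
    using unitary_group_entry_norm[OF _ ij] by (auto simp: bounded_measurable_def space_haar)
qed

lemma left_mult_measurable:
  assumes v: "v \<in> unitary_group N"
  shows "(\<lambda>u. v * u) \<in> measurable \<mu> \<mu>"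
proof -
  let ?I = "{..<N} \<times> {..<N}"
  have "(\<lambda>u. v * u) \<in> measurable \<mu> (unitary_borel N)"
    unfolding unitary_borel_def
  proof (rule measurable_vimage_algebra2)
    show "(\<lambda>u. v * u) \<in> space \<mu> \<rightarrow> unitary_group N"
      using unitary_group_mult(1)[OF v] by (auto simp: space_haar)
    show "(\<lambda>u. \<lambda>ij\<in>?I. (v * u) $$ ij) \<in> measurable \<mu> (Pi\<^sub>M ?I (\<lambda>_. borel))"
    proof (rule measurable_restrict)
      fix ij assume "ij \<in> ?I"
      then obtain i j where ij: "ij = (i, j)" "i < N" "j < N" by auto
      have "bounded_measurable \<mu> (\<lambda>u. \<Sum>k<N. v $$ (i, k) * u $$ (k, j))"
        using ij
        by (intro bounded_measurable_sum bounded_measurable_mult bounded_measurable_const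
            bounded_measurable_entry) auto
      moreover have "(v * u) $$ (i, j) = (\<Sum>k<N. v $$ (i, k) * u $$ (k, j))" if "u \<in> space \<mu>" for u
        using that v ij by (intro product_index) (auto simp: space_haar unitary_group_def)
      ultimately have "bounded_measurable \<mu> (\<lambda>u. (v * u) $$ (i, j))"
        by (rule bounded_measurable_eq)
      then show "(\<lambda>u. (v * u) $$ ij) \<in> borel_measurable \<mu>"
        by (simp add: bounded_measurable_def ij)
    qed
  qed
  then show ?thesis using measurable_cong_sets[OF refl sets_haar] by auto
qed

lemma integral_left_mult:
  fixes f :: "complex mat \<Rightarrow> complex"
  assumes v: "v \<in> unitary_group N" and f: "f \<in> borel_measurable \<mu>"
  shows "(LINT u|\<mu>. f (v * u)) = (LINT u|\<mu>. f u)"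
proof -
  have "(LINT u|\<mu>. f u) = (LINT u|distr \<mu> \<mu> (\<lambda>u. v * u). f u)"
    using haar v by (simp add: normalized_haar_def)
  also have "\<dots> = (LINT u|\<mu>. f (v * u))"
    by (rule integral_distr[OF left_mult_measurable[OF v] f])
  finally show ?thesis ..
qed

end

text \<open>A power of \<open>1 + t^2\<close> is even in \<open>t\<close>.\<close>

lemma coeff_1_power_one_plus_square: "coeff (Polynomial.smult c ([:1, 0, 1:] ^ m)) 1 = (0 :: complex)"
proof -
  have "coeff ([:1, 0, 1:] ^ m :: complex poly) 1 = poly (pderiv ([:1, 0, 1:] ^ m)) 0"
    by (simp add: poly_0_coeff_0 coeff_pderiv)
  also have "\<dots> = 0" by (simp add: pderiv_power pderiv_pCons)
  finally show ?thesis by simp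
qed

lemma poly_eq_on_reals:
  fixes p q :: "complex poly"
  assumes "\<And>t :: real. poly p (of_real t) = poly q (of_real t)"
  shows "p = q"
proof (rule ccontr)
  assume "p \<noteq> q"
  then have "finite {x. poly (p - q) x = 0}" by (intro poly_roots_finite) simp
  moreover have "range complex_of_real \<subseteq> {x. poly (p - q) x = 0}" using assms by auto
  ultimately have "finite (range complex_of_real)" by (rule finite_subset[rotated])
  then have "finite (UNIV :: real set)" by (rule finite_imageD) (auto simp: inj_on_def)
  then show False using infinite_UNIV_char_0 by blast
qed

section \<open>Integrals along a unitary orbit\<close>

locale haar_orbit = haar_measure +
  fixes x :: "complex mat"
  assumes x: "x \<in> carrier_mat N N"
begin

definition orbit :: "complex mat \<Rightarrow> complex mat" where
  "orbit u = u * x * mat_adjoint u"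

lemma unitary_carrier: "u \<in> unitary_group N \<Longrightarrow> u \<in> carrier_mat N N"
  by (simp add: unitary_group_def)

lemma orbit_carrier: "u \<in> unitary_group N \<Longrightarrow> orbit u \<in> carrier_mat N N"
  unfolding orbit_def using x unitary_carrier
  by (intro mult_carrier_mat[of _ N N _ N]) auto

lemma orbit_mult:
  "v \<in> unitary_group N \<Longrightarrow> u \<in> unitary_group N \<Longrightarrow> orbit (v * u) = v * orbit u * mat_adjoint v"
  unfolding orbit_def by (rule unitary_group_mult(2)[OF _ _ x])

lemma bounded_measurable_orbit:
  assumes ij: "i < N" "j < N"
  shows "bounded_measurable \<mu> (\<lambda>u. orbit u $$ (i, j))"
proof -
  have "bounded_measurable \<mu> (\<lambda>u. \<Sum>b<N. (\<Sum>a<N. u $$ (i, a) * x $$ (a, b)) * cnj (u $$ (j, b)))"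
    using ij by (intro bounded_measurable_sum bounded_measurable_mult bounded_measurable_const
        bounded_measurable_cnj bounded_measurable_entry) auto
  moreover have "orbit u $$ (i, j) = (\<Sum>b<N. (\<Sum>a<N. u $$ (i, a) * x $$ (a, b)) * cnj (u $$ (j, b)))"
    if "u \<in> space \<mu>" for u
  proof -
    have u: "u \<in> carrier_mat N N" using that by (simp add: space_haar unitary_carrier)
    have "orbit u $$ (i, j) = (\<Sum>b<N. (\<Sum>a<N. u $$ (i, a) * x $$ (a, b)) * mat_adjoint u $$ (b, j))"
      unfolding orbit_def using u x ij by (intro triple_product_index) auto
    also have "\<dots> = (\<Sum>b<N. (\<Sum>a<N. u $$ (i, a) * x $$ (a, b)) * cnj (u $$ (j, b)))"
      using u ij by (intro sum.cong) auto
    finally show ?thesis .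
  qed
  ultimately show ?thesis by (rule bounded_measurable_eq)
qed

abbreviation block :: "nat \<Rightarrow> complex mat \<Rightarrow> complex mat" where
  "block k u \<equiv> leading_block k (orbit u)"

lemma bounded_measurable_block:
  assumes "k \<le> N"
  shows "bounded_coeffs \<mu> (\<lambda>u. char_poly (block k u))"
    and "i < k \<Longrightarrow> j < k \<Longrightarrow> bounded_coeffs \<mu> (\<lambda>u. resolvent (block k u) $$ (i, j))"
  using assms
  by (auto intro!: bounded_coeffs_char_poly[where n = k] bounded_measurable_orbit)

lemma bounded_measurable_leading_minor:
  "k \<le> N \<Longrightarrow> bounded_measurable \<mu> (\<lambda>u. leading_minor k (orbit u))"
  unfolding leading_minor_def by (intro bounded_measurable_det bounded_measurable_orbit) auto

lemma block_rotation:
  assumes "i < K" "K < N" "u \<in> unitary_group N" "a * cnj a = 1"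
  shows "block (Suc K) (plane_rotation N i K t a * u) =
    plane_rotation (Suc K) i K t a * block (Suc K) u * mat_adjoint (plane_rotation (Suc K) i K t a)"
  using assms
  by (subst orbit_mult) (auto intro!: plane_rotation_unitary leading_block_rotation orbit_carrier)

lemma bounded_measurable_mixed_rows:
  assumes "K < N"
  shows "bounded_coeffs \<mu>
    (\<lambda>u. mixed_rows K l (resolvent (block (Suc K) u) $$ (K, K)) (char_poly (block (Suc K) u)) r i)"
  unfolding mixed_rows_def using assms
  by (intro bounded_coeffs_if bounded_coeffs_mult
      bounded_coeffs_const bounded_coeffs_pderiv bounded_measurable_block) auto

text \<open>By left invariance, the integral of the weighted test function times
  \<open>(1 + t^2)^(r + 1)\<close> is for every real \<open>t\<close> the integral of
  \<open>rotation_poly\<close> at \<open>t\<close>. Both sides are polynomials in \<open>t\<close>,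
  and the first is even, so the linear coefficient of \<open>rotation_poly\<close> integrates to
  0.\<close>

lemma integral_radial_defect:
  assumes K: "K < N" and i: "i < K" and r: "r < M"
    and W: "bounded_measurable \<mu> W"
    and inv: "\<And>t a u. a * cnj a = 1 \<Longrightarrow> u \<in> unitary_group N \<Longrightarrow>
      W (plane_rotation N i K t a * u) = W u"
  shows "bounded_measurable \<mu> (\<lambda>u. radial_defect K M l r (block (Suc K) u) i)"
    and "(LINT u|\<mu>. W u * radial_defect K M l r (block (Suc K) u) i) = 0"
proof -
  let ?Y = "block (Suc K)"
  let ?n = "K + M"
  have bA: "bounded_coeffs \<mu> (\<lambda>u. resolvent (?Y u) $$ (p, q))" if "p < Suc K" "q < Suc K" for p q
    using bounded_measurable_block(2)[of "Suc K" p q] K that by simp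
  have bAm: "bounded_coeffs \<mu> (\<lambda>u. resolvent (?Y u) $$ (p, q) * monom 1 m)"
    if "p < Suc K" "q < Suc K" for p q m
    using bA[OF that] by (intro bounded_coeffs_mult bounded_coeffs_const)
  have bR: "bounded_coeffs \<mu>
      (\<lambda>u. mixed_rows K l (resolvent (?Y u) $$ (K, K)) (char_poly (?Y u)) r m)" for m
    by (rule bounded_measurable_mixed_rows[OF K])
  have upd1: "bounded_coeffs \<mu>
      (\<lambda>u. ((mixed_rows K l (resolvent (?Y u) $$ (K, K)) (char_poly (?Y u)) r)(m := F u)) m')"
    if "bounded_coeffs \<mu> F" for m m' F
    using that bR by (cases "m' = m") auto
  have upd2: "bounded_coeffs \<mu>
      (\<lambda>u. ((mixed_rows K l (resolvent (?Y u) $$ (K, K)) (char_poly (?Y u)) r)(m1 := G u, m := F u)) m')"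
    if "bounded_coeffs \<mu> F" "bounded_coeffs \<mu> G" for m m' m1 F G
    using that bR by (cases "m' = m"; cases "m' = m1") auto
  have bDiff: "bounded_coeffs \<mu>
      (\<lambda>u. (resolvent (?Y u) $$ (i, i) - resolvent (?Y u) $$ (K, K)) * monom 1 r)"
    using i by (intro bounded_coeffs_mult bounded_coeffs_const
        bounded_coeffs_diff bA) auto
  show bD: "bounded_measurable \<mu> (\<lambda>u. radial_defect K M l r (?Y u) i)"
    unfolding radial_defect_def Let_def using i
    by (intro bounded_measurable_add bounded_measurable_sum bounded_measurable_coeff_det upd1 upd2 bDiff bAm) auto
  have bRem: "bounded_measurable \<mu> (\<lambda>u. rotation_remainder K M l r i (?Y u))"
    unfolding rotation_remainder_def Let_def using i
    by (intro bounded_measurable_sum bounded_measurable_coeff_det upd2 bAm) auto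
  have bT: "bounded_measurable \<mu> (\<lambda>u. rotation_test K M l r i (?Y u))"
    unfolding rotation_test_def Let_def using i
    by (intro bounded_measurable_coeff_det upd1 bAm) auto
  have bP: "bounded_coeffs \<mu> (\<lambda>u. rotation_poly K M l r i a (?Y u))" for a
    unfolding rotation_poly_def Let_def quadratic_det_def
  proof (rule bounded_coeffs_det[where n = ?n])
    fix m j assume mj: "m < ?n" "j < ?n"
    have c: "bounded_measurable \<mu> (\<lambda>u. coeff (F u) j)" if "bounded_coeffs \<mu> F" for F
      using that by (simp add: bounded_coeffs_def)
    have q: "bounded_coeffs \<mu> (\<lambda>u. linear_row K r i a (resolvent (?Y u)) m)"
      unfolding linear_row_def
      using i by (intro bounded_coeffs_if bounded_coeffs_mult
          bounded_coeffs_const bounded_coeffs_add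
          bounded_coeffs_diff bounded_coeffs_smult bA) auto
    have s: "bounded_coeffs \<mu> (\<lambda>u. quadratic_row K r i a (resolvent (?Y u)) m)"
      unfolding quadratic_row_def
      using i by (intro bounded_coeffs_if bounded_coeffs_mult
          bounded_coeffs_const bounded_coeffs_smult bA) auto
    have p: "bounded_coeffs \<mu> (\<lambda>u. ((mixed_rows K l (resolvent (?Y u) $$ (K, K)) (char_poly (?Y u)) r)
        (K + r := resolvent (?Y u) $$ (K, i) * monom 1 r)) m)"
      using i by (intro upd1 bAm) auto
    show "bounded_coeffs \<mu> (\<lambda>u. Matrix.mat ?n ?n (\<lambda>(m, j).
        [:coeff (((mixed_rows K l (resolvent (?Y u) $$ (K, K)) (char_poly (?Y u)) r)
            (K + r := resolvent (?Y u) $$ (K, i) * monom 1 r)) m) j,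
          coeff (linear_row K r i a (resolvent (?Y u)) m) j,
          coeff (quadratic_row K r i a (resolvent (?Y u)) m) j:]) $$ (m, j))"
      unfolding index_mat(1)[OF mj] split
      by (intro bounded_coeffs_pCons bounded_coeffs_const c[OF p] c[OF q] c[OF s])
  qed simp
  have zero: "(LINT u|\<mu>. W u * coeff (rotation_poly K M l r i a (?Y u)) 1) = 0" if a: "a * cnj a = 1" for a
  proof -
    let ?P = "\<lambda>u. rotation_poly K M l r i a (?Y u)"
    let ?E = "LINT u|\<mu>. W u * rotation_test K M l r i (?Y u)"
    \<comment> \<open>The integral taken coefficient by coefficient; \<open>2 * ?n\<close> bounds
      the degrees for all \<open>u\<close> at once.\<close>
    define Q where "Q = (\<Sum>m\<le>2 * ?n. monom (LINT u|\<mu>. W u * coeff (?P u) m) m)"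
    have intg: "integrable \<mu> (\<lambda>u. W u * coeff (?P u) m)" for m
      using W bP by (intro integrable_bounded_measurable bounded_measurable_mult)
        (auto simp: bounded_coeffs_def)
    have WT: "bounded_measurable \<mu> (\<lambda>u. W u * rotation_test K M l r i (?Y u))"
      using W bT by (rule bounded_measurable_mult)
    have "poly (Polynomial.smult ?E ([:1, 0, 1:] ^ Suc r)) (of_real t) = poly Q (of_real t)" for t :: real
    proof -
      let ?v = "plane_rotation N i K t a"
      have v: "?v \<in> unitary_group N" using i K a by (intro plane_rotation_unitary) auto
      have "?E = (LINT u|\<mu>. W (?v * u) * rotation_test K M l r i (?Y (?v * u)))"
        using integral_left_mult[OF v, of "\<lambda>u. W u * rotation_test K M l r i (?Y u)"] WT
        by (simp add: bounded_measurable_def)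
      then have "(1 + (of_real t)\<^sup>2) ^ Suc r * ?E = (LINT u|\<mu>. (1 + (of_real t)\<^sup>2) ^ Suc r *
          (W (?v * u) * rotation_test K M l r i (?Y (?v * u))))"
        by simp
      also have "\<dots> = (LINT u|\<mu>. (\<Sum>m\<le>2 * ?n. (W u * coeff (?P u) m) * of_real t ^ m))"
      proof (rule Bochner_Integration.integral_cong[OF refl])
        fix u assume "u \<in> space \<mu>"
        then have u: "u \<in> unitary_group N" by (simp add: space_haar)
        have "(1 + (complex_of_real t)\<^sup>2) ^ Suc r * rotation_test K M l r i (?Y (?v * u)) = poly (?P u) (of_real t)"
          unfolding block_rotation[OF i K u a]
          by (rule rotation_test_rotated[OF _ i a r]) simp
        also have "\<dots> = (\<Sum>m\<le>degree (?P u). coeff (?P u) m * of_real t ^ m)"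
          by (rule poly_altdef)
        also have "\<dots> = (\<Sum>m\<le>2 * ?n. coeff (?P u) m * of_real t ^ m)"
          by (rule sum.mono_neutral_left)
            (auto simp: coeff_eq_0 rotation_poly_def Let_def intro: order.trans degree_quadratic_det)
        finally have "(1 + (complex_of_real t)\<^sup>2) ^ Suc r * rotation_test K M l r i (?Y (?v * u)) =
            (\<Sum>m\<le>2 * ?n. coeff (?P u) m * of_real t ^ m)" .
        then have "W u * ((1 + (complex_of_real t)\<^sup>2) ^ Suc r * rotation_test K M l r i (?Y (?v * u))) =
            (\<Sum>m\<le>2 * ?n. (W u * coeff (?P u) m) * of_real t ^ m)"
          by (simp only: sum_distrib_left mult.assoc)
        then show "(1 + (of_real t)\<^sup>2) ^ Suc r * (W (?v * u) * rotation_test K M l r i (?Y (?v * u))) =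
            (\<Sum>m\<le>2 * ?n. (W u * coeff (?P u) m) * of_real t ^ m)"
          unfolding inv[OF a u] by (simp only: mult.left_commute)
      qed
      also have "\<dots> = (\<Sum>m\<le>2 * ?n. (LINT u|\<mu>. (W u * coeff (?P u) m) * of_real t ^ m))"
        by (intro Bochner_Integration.integral_sum integrable_mult_left intg)
      also have "\<dots> = (\<Sum>m\<le>2 * ?n. (LINT u|\<mu>. W u * coeff (?P u) m) * of_real t ^ m)"
        by (simp only: integral_mult_left_zero)
      also have "\<dots> = poly Q (of_real t)"
        by (simp add: Q_def poly_sum poly_monom)
      finally show ?thesis
        by (simp add: poly_power power2_eq_square algebra_simps)
    qed
    then have "Polynomial.smult ?E ([:1, 0, 1:] ^ Suc r) = Q" by (rule poly_eq_on_reals)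
    then have "coeff Q 1 = 0" using coeff_1_power_one_plus_square by metis
    moreover have "coeff Q 1 = (LINT u|\<mu>. W u * coeff (?P u) 1)"
      using r by (simp add: Q_def coeff_sum)
    ultimately show ?thesis by simp
  qed
  txt \<open>Comparing the phases \<open>1\<close> and \<open>\<i>\<close> separates the two terms of the linear coefficient.\<close>
  let ?D = "LINT u|\<mu>. W u * radial_defect K M l r (?Y u) i"
  let ?F = "LINT u|\<mu>. W u * rotation_remainder K M l r i (?Y u)"
  have split: "a * ?D + cnj a * ?F = 0" if a: "a * cnj a = 1" for a
  proof -
    have "0 = (LINT u|\<mu>. a * (W u * radial_defect K M l r (?Y u) i) + cnj a * (W u * rotation_remainder K M l r i (?Y u)))"
      using zero[OF a] unfolding coeff_rotation_poly_1[OF r]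
      by (simp only: distrib_left mult.left_commute[of "W _"])
    also have "\<dots> = a * ?D + cnj a * ?F"
      using W bD bRem
      by (subst Bochner_Integration.integral_add)
        (auto intro!: integrable_mult_right integrable_bounded_measurable bounded_measurable_mult )
    finally show ?thesis by simp
  qed
  from split[of 1] split[of \<i>] show "?D = 0"
    by (simp add: algebra_simps)
qed

end

section \<open>From one block size to the next\<close>

lemma power_rows_det_cong:
  "(\<And>i. i < k \<Longrightarrow> l i = l' i) \<Longrightarrow> power_rows_det k M l \<phi> = power_rows_det k M l' \<phi>"
  unfolding power_rows_det_def by (intro coeff_det_cong) auto

lemma power_rows_det_absorb_power:
  "((-1) ^ k * coeff \<phi> 0) ^ n * power_rows_det k M l \<phi> = power_rows_det k (M + n) (\<lambda>i. l i + n) \<phi>"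
proof (induction n)
  case (Suc n)
  have "((-1) ^ k * coeff \<phi> 0) ^ Suc n * power_rows_det k M l \<phi> =
      (-1) ^ k * coeff \<phi> 0 * power_rows_det k (M + n) (\<lambda>i. l i + n) \<phi>"
    using Suc by (simp add: mult_ac)
  then show ?case by (simp add: power_rows_det_absorb)
qed simp

lemma det_eq_coeff_char_poly:
  fixes Y :: "complex mat"
  assumes Y: "Y \<in> carrier_mat k k"
  shows "Determinant.det Y = (-1) ^ k * coeff (char_poly Y) 0"
proof -
  have "coeff (char_poly Y) 0 = Determinant.det (map_mat (\<lambda>p. poly p 0) (char_poly_matrix Y))"
    unfolding poly_0_coeff_0[symmetric] char_poly_def poly_det ..
  also have "map_mat (\<lambda>p. poly p 0) (char_poly_matrix Y) = (- 1) \<cdot>\<^sub>m Y"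
    using Y by (intro eq_matI) (auto simp: char_poly_matrix_def)
  also have "Determinant.det \<dots> = (-1) ^ k * Determinant.det Y"
    using Y by simp
  finally show ?thesis by (simp add: mult.assoc[symmetric] power_mult_distrib[symmetric])
qed

text \<open>The result of two alternating moves: a larger block prepends the exponent 0 and raises
  the others by 1, and absorbing the power of its minor adds \<open>a k\<close> to all. Beyond the
  staircase \<open>i\<close>, the partial sums are the parts of a partition in increasing
  order.\<close>

definition minor_exponent :: "(nat \<Rightarrow> nat) \<Rightarrow> nat \<Rightarrow> nat \<Rightarrow> nat" where
  "minor_exponent a k i = i + (\<Sum>j\<in>{k - i..k}. a j)"

lemma minor_exponent_Suc:
  "i < Suc k \<Longrightarrow> minor_exponent a (Suc k) i =
    case_nat 0 (\<lambda>i. Suc (minor_exponent a k i)) i + a (Suc k)"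
  by (cases i) (auto simp: minor_exponent_def Suc_diff_le)

context haar_orbit
begin

text \<open>\<open>radial_identity\<close> under the integral: its right side is a sum of defects,
  each of which integrates to 0 against a weight fixed by the rotations.\<close>

lemma integral_mixed_rows_step:
  fixes l :: "nat \<Rightarrow> nat"
  assumes K: "K < N" and r: "r < M"
    and W: "bounded_measurable \<mu> W"
    and inv: "\<And>i t a u. i < K \<Longrightarrow> a * cnj a = 1 \<Longrightarrow> u \<in> unitary_group N \<Longrightarrow>
      W (plane_rotation N i K t a * u) = W u"
  defines "R \<equiv> \<lambda>r u. mixed_rows K l (resolvent (block (Suc K) u) $$ (K, K)) (char_poly (block (Suc K) u)) r"
  shows "(LINT u|\<mu>. W u * coeff_det (K + M) (R r u)) =
    of_nat (Suc K + r) * (LINT u|\<mu>. W u * coeff_det (K + M) (R (Suc r) u))"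
proof -
  let ?D = "\<lambda>i u. radial_defect K M l r (block (Suc K) u) i"
  note D = integral_radial_defect[OF K _ r W inv]
  have intR: "integrable \<mu> (\<lambda>u. W u * coeff_det (K + M) (R r u))" for r
    unfolding R_def using W bounded_measurable_mixed_rows[OF K]
    by (intro integrable_bounded_measurable bounded_measurable_mult bounded_measurable_coeff_det) auto
  have intD: "integrable \<mu> (\<lambda>u. W u * ?D i u)" if "i < K" for i
    using W D(1)[OF that] that by (intro integrable_bounded_measurable bounded_measurable_mult) auto
  have "(LINT u|\<mu>. W u * coeff_det (K + M) (R r u)) -
      of_nat (Suc K + r) * (LINT u|\<mu>. W u * coeff_det (K + M) (R (Suc r) u)) =
      (LINT u|\<mu>. W u * coeff_det (K + M) (R r u) - of_nat (Suc K + r) * (W u * coeff_det (K + M) (R (Suc r) u)))"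
    by (subst Bochner_Integration.integral_diff) (auto intro!: intR integrable_mult_right)
  also have "\<dots> = (LINT u|\<mu>. (\<Sum>i<K. W u * ?D i u))"
  proof (intro Bochner_Integration.integral_cong refl)
    fix u
    have "coeff_det (K + M) (R r u) - of_nat (Suc K + r) * coeff_det (K + M) (R (Suc r) u) = (\<Sum>i<K. ?D i u)"
      unfolding R_def by (rule radial_identity[OF _ r]) simp
    then have "W u * (coeff_det (K + M) (R r u) - of_nat (Suc K + r) * coeff_det (K + M) (R (Suc r) u)) =
        W u * (\<Sum>i<K. ?D i u)" by (rule arg_cong)
    then show "W u * coeff_det (K + M) (R r u) - of_nat (Suc K + r) * (W u * coeff_det (K + M) (R (Suc r) u)) =
        (\<Sum>i<K. W u * ?D i u)"
      by (simp only: right_diff_distrib sum_distrib_left mult.left_commute)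
  qed
  also have "\<dots> = (\<Sum>i<K. LINT u|\<mu>. W u * ?D i u)"
    by (intro Bochner_Integration.integral_sum intD) auto
  also have "\<dots> = 0"
    using D(2) by (intro sum.neutral) auto
  finally show ?thesis by simp
qed

text \<open>At \<open>r = M\<close> the rows past \<open>K\<close> contain the smaller
  characteristic polynomial, at \<open>r = 0\<close> they are derivatives. The factors of the
  \<open>M\<close> steps between multiply to \<open>(K + M)! / K!\<close>, and
  \<open>power_rows_det_derivative\<close> cancels the numerator.\<close>

lemma integral_power_rows_det_step:
  assumes K: "K < N"
    and W: "bounded_measurable \<mu> W"
    and inv: "\<And>i t a u. i < K \<Longrightarrow> a * cnj a = 1 \<Longrightarrow> u \<in> unitary_group N \<Longrightarrow>
      W (plane_rotation N i K t a * u) = W u"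
  shows "(\<Prod>i<K. of_nat (Suc (l i))) * (LINT u|\<mu>. W u * power_rows_det K M l (char_poly (block K u))) =
    fact K * (LINT u|\<mu>. W u *
      power_rows_det (Suc K) M (case_nat 0 (\<lambda>i. Suc (l i))) (char_poly (block (Suc K) u)))"
proof -
  define R where "R r u = mixed_rows K l (resolvent (block (Suc K) u) $$ (K, K)) (char_poly (block (Suc K) u)) r" for r u
  define I where "I r = (LINT u|\<mu>. W u * coeff_det (K + M) (R r u))" for r
  have iter: "fact K * I 0 = fact (K + r) * I r" if "r \<le> M" for r
    using that
  proof (induction r)
    case (Suc r)
    have "I r = of_nat (Suc K + r) * I (Suc r)"
      unfolding I_def R_def using Suc.prems by (intro integral_mixed_rows_step[OF K _ W inv]) auto
    then show ?case using Suc by (simp add: algebra_simps)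
  qed simp
  have "resolvent (block (Suc K) u) $$ (K, K) = char_poly (block K u)" for u
  proof -
    have "mat_delete (block (Suc K) u) K K = block K u"
      by (intro eq_matI) (auto simp: mat_delete_def)
    then show ?thesis using resolvent_diag[of "block (Suc K) u" "Suc K" K] by simp
  qed
  then have IM: "I M = (LINT u|\<mu>. W u * power_rows_det K M l (char_poly (block K u)))"
    unfolding I_def R_def power_rows_det_def
    by (intro Bochner_Integration.integral_cong refl arg_cong2[where f = "(*)"] coeff_det_cong)
      (auto simp: mixed_rows_def)
  have "(\<Prod>i<K. of_nat (Suc (l i))) * I 0 = (LINT u|\<mu>. (\<Prod>i<K. of_nat (Suc (l i))) * (W u * coeff_det (K + M) (R 0 u)))"
    by (simp add: I_def)
  also have "\<dots> = (LINT u|\<mu>. fact (K + M) * (W u *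
      power_rows_det (Suc K) M (case_nat 0 (\<lambda>i. Suc (l i))) (char_poly (block (Suc K) u))))"
  proof (intro Bochner_Integration.integral_cong refl)
    fix u
    have "coeff_det (K + M) (R 0 u) = coeff_det (K + M) (\<lambda>i. if i < K then monom 1 (l i)
        else pderiv (char_poly (block (Suc K) u) * monom 1 (i - K)))"
      by (intro coeff_det_cong) (simp add: R_def mixed_rows_def)
    then have "(\<Prod>i<K. of_nat (Suc (l i))) * coeff_det (K + M) (R 0 u) = fact (K + M) *
        power_rows_det (Suc K) M (case_nat 0 (\<lambda>i. Suc (l i))) (char_poly (block (Suc K) u))"
      by (simp only: power_rows_det_derivative)
    then have "W u * ((\<Prod>i<K. of_nat (Suc (l i))) * coeff_det (K + M) (R 0 u)) = W u * (fact (K + M) *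
        power_rows_det (Suc K) M (case_nat 0 (\<lambda>i. Suc (l i))) (char_poly (block (Suc K) u)))"
      by (rule arg_cong)
    then show "(\<Prod>i<K. of_nat (Suc (l i))) * (W u * coeff_det (K + M) (R 0 u)) = fact (K + M) * (W u *
        power_rows_det (Suc K) M (case_nat 0 (\<lambda>i. Suc (l i))) (char_poly (block (Suc K) u)))"
      by (simp only: mult.left_commute)
  qed
  also have "\<dots> = fact (K + M) * (LINT u|\<mu>. W u *
      power_rows_det (Suc K) M (case_nat 0 (\<lambda>i. Suc (l i))) (char_poly (block (Suc K) u)))"
    by (rule integral_mult_right_zero)
  finally have P0: "(\<Prod>i<K. of_nat (Suc (l i))) * I 0 = \<dots>" .
  have "fact (K + M) * ((\<Prod>i<K. of_nat (Suc (l i))) * I M) = (\<Prod>i<K. of_nat (Suc (l i))) * (fact (K + M) * I M)"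
    by (rule mult.left_commute)
  also have "\<dots> = (\<Prod>i<K. of_nat (Suc (l i))) * (fact K * I 0)"
    by (simp only: iter[OF order.refl])
  also have "\<dots> = fact K * ((\<Prod>i<K. of_nat (Suc (l i))) * I 0)"
    by (rule mult.left_commute)
  also have "\<dots> = fact (K + M) * (fact K * (LINT u|\<mu>. W u *
      power_rows_det (Suc K) M (case_nat 0 (\<lambda>i. Suc (l i))) (char_poly (block (Suc K) u))))"
    unfolding P0 by (rule mult.left_commute)
  finally have "fact (K + M) * ((\<Prod>i<K. of_nat (Suc (l i))) * I M) = \<dots>" .
  then show ?thesis unfolding IM by simp
qed

text \<open>The invariant of the recursion: the powers of the first \<open>k\<close> minors are
  exchanged for a determinant of the block of size \<open>k\<close>, those of the larger minors
  remain as the weight. At \<open>k = 0\<close> the determinant is empty.\<close>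

lemma moment_recursion:
  assumes "k \<le> N"
  shows "(\<Prod>K<k. \<Prod>i<K. of_nat (Suc (minor_exponent a K i))) *
      (LINT u|\<mu>. (\<Prod>j\<in>{1..N}. leading_minor j (orbit u) ^ a j)) =
    (\<Prod>K<k. fact K) * (LINT u|\<mu>. (\<Prod>j\<in>{Suc k..N}. leading_minor j (orbit u) ^ a j) *
      power_rows_det k (\<Sum>j\<in>{1..k}. a j) (minor_exponent a k) (char_poly (block k u)))"
  using assms
proof (induction k)
  case 0
  show ?case by (simp add: power_rows_det_def coeff_det_def)
next
  case (Suc k)
  then have k: "k < N" by simp
  let ?W = "\<lambda>u. \<Prod>j\<in>{Suc k..N}. leading_minor j (orbit u) ^ a j"
  let ?W' = "\<lambda>u. \<Prod>j\<in>{Suc (Suc k)..N}. leading_minor j (orbit u) ^ a j"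
  let ?M = "\<Sum>j\<in>{1..k}. a j" and ?l = "minor_exponent a k"
  let ?l' = "case_nat 0 (\<lambda>i. Suc (?l i))"
  have W: "bounded_measurable \<mu> ?W"
    by (intro bounded_measurable_prod bounded_measurable_power bounded_measurable_leading_minor) auto
  \<comment> \<open>Every minor in the weight has size above \<open>k\<close>, so both rotated
    coordinates lie in its block.\<close>
  have inv: "?W (plane_rotation N i k t b * u) = ?W u"
    if "i < k" "b * cnj b = 1" "u \<in> unitary_group N" for i t b u
  proof (intro prod.cong refl arg_cong2[where f = "(^)"])
    fix j assume "j \<in> {Suc k..N}"
    then show "leading_minor j (orbit (plane_rotation N i k t b * u)) = leading_minor j (orbit u)"
      using that k
      by (subst orbit_mult) (auto intro!: plane_rotation_unitary leading_minor_rotation orbit_carrier)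
  qed
  have absorb: "?W u * power_rows_det (Suc k) ?M ?l' (char_poly (block (Suc k) u)) =
      ?W' u * power_rows_det (Suc k) (\<Sum>j\<in>{1..Suc k}. a j) (minor_exponent a (Suc k)) (char_poly (block (Suc k) u))" for u
  proof -
    have "?W u = leading_minor (Suc k) (orbit u) ^ a (Suc k) * ?W' u"
      using k by (intro prod.atLeast_Suc_atMost) auto
    then have "?W u * power_rows_det (Suc k) ?M ?l' (char_poly (block (Suc k) u)) =
        ?W' u * (leading_minor (Suc k) (orbit u) ^ a (Suc k) * power_rows_det (Suc k) ?M ?l' (char_poly (block (Suc k) u)))"
      by (simp only: mult_ac)
    also have "leading_minor (Suc k) (orbit u) = (-1) ^ Suc k * coeff (char_poly (block (Suc k) u)) 0"
      unfolding leading_minor_eq_det by (rule det_eq_coeff_char_poly) simp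
    also have "(\<dots>) ^ a (Suc k) * power_rows_det (Suc k) ?M ?l' (char_poly (block (Suc k) u)) =
        power_rows_det (Suc k) (\<Sum>j\<in>{1..Suc k}. a j) (minor_exponent a (Suc k)) (char_poly (block (Suc k) u))"
    proof -
      have "(\<Sum>j\<in>{1..Suc k}. a j) = ?M + a (Suc k)" by simp
      then show ?thesis
        unfolding power_rows_det_absorb_power
        by (simp only:) (rule power_rows_det_cong, simp add: minor_exponent_Suc)
    qed
    finally show ?thesis .
  qed
  have "(\<Prod>K<Suc k. \<Prod>i<K. of_nat (Suc (minor_exponent a K i))) *
      (LINT u|\<mu>. (\<Prod>j\<in>{1..N}. leading_minor j (orbit u) ^ a j)) =
      (\<Prod>K<k. fact K) * ((\<Prod>i<k. of_nat (Suc (?l i))) *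
        (LINT u|\<mu>. ?W u * power_rows_det k ?M ?l (char_poly (block k u))))"
    using Suc.IH k by (simp add: mult_ac)
  also have "(\<Prod>i<k. of_nat (Suc (?l i))) * (LINT u|\<mu>. ?W u * power_rows_det k ?M ?l (char_poly (block k u))) =
      fact k * (LINT u|\<mu>. ?W u * power_rows_det (Suc k) ?M ?l' (char_poly (block (Suc k) u)))"
    by (rule integral_power_rows_det_step[OF k W inv])
  finally show ?case unfolding absorb by (simp add: mult_ac)
qed

lemma leading_block_full: "Y \<in> carrier_mat N N \<Longrightarrow> leading_block N Y = Y"
  by (intro eq_matI) auto

lemma integer_moments:
  "(\<Prod>K<N. \<Prod>i<K. of_nat (Suc (minor_exponent a K i))) *
      (LINT u|\<mu>. (\<Prod>j\<in>{1..N}. leading_minor j (orbit u) ^ a j)) =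
    (\<Prod>K<N. fact K) * power_rows_det N (\<Sum>j\<in>{1..N}. a j) (minor_exponent a N) (char_poly x)"
proof -
  have "char_poly (block N u) = char_poly x" if "u \<in> space \<mu>" for u
    using that char_poly_unitary_conj[OF _ x, of u]
    by (simp add: leading_block_full orbit_carrier space_haar) (simp add: orbit_def)
  then have "(LINT u|\<mu>. (\<Prod>j\<in>{Suc N..N}. leading_minor j (orbit u) ^ a j) *
      power_rows_det N (\<Sum>j\<in>{1..N}. a j) (minor_exponent a N) (char_poly (block N u))) =
      (LINT u|\<mu>. power_rows_det N (\<Sum>j\<in>{1..N}. a j) (minor_exponent a N) (char_poly x))"
    by (intro Bochner_Integration.integral_cong refl) simp
  also have "\<dots> = power_rows_det N (\<Sum>j\<in>{1..N}. a j) (minor_exponent a N) (char_poly x)"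
    by (simp add: prob_space)
  finally show ?thesis using moment_recursion[of N a] by simp
qed

end

section \<open>Bounds for leading minors\<close>

definition sesq_form :: "nat \<Rightarrow> complex mat \<Rightarrow> (nat \<Rightarrow> complex) \<Rightarrow> (nat \<Rightarrow> complex) \<Rightarrow> complex" where
  "sesq_form n Y v w = (\<Sum>i<n. (\<Sum>j<n. Y $$ (i, j) * v j) * cnj (w i))"

definition square_norm :: "nat \<Rightarrow> (nat \<Rightarrow> complex) \<Rightarrow> real" where
  "square_norm n w = (\<Sum>i<n. (norm (w i))\<^sup>2)"

text \<open>Uniform positivity in this form passes to unitary conjugates and to leading blocks, so
  it bounds all minors along an orbit at once. The condition on \<open>Im\<close> stands for
  Hermitian symmetry and makes eigenvalues real.\<close>

definition form_bounds :: "nat \<Rightarrow> complex mat \<Rightarrow> real \<Rightarrow> real \<Rightarrow> bool" where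
  "form_bounds n Y m B \<longleftrightarrow> (\<forall>w. Im (sesq_form n Y w w) = 0 \<and>
     m * square_norm n w \<le> Re (sesq_form n Y w w) \<and> Re (sesq_form n Y w w) \<le> B * square_norm n w)"

lemma form_bounds_leading_block:
  assumes "form_bounds N Y m B" "k \<le> N"
  shows "form_bounds k (leading_block k Y) m B"
  unfolding form_bounds_def
proof
  fix w :: "nat \<Rightarrow> complex"
  define v where "v i = (if i < k then w i else 0)" for i
  have "sesq_form N Y v v = (\<Sum>i<k. (\<Sum>j<N. Y $$ (i, j) * v j) * cnj (v i))"
    unfolding sesq_form_def by (rule sum.mono_neutral_right) (use assms in \<open>auto simp: v_def\<close>)
  also have "\<dots> = (\<Sum>i<k. (\<Sum>j<k. Y $$ (i, j) * v j) * cnj (v i))"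
    by (intro sum.cong refl arg_cong2[where f = "(*)"] sum.mono_neutral_right)
      (use assms in \<open>auto simp: v_def\<close>)
  also have "\<dots> = sesq_form k (leading_block k Y) w w"
    unfolding sesq_form_def by (auto simp: v_def intro!: sum.cong)
  finally have form: "sesq_form k (leading_block k Y) w w = sesq_form N Y v v" ..
  have "square_norm N v = (\<Sum>i<k. (norm (v i))\<^sup>2)"
    unfolding square_norm_def by (rule sum.mono_neutral_right) (use assms in \<open>auto simp: v_def\<close>)
  also have "\<dots> = square_norm k w" by (simp add: square_norm_def v_def)
  finally show "Im (sesq_form k (leading_block k Y) w w) = 0 \<and>
      m * square_norm k w \<le> Re (sesq_form k (leading_block k Y) w w) \<and>
      Re (sesq_form k (leading_block k Y) w w) \<le> B * square_norm k w"
    using assms(1) unfolding form_bounds_def form by metis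
qed

text \<open>Rayleigh quotient at an eigenvector.\<close>

lemma eigenvalue_bounds:
  assumes Y: "Y \<in> carrier_mat k k" and bounds: "form_bounds k Y m B"
    and root: "poly (char_poly Y) e = 0"
  shows "e = of_real (Re e)" "m \<le> Re e" "Re e \<le> B"
proof -
  obtain v where v: "v \<in> carrier_vec k" "v \<noteq> 0\<^sub>v k" "Y *\<^sub>v v = e \<cdot>\<^sub>v v"
    using root Y eigenvalue_root_char_poly[OF Y, of e] unfolding eigenvalue_def eigenvector_def by auto
  define w where "w = ($) v"
  have row: "(\<Sum>j<k. Y $$ (i, j) * w j) = e * w i" if "i < k" for i
  proof -
    have "(\<Sum>j<k. Y $$ (i, j) * w j) = (Y *\<^sub>v v) $ i"
      using that Y v(1) by (auto simp: scalar_prod_def w_def atLeast0LessThan intro!: sum.cong)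
    then show ?thesis using that v(1) unfolding v(3) by (simp add: w_def)
  qed
  have "sesq_form k Y w w = (\<Sum>i<k. e * (w i * cnj (w i)))"
    unfolding sesq_form_def by (intro sum.cong) (auto simp: row)
  also have "\<dots> = e * of_real (square_norm k w)"
    by (simp add: square_norm_def sum_distrib_left complex_norm_square del: of_real_power)
  finally have form: "sesq_form k Y w w = e * of_real (square_norm k w)" .
  obtain i where "i < k" "v $ i \<noteq> 0"
    using v by (metis eq_vecI carrier_vecD index_zero_vec)
  then have "0 < (norm (w i))\<^sup>2" "i < k" by (auto simp: w_def)
  moreover have "(norm (w i))\<^sup>2 \<le> square_norm k w"
    unfolding square_norm_def using \<open>i < k\<close> by (intro member_le_sum) auto
  ultimately have pos: "square_norm k w > 0" by linarith
  have "Im (sesq_form k Y w w) = 0" "m * square_norm k w \<le> Re (sesq_form k Y w w)"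
    "Re (sesq_form k Y w w) \<le> B * square_norm k w"
    using bounds unfolding form_bounds_def by auto
  then have "Im e = 0" "m \<le> Re e" "Re e \<le> B"
    using pos unfolding form by auto
  then show "e = of_real (Re e)" "m \<le> Re e" "Re e \<le> B"
    by (auto simp: complex_eq_iff)
qed

lemma coeff_0_prod_linear:
  "(-1) ^ length es * coeff (\<Prod>e\<leftarrow>es. [:- e, 1:]) 0 = prod_list (es :: complex list)"
  by (induction es) (auto simp: coeff_mult algebra_simps)

text \<open>The determinant is the product of the \<open>k\<close> eigenvalues with multiplicity,
  each of them real and between \<open>m\<close> and \<open>B\<close>.\<close>

lemma det_bounds:
  assumes Y: "Y \<in> carrier_mat k k" and bounds: "form_bounds k Y m B" and m: "0 \<le> m"
  shows "\<exists>d. Determinant.det Y = complex_of_real d \<and> m ^ k \<le> d \<and> d \<le> B ^ k"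
proof -
  obtain es where es: "char_poly Y = (\<Prod>e\<leftarrow>es. [:- e, 1:])" "length es = k"
    using char_poly_factorized[OF Y] by auto
  have "Determinant.det Y = prod_list es"
    using det_eq_coeff_char_poly[OF Y] coeff_0_prod_linear[of es] es by simp
  moreover have "\<forall>e\<in>set es. e = of_real (Re e) \<and> m \<le> Re e \<and> Re e \<le> B"
  proof
    fix e assume e: "e \<in> set es"
    have "poly (char_poly Y) e = 0"
      unfolding es(1) poly_prod_list prod_list_zero_iff using e by force
    then show "e = of_real (Re e) \<and> m \<le> Re e \<and> Re e \<le> B"
      using eigenvalue_bounds[OF Y bounds] by blast
  qed
  then have "\<exists>d. prod_list es = complex_of_real d \<and> m ^ length es \<le> d \<and> d \<le> B ^ length es"
  proof (induction es)
    case (Cons e es)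
    then obtain d where d: "prod_list es = complex_of_real d" "m ^ length es \<le> d" "d \<le> B ^ length es"
      by auto
    have e: "e = of_real (Re e)" "m \<le> Re e" "Re e \<le> B" using Cons.prems by auto
    have "0 \<le> m ^ length es" using m by simp
    moreover from this d(2) have "0 \<le> d" by linarith
    ultimately have "m ^ length (e # es) \<le> Re e * d" "Re e * d \<le> B ^ length (e # es)"
      using d e m by (auto intro!: mult_mono)
    moreover have "prod_list (e # es) = complex_of_real (Re e * d)"
      using d(1) e(1) by simp
    ultimately show ?case by blast
  qed simp
  ultimately show ?thesis using es(2) by simp
qed

lemma sesq_form_conj:
  assumes u: "u \<in> unitary_group N" and x: "x \<in> carrier_mat N N"
  defines "w' w \<equiv> \<lambda>b. \<Sum>j<N. cnj (u $$ (j, b)) * w j"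
  shows "sesq_form N (u * x * mat_adjoint u) w w = sesq_form N x (w' w) (w' w)"
    and "square_norm N (w' w) = square_norm N w"
proof -
  have c: "u \<in> carrier_mat N N" using u by (simp add: unitary_group_def)
  \<comment> \<open>Proved for every matrix, because the claim on \<open>square_norm\<close> is the
    case of the identity matrix.\<close>
  have form: "sesq_form N (u * x * mat_adjoint u) w w = sesq_form N x (w' w) (w' w)"
    if x: "x \<in> carrier_mat N N" for x w
  proof -
    have "sesq_form N (u * x * mat_adjoint u) w w =
        (\<Sum>i<N. (\<Sum>j<N. (\<Sum>b<N. (\<Sum>a<N. u $$ (i, a) * x $$ (a, b)) * cnj (u $$ (j, b))) * w j) * cnj (w i))"
      unfolding sesq_form_def
    proof (intro sum.cong refl arg_cong2[where f = "(*)"])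
      fix i j assume "i \<in> {..<N}" "j \<in> {..<N}"
      then have ij: "i < N" "j < N" by auto
      have "(u * x * mat_adjoint u) $$ (i, j) = (\<Sum>b<N. (\<Sum>a<N. u $$ (i, a) * x $$ (a, b)) * mat_adjoint u $$ (b, j))"
        using c x ij by (intro triple_product_index) auto
      then show "(u * x * mat_adjoint u) $$ (i, j) = (\<Sum>b<N. (\<Sum>a<N. u $$ (i, a) * x $$ (a, b)) * cnj (u $$ (j, b)))"
        using c ij by simp
    qed
    also have "\<dots> = (\<Sum>i<N. \<Sum>j<N. \<Sum>b<N. \<Sum>a<N. x $$ (a, b) * (cnj (u $$ (j, b)) * w j) * (u $$ (i, a) * cnj (w i)))"
      unfolding sum_distrib_right by (intro sum.cong refl) (simp only: mult_ac)
    also have "\<dots> = (\<Sum>i<N. \<Sum>b<N. \<Sum>j<N. \<Sum>a<N. x $$ (a, b) * (cnj (u $$ (j, b)) * w j) * (u $$ (i, a) * cnj (w i)))"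
      by (intro sum.cong refl sum.swap)
    also have "\<dots> = (\<Sum>i<N. \<Sum>b<N. \<Sum>a<N. \<Sum>j<N. x $$ (a, b) * (cnj (u $$ (j, b)) * w j) * (u $$ (i, a) * cnj (w i)))"
      by (intro sum.cong refl sum.swap)
    also have "\<dots> = (\<Sum>i<N. \<Sum>b<N. \<Sum>a<N. x $$ (a, b) * w' w b * (u $$ (i, a) * cnj (w i)))"
      by (simp only: w'_def sum_distrib_left sum_distrib_right)
    also have "\<dots> = (\<Sum>i<N. \<Sum>a<N. \<Sum>b<N. x $$ (a, b) * w' w b * (u $$ (i, a) * cnj (w i)))"
      by (intro sum.cong refl sum.swap)
    also have "\<dots> = (\<Sum>a<N. \<Sum>i<N. \<Sum>b<N. x $$ (a, b) * w' w b * (u $$ (i, a) * cnj (w i)))"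
      by (rule sum.swap)
    also have "\<dots> = (\<Sum>a<N. (\<Sum>b<N. x $$ (a, b) * w' w b) * (\<Sum>i<N. u $$ (i, a) * cnj (w i)))"
      by (intro sum.cong refl) (simp only: sum_product, rule sum.swap)
    also have "\<dots> = sesq_form N x (w' w) (w' w)"
      unfolding sesq_form_def by (simp add: w'_def)
    finally show ?thesis .
  qed
  show "sesq_form N (u * x * mat_adjoint u) w w = sesq_form N x (w' w) (w' w)" by (rule form[OF x])
  have one: "sesq_form N (1\<^sub>m N) v v = of_real (square_norm N v)" for v
  proof -
    have "(\<Sum>j<N. 1\<^sub>m N $$ (i, j) * v j) = v i" if "i < N" for i
    proof -
      have "(\<Sum>j<N. 1\<^sub>m N $$ (i, j) * v j) = (\<Sum>j\<in>{i}. 1\<^sub>m N $$ (i, j) * v j)"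
        by (rule sum.mono_neutral_right) (use that in auto)
      then show ?thesis using that by simp
    qed
    then show ?thesis
      by (simp add: sesq_form_def square_norm_def complex_norm_square del: of_real_power)
  qed
  have "u * 1\<^sub>m N * mat_adjoint u = 1\<^sub>m N"
    using u c by (simp add: unitary_group_def)
  then have "complex_of_real (square_norm N w) = of_real (square_norm N (w' w))"
    using form[of "1\<^sub>m N" w] by (simp add: one)
  then show "square_norm N (w' w) = square_norm N w" by simp
qed

lemma form_bounds_conj:
  assumes "u \<in> unitary_group N" "x \<in> carrier_mat N N" "form_bounds N x m B"
  shows "form_bounds N (u * x * mat_adjoint u) m B"
  unfolding form_bounds_def
proof
  fix w :: "nat \<Rightarrow> complex"
  let ?v = "\<lambda>b. \<Sum>j<N. cnj (u $$ (j, b)) * w j"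
  show "Im (sesq_form N (u * x * mat_adjoint u) w w) = 0 \<and>
      m * square_norm N w \<le> Re (sesq_form N (u * x * mat_adjoint u) w w) \<and>
      Re (sesq_form N (u * x * mat_adjoint u) w w) \<le> B * square_norm N w"
    using assms(3)[unfolded form_bounds_def, rule_format, of ?v]
    unfolding sesq_form_conj[OF assms(1,2), of w] .
qed

lemma leading_minor_bounds:
  assumes u: "u \<in> unitary_group N" and x: "x \<in> carrier_mat N N"
    and bounds: "form_bounds N x m B" and m: "0 \<le> m" and k: "k \<le> N"
  shows "\<exists>d. leading_minor k (u * x * mat_adjoint u) = complex_of_real d \<and> m ^ k \<le> d \<and> d \<le> B ^ k"
  unfolding leading_minor_eq_det
  by (rule det_bounds[OF _ form_bounds_leading_block[OF form_bounds_conj[OF u x bounds] k] m]) simp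

lemma norm_sesq_form_le:
  "norm (sesq_form n Y v v) \<le> (\<Sum>i<n. \<Sum>j<n. norm (Y $$ (i, j))) * square_norm n v"
proof -
  have "norm (sesq_form n Y v v) \<le> (\<Sum>i<n. \<Sum>j<n. norm (Y $$ (i, j) * v j * cnj (v i)))"
    unfolding sesq_form_def sum_distrib_right
    by (intro order.trans[OF norm_sum] sum_mono norm_sum)
  also have "\<dots> \<le> (\<Sum>i<n. \<Sum>j<n. norm (Y $$ (i, j)) * square_norm n v)"
  proof (intro sum_mono)
    fix i j assume "i \<in> {..<n}" "j \<in> {..<n}"
    then have "(norm (v i))\<^sup>2 \<le> square_norm n v" "(norm (v j))\<^sup>2 \<le> square_norm n v"
      unfolding square_norm_def
      by (auto intro: member_le_sum[of _ "{..<n}" "\<lambda>i. (norm (v i))\<^sup>2"])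
    moreover have "2 * (norm (v j) * norm (v i)) \<le> (norm (v i))\<^sup>2 + (norm (v j))\<^sup>2"
      using sum_squares_bound[of "norm (v i)" "norm (v j)"] by (simp add: mult_ac)
    ultimately have "norm (v j) * norm (v i) \<le> square_norm n v" by linarith
    then show "norm (Y $$ (i, j) * v j * cnj (v i)) \<le> norm (Y $$ (i, j)) * square_norm n v"
      by (simp add: norm_mult mult.assoc mult_left_mono)
  qed
  finally show ?thesis by (simp add: sum_distrib_right)
qed

text \<open>Pointwise positivity becomes a uniform lower bound through the inverse \<open>z\<close>
  of \<open>x\<close>, instead of compactness of the sphere: an upper bound for the form of the
  inverse, read off from its entries, is a lower bound for the form of \<open>x\<close>.\<close>

lemma hermitian_pos_def_form_bounds:
  assumes x: "x \<in> hermitian_pos_def N"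
  shows "\<exists>m B. 0 < m \<and> form_bounds N x m B"
proof -
  have c: "x \<in> carrier_mat N N" and adj: "mat_adjoint x = x"
    and pos: "\<And>v. v \<in> carrier_vec N \<Longrightarrow> v \<noteq> 0\<^sub>v N \<Longrightarrow> Re ((x *\<^sub>v v) \<bullet>c v) > 0"
    using x by (auto simp: hermitian_pos_def_def)
  have herm: "cnj (x $$ (i, j)) = x $$ (j, i)" if "i < N" "j < N" for i j
    using that c mat_adjoint_index[of j x i] adj by simp
  have mult_vec: "(A *\<^sub>v vec N w) $ i = (\<Sum>j<N. A $$ (i, j) * w j)"
    if "A \<in> carrier_mat N N" "i < N" for A :: "complex mat" and w i
    using that by (auto simp: scalar_prod_def atLeast0LessThan intro!: sum.cong)
  have form: "(x *\<^sub>v vec N w) \<bullet>c vec N w = sesq_form N x w w" for w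
  proof -
    have "(x *\<^sub>v vec N w) \<bullet>c vec N w = (\<Sum>i<N. (x *\<^sub>v vec N w) $ i * cnj (w i))"
      by (auto simp: scalar_prod_def atLeast0LessThan intro!: sum.cong)
    also have "\<dots> = sesq_form N x w w"
      unfolding sesq_form_def by (intro sum.cong) (auto simp: mult_vec[OF c])
    finally show ?thesis .
  qed
  have nonneg: "0 \<le> Re (sesq_form N x w w)" for w
  proof (cases "vec N w = 0\<^sub>v N")
    case True
    then have "x *\<^sub>v vec N w = 0\<^sub>v N" using c by auto
    then show ?thesis using form[of w] True by simp
  next
    case False
    then show ?thesis using pos[of "vec N w"] form[of w] by simp
  qed
  have sesq_swap: "sesq_form N x v w = cnj (sesq_form N x w v)" for v w
  proof -
    have "sesq_form N x v w = (\<Sum>i<N. \<Sum>j<N. cnj (x $$ (j, i)) * v j * cnj (w i))"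
      unfolding sesq_form_def sum_distrib_right
      by (intro sum.cong refl) (simp add: herm)
    also have "\<dots> = (\<Sum>j<N. \<Sum>i<N. cnj (x $$ (j, i)) * v j * cnj (w i))"
      by (rule sum.swap)
    also have "\<dots> = cnj (sesq_form N x w v)"
      by (simp add: sesq_form_def sum_distrib_right sum_distrib_left mult_ac)
    finally show ?thesis .
  qed
  have real: "Im (sesq_form N x w w) = 0" for w
    using arg_cong[OF sesq_swap[of w w], of Im] by simp
  have "Determinant.det x \<noteq> 0"
  proof
    assume "Determinant.det x = 0"
    then obtain v where v: "v \<in> carrier_vec N" "v \<noteq> 0\<^sub>v N" "x *\<^sub>v v = 0\<^sub>v N"
      using det_0_iff_vec_prod_zero_field[OF c] by auto
    have "(x *\<^sub>v v) \<bullet>c v = 0" unfolding v(3) using v(1) by simp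
    then show False using pos[OF v(1,2)] by simp
  qed
  then obtain z where z: "z \<in> carrier_mat N N" "x * z = 1\<^sub>m N"
    using det_non_zero_imp_unit[OF c, of undefined] unfolding Units_def ring_mat_def by auto
  \<comment> \<open>The sum bounds the form of the inverse; the summand 1 makes \<open>C\<close>
    strictly positive.\<close>
  define C where "C = 1 + (\<Sum>i<N. \<Sum>j<N. norm (z $$ (i, j)))"
  have C: "C > 0" unfolding C_def by (intro add_pos_nonneg sum_nonneg) auto
  have lower: "1 / C * square_norm N w \<le> Re (sesq_form N x w w)" for w
  proof -
    define y where "y i = (\<Sum>j<N. z $$ (i, j) * w j)" for i
    have xy: "(\<Sum>j<N. x $$ (i, j) * y j) = w i" if i: "i < N" for i
    proof -
      have "(\<Sum>j<N. x $$ (i, j) * y j) = (\<Sum>k<N. \<Sum>j<N. x $$ (i, j) * z $$ (j, k) * w k)"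
        unfolding y_def sum_distrib_left by (subst sum.swap) (simp add: mult.assoc)
      also have "\<dots> = (\<Sum>k<N. (x * z) $$ (i, k) * w k)"
        using i by (intro sum.cong refl) (simp add: product_index[OF c z(1)] sum_distrib_right del: index_mult_mat(1))
      also have "\<dots> = (\<Sum>k\<in>{i}. (x * z) $$ (i, k) * w k)"
        unfolding z(2) by (rule sum.mono_neutral_right) (use i in auto)
      also have "\<dots> = w i" using i unfolding z(2) by simp
      finally show ?thesis .
    qed
    have y_left: "sesq_form N x y v = (\<Sum>i<N. w i * cnj (v i))" for v
      unfolding sesq_form_def by (intro sum.cong) (auto simp: xy)
    have yw: "sesq_form N x y w = of_real (square_norm N w)"
      unfolding y_left by (simp add: square_norm_def complex_norm_square del: of_real_power)
    have wy: "sesq_form N x w y = of_real (square_norm N w)"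
      using sesq_swap[of w y] by (simp add: yw)
    have "sesq_form N x y y = cnj (sesq_form N z w w)"
      unfolding y_left by (simp add: sesq_form_def y_def mult.commute)
    then have "Re (sesq_form N x y y) \<le> (C - 1) * square_norm N w"
      using norm_sesq_form_le[of N z w] complex_Re_le_cmod[of "sesq_form N z w w"]
      by (simp add: C_def)
    moreover have "square_norm N w \<ge> 0" by (simp add: square_norm_def sum_nonneg)
    ultimately have yy: "Re (sesq_form N x y y) \<le> C * square_norm N w"
      by (simp add: algebra_simps)
    txt \<open>The form is nonnegative at \<open>x\<^sup>-\<^sup>1 w - C w\<close>.\<close>
    have "sesq_form N x (\<lambda>i. y i - of_real C * w i) (\<lambda>i. y i - of_real C * w i) =
        sesq_form N x y y - of_real C * sesq_form N x y w - of_real C * sesq_form N x w y +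
        (of_real C)\<^sup>2 * sesq_form N x w w"
      by (simp add: sesq_form_def algebra_simps sum_subtractf sum.distrib sum_distrib_left
          sum_distrib_right power2_eq_square)
    then have "0 \<le> Re (sesq_form N x y y) - 2 * C * square_norm N w + C\<^sup>2 * Re (sesq_form N x w w)"
      using nonneg[of "\<lambda>i. y i - of_real C * w i"]
      by (simp add: yw wy flip: of_real_power)
    then have "C * square_norm N w \<le> C\<^sup>2 * Re (sesq_form N x w w)"
      using yy by linarith
    then have "square_norm N w \<le> C * Re (sesq_form N x w w)"
      using C by (simp add: power2_eq_square mult.assoc)
    then show ?thesis using C by (simp add: field_simps)
  qed
  have "form_bounds N x (1 / C) (\<Sum>i<N. \<Sum>j<N. norm (x $$ (i, j)))"
    unfolding form_bounds_def
    using real lower norm_sesq_form_le[of N x] complex_Re_le_cmod order.trans by blast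
  then show ?thesis using C by (metis zero_less_divide_1_iff)
qed

lemma sesq_form_diagonal:
  "sesq_form N (Matrix.mat N N (\<lambda>(i, j). if i = j then of_real (r i) else 0)) w w =
    of_real (\<Sum>i<N. r i * (norm (w i))\<^sup>2)"
proof -
  have "(\<Sum>j<N. Matrix.mat N N (\<lambda>(i, j). if i = j then of_real (r i) else 0) $$ (i, j) * w j) = of_real (r i) * w i"
    if "i < N" for i
  proof -
    have "(\<Sum>j<N. Matrix.mat N N (\<lambda>(i, j). if i = j then of_real (r i) else 0) $$ (i, j) * w j) =
        (\<Sum>j\<in>{i}. Matrix.mat N N (\<lambda>(i, j). if i = j then of_real (r i) else 0) $$ (i, j) * w j)"
      by (rule sum.mono_neutral_right) (use that in auto)
    then show ?thesis using that by simp
  qed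
  then show ?thesis
    by (simp add: sesq_form_def complex_norm_square mult.assoc del: of_real_power)
qed

lemma form_bounds_diagonal:
  assumes "\<And>i. i < N \<Longrightarrow> m \<le> r i \<and> r i \<le> B"
  shows "form_bounds N (Matrix.mat N N (\<lambda>(i, j). if i = j then of_real (r i) else 0)) m B"
  unfolding form_bounds_def sesq_form_diagonal square_norm_def sum_distrib_left
  using assms by (auto intro!: sum_mono mult_right_mono simp flip: of_real_sum of_real_mult of_real_power)

section \<open>Newton series\<close>

text \<open>A rate below 1 lies inside the disc of convergence of the binomial series, so that
  \<open>summable_gchoose\<close> holds at every complex \<open>z\<close>.\<close>

definition geometrically_bounded :: "(nat \<Rightarrow> complex) \<Rightarrow> bool" where
  "geometrically_bounded d \<longleftrightarrow> (\<exists>C r. 0 < r \<and> r < 1 \<and> (\<forall>n. norm (d n) \<le> C * r ^ n))"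

lemma geometrically_bounded_add:
  assumes "geometrically_bounded d" "geometrically_bounded e"
  shows "geometrically_bounded (\<lambda>n. d n + e n)"
proof -
  obtain C r where r: "0 < r" "r < 1" "\<And>n. norm (d n) \<le> C * r ^ n"
    using assms by (auto simp: geometrically_bounded_def)
  obtain D s where s: "0 < s" "s < 1" "\<And>n. norm (e n) \<le> D * s ^ n"
    using assms by (auto simp: geometrically_bounded_def)
  have nonneg: "0 \<le> C" "0 \<le> D"
    using order.trans[OF norm_ge_zero r(3)[of 0]] order.trans[OF norm_ge_zero s(3)[of 0]] by auto
  have "norm (d n + e n) \<le> (C + D) * max r s ^ n" for n
  proof -
    have "norm (d n + e n) \<le> C * r ^ n + D * s ^ n"
      by (intro norm_triangle_mono r s)
    also have "\<dots> \<le> C * max r s ^ n + D * max r s ^ n"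
      using nonneg r s by (intro add_mono mult_left_mono power_mono) auto
    finally show ?thesis by (simp add: distrib_right)
  qed
  then show ?thesis
    unfolding geometrically_bounded_def using r s
    by (intro exI[of _ "C + D"] exI[of _ "max r s"]) auto
qed

lemma geometrically_bounded_cmult:
  assumes "geometrically_bounded d"
  shows "geometrically_bounded (\<lambda>n. c * d n)"
proof -
  obtain C r where r: "0 < r" "r < 1" "\<And>n. norm (d n) \<le> C * r ^ n"
    using assms by (auto simp: geometrically_bounded_def)
  have "norm (c * d n) \<le> (norm c * C) * r ^ n" for n
    using mult_left_mono[OF r(3)[of n], of "norm c"] by (simp add: norm_mult mult.assoc)
  then show ?thesis unfolding geometrically_bounded_def using r by blast
qed

lemma geometrically_bounded_of_nat_mult:
  assumes "geometrically_bounded d"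
  shows "geometrically_bounded (\<lambda>n. of_nat n * d n)"
proof -
  obtain C r where r: "0 < r" "r < 1" "\<And>n. norm (d n) \<le> C * r ^ n"
    using assms by (auto simp: geometrically_bounded_def)
  have C: "0 \<le> C" using order.trans[OF norm_ge_zero r(3)[of 0]] by auto
  \<comment> \<open>Any rate strictly between \<open>r\<close> and 1 absorbs the factor
    \<open>n\<close>; the midpoint is taken.\<close>
  define s where "s = (1 + r) / 2"
  have s: "0 < s" "s < 1" "r / s < 1" using r by (auto simp: s_def field_simps)
  have "(\<lambda>n. of_nat n * (r / s) ^ n) \<longlonglongrightarrow> 0"
    by (rule powser_times_n_limit_0) (use r s in auto)
  then have "Bseq (\<lambda>n. of_nat n * (r / s) ^ n)"
    by (intro convergent_imp_Bseq) (auto simp: convergent_def)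
  then obtain B where B: "\<And>n. \<bar>of_nat n * (r / s) ^ n\<bar> \<le> B"
    by (auto simp: Bseq_def)
  have "norm (of_nat n * d n) \<le> (C * B) * s ^ n" for n
  proof -
    have "norm (of_nat n * d n) \<le> of_nat n * (C * r ^ n)"
      using mult_left_mono[OF r(3)[of n], of "of_nat n"] by (simp add: norm_mult)
    also have "\<dots> = C * (of_nat n * (r / s) ^ n) * s ^ n"
      using s by (simp add: power_divide)
    also have "\<dots> \<le> C * B * s ^ n"
      using C s B[of n] by (intro mult_right_mono mult_left_mono) auto
    finally show ?thesis .
  qed
  then show ?thesis unfolding geometrically_bounded_def using s by blast
qed

lemma geometrically_bounded_shift:
  assumes "geometrically_bounded d"
  shows "geometrically_bounded (\<lambda>n. d (n - 1))"
proof -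
  obtain C r where r: "0 < r" "r < 1" "\<And>n. norm (d n) \<le> C * r ^ n"
    using assms by (auto simp: geometrically_bounded_def)
  have C: "0 \<le> C" using order.trans[OF norm_ge_zero r(3)[of 0]] by auto
  have "norm (d (n - 1)) \<le> (C / r) * r ^ n" for n
  proof (cases n)
    case 0
    have "C \<le> C / r" using C r by (simp add: field_simps mult_left_le)
    then show ?thesis using r(3)[of 0] 0 by simp
  next
    case (Suc k)
    then show ?thesis using r(3)[of k] r(1) by simp
  qed
  then show ?thesis unfolding geometrically_bounded_def using r by blast
qed

lemma summable_norm_gchoose:
  fixes z :: complex
  assumes "0 < r" "r < 1"
  shows "summable (\<lambda>n. norm (z gchoose n) * r ^ n)"
proof -
  have "ereal (norm (complex_of_real r)) < conv_radius (\<lambda>n. z gchoose n)"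
    using assms by (simp add: conv_radius_gchoose)
  then have "summable (\<lambda>n. norm ((z gchoose n) * complex_of_real r ^ n))"
    by (rule abs_summable_in_conv_radius)
  then show ?thesis using assms by (simp add: norm_mult norm_power)
qed

lemma summable_gchoose:
  fixes z :: complex
  assumes "geometrically_bounded d"
  shows "summable (\<lambda>n. d n * (z gchoose n))"
proof -
  obtain C r where r: "0 < r" "r < 1" "\<And>n. norm (d n) \<le> C * r ^ n"
    using assms by (auto simp: geometrically_bounded_def)
  have "summable (\<lambda>n. C * (norm (z gchoose n) * r ^ n))"
    by (intro summable_mult summable_norm_gchoose r)
  then show ?thesis
  proof (rule summable_comparison_test'[where N = 0])
    fix n
    show "norm (d n * (z gchoose n)) \<le> C * (norm (z gchoose n) * r ^ n)"
      using mult_right_mono[OF r(3)[of n], of "norm (z gchoose n)"] by (simp add: norm_mult mult_ac)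
  qed
qed

text \<open>\<open>f z = \<gamma>\<^sup>z \<Sum>\<^sub>n d\<^sub>n (z choose n)\<close> with geometrically decreasing \<open>d\<^sub>n\<close>.  The coefficients are determined
  by the values of \<open>f\<close> at the natural numbers, so that these determine \<open>f\<close>.\<close>

definition newton_series_at :: "real \<Rightarrow> (complex \<Rightarrow> complex) \<Rightarrow> bool" where
  "newton_series_at \<gamma> f \<longleftrightarrow> \<gamma> > 0 \<and> (\<exists>d. geometrically_bounded d \<and>
     (\<forall>z. (\<lambda>n. d n * (z gchoose n)) sums (f z * exp (- z * of_real (ln \<gamma>)))))"

lemma newton_series_at_add:
  assumes "newton_series_at \<gamma> f" "newton_series_at \<gamma> g"
  shows "newton_series_at \<gamma> (\<lambda>z. f z + g z)"
proof -
  obtain d e where d: "geometrically_bounded d"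
      "\<And>z. (\<lambda>n. d n * (z gchoose n)) sums (f z * exp (- z * of_real (ln \<gamma>)))"
    and e: "geometrically_bounded e"
      "\<And>z. (\<lambda>n. e n * (z gchoose n)) sums (g z * exp (- z * of_real (ln \<gamma>)))"
    using assms unfolding newton_series_at_def by blast
  have "(\<lambda>n. (d n + e n) * (z gchoose n)) sums ((f z + g z) * exp (- z * of_real (ln \<gamma>)))" for z
    using sums_add[OF d(2) e(2)] by (simp add: distrib_right)
  then show ?thesis
    using geometrically_bounded_add[OF d(1) e(1)] assms(1) unfolding newton_series_at_def by blast
qed

lemma newton_series_at_cmult:
  assumes "newton_series_at \<gamma> f"
  shows "newton_series_at \<gamma> (\<lambda>z. c * f z)"
proof -
  obtain d where d: "geometrically_bounded d"
      "\<And>z. (\<lambda>n. d n * (z gchoose n)) sums (f z * exp (- z * of_real (ln \<gamma>)))"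
    using assms unfolding newton_series_at_def by blast
  have "(\<lambda>n. (c * d n) * (z gchoose n)) sums (c * f z * exp (- z * of_real (ln \<gamma>)))" for z
    using sums_mult[OF d(2), of c] by (simp add: mult.assoc)
  then show ?thesis
    using geometrically_bounded_cmult[OF d(1), of c] assms unfolding newton_series_at_def by blast
qed

text \<open>Since \<open>z * (z gchoose n) = n * (z gchoose n) + (n + 1) * (z gchoose (n +
  1))\<close>, multiplication by \<open>z\<close> only mixes neighbouring coefficients. It serves
  the polynomial factors in the exponents that stand before the moment.\<close>

lemma newton_series_at_mult_id:
  assumes "newton_series_at \<gamma> f"
  shows "newton_series_at \<gamma> (\<lambda>z. z * f z)"
proof -
  obtain d where d: "geometrically_bounded d"
      "\<And>z. (\<lambda>n. d n * (z gchoose n)) sums (f z * exp (- z * of_real (ln \<gamma>)))"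
    using assms unfolding newton_series_at_def by blast
  define a where "a n = of_nat n * d n" for n
  \<comment> \<open>At \<open>n = 0\<close> the truncated \<open>n - 1\<close> is harmless because
    of the factor \<open>of_nat n\<close>.\<close>
  define c where "c n = of_nat n * d (n - 1)" for n
  have a: "geometrically_bounded a"
    unfolding a_def by (rule geometrically_bounded_of_nat_mult[OF d(1)])
  have c: "geometrically_bounded c"
    unfolding c_def by (intro geometrically_bounded_of_nat_mult geometrically_bounded_shift d(1))
  have "(\<lambda>n. (a n + c n) * (z gchoose n)) sums (z * f z * exp (- z * of_real (ln \<gamma>)))" for z
  proof -
    have a_sum: "(\<lambda>n. a n * (z gchoose n)) sums (\<Sum>n. a n * (z gchoose n))"
      using summable_gchoose[OF a] by (rule summable_sums)
    have "(\<lambda>n. z * (d n * (z gchoose n))) sums (z * (f z * exp (- z * of_real (ln \<gamma>))))"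
      by (intro sums_mult d)
    from sums_diff[OF this a_sum]
    have "(\<lambda>n. c (Suc n) * (z gchoose Suc n)) sums
        (z * (f z * exp (- z * of_real (ln \<gamma>))) - (\<Sum>n. a n * (z gchoose n)))"
    proof (rule back_subst[of "\<lambda>h. h sums _"])
      have "z * (d n * (z gchoose n)) - a n * (z gchoose n) = c (Suc n) * (z gchoose Suc n)" for n
      proof -
        have "z * (d n * (z gchoose n)) = d n * (z * (z gchoose n))" by simp
        then show ?thesis
          unfolding gbinomial_mult_1 by (simp add: a_def c_def algebra_simps)
      qed
      then show "(\<lambda>n. z * (d n * (z gchoose n)) - a n * (z gchoose n)) = (\<lambda>n. c (Suc n) * (z gchoose Suc n))"
        by simp
    qed
    from sums_add[OF a_sum sums_Suc[OF this]]
    show ?thesis by (simp add: c_def distrib_right mult.assoc)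
  qed
  then show ?thesis
    using geometrically_bounded_add[OF a c] assms unfolding newton_series_at_def by blast
qed

lemma powr_of_real_exp: "b > 0 \<Longrightarrow> complex_of_real b powr z = exp (z * of_real (ln b))"
  by (simp add: powr_def Ln_of_real)

text \<open>Write \<open>D = \<gamma> * (1 + q)\<close>. As
  \<open>0 < m \<le> D \<le> B < 2 * \<gamma>\<close>, the values of \<open>q\<close> stay at a
  distance from -1 and 1, and the binomial series of \<open>(1 + q) powr z\<close> can be integrated
  term by term. Its coefficients are the integrals of \<open>g * q ^ n\<close>.\<close>

lemma newton_series_at_integral:
  fixes D :: "'a \<Rightarrow> real"
  assumes M: "finite_measure M" and g: "bounded_measurable M g"
    and D: "bounded_measurable M (\<lambda>u. complex_of_real (D u))"
    and m: "0 < m" and bounds: "\<And>u. u \<in> space M \<Longrightarrow> m \<le> D u \<and> D u \<le> B" and \<gamma>: "0 < \<gamma>" "B < 2 * \<gamma>"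
  shows "newton_series_at \<gamma> (\<lambda>z. LINT u|M. g u * complex_of_real (D u) powr z)"
proof -
  interpret finite_measure M by (rule M)
  define q where "q u = D u / \<gamma> - 1" for u
  \<comment> \<open>The entry \<open>1 / 2\<close> keeps \<open>r\<close> positive; the other two
    bound \<open>- q\<close> and \<open>q\<close>.\<close>
  define r where "r = max (1 / 2) (max (1 - m / \<gamma>) (B / \<gamma> - 1))"
  have r: "0 < r" "r < 1" using \<gamma> m by (auto simp: r_def field_simps)
  have q: "\<bar>q u\<bar> \<le> r" if "u \<in> space M" for u
  proof -
    have "D u / \<gamma> \<le> B / \<gamma>" "m / \<gamma> \<le> D u / \<gamma>"
      using bounds[OF that] \<gamma> by (auto intro: divide_right_mono)
    then show ?thesis by (auto simp: q_def r_def)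
  qed
  have bq: "bounded_measurable M (\<lambda>u. complex_of_real (q u))"
  proof -
    have "bounded_measurable M (\<lambda>u. complex_of_real (1 / \<gamma>) * complex_of_real (D u) + (- 1))"
      by (intro bounded_measurable_add bounded_measurable_mult bounded_measurable_const D)
    then show ?thesis by (simp add: q_def)
  qed
  obtain G where G: "\<And>u. u \<in> space M \<Longrightarrow> norm (g u) \<le> G"
    using g by (auto simp: bounded_measurable_def)
  define G' where "G' = max G 0"
  have G': "0 \<le> G'" "\<And>u. u \<in> space M \<Longrightarrow> norm (g u) \<le> G'"
    using G by (force simp: G'_def)+
  define d where "d n = (LINT u|M. g u * complex_of_real (q u) ^ n)" for n
  have int: "integrable M (\<lambda>u. g u * complex_of_real (q u) ^ n)" for n
    by (intro integrable_bounded_measurable bounded_measurable_mult bounded_measurable_power g bq)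
  have le: "norm (g u * complex_of_real (q u) ^ n) \<le> G' * r ^ n" if "u \<in> space M" for u n
    unfolding norm_mult norm_power
    using G' q[OF that] that by (intro mult_mono power_mono) auto
  have int_le: "(LINT u|M. norm (g u * complex_of_real (q u) ^ n)) \<le> (measure M (space M) * G') * r ^ n" for n
  proof -
    have "(LINT u|M. norm (g u * complex_of_real (q u) ^ n)) \<le> (LINT u|M. G' * r ^ n)"
      by (intro integral_mono integrable_norm int le) auto
    then show ?thesis by (simp add: mult.assoc)
  qed
  have "norm (d n) \<le> (measure M (space M) * G') * r ^ n" for n
    unfolding d_def by (rule order.trans[OF integral_norm_bound int_le])
  then have geo: "geometrically_bounded d"
    unfolding geometrically_bounded_def using r by blast
  have "(\<lambda>n. d n * (z gchoose n)) sums
      ((LINT u|M. g u * complex_of_real (D u) powr z) * exp (- z * of_real (ln \<gamma>)))" for z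
  proof -
    define f where "f n u = g u * complex_of_real (q u) ^ n * (z gchoose n)" for n u
    have f_le: "norm (f n u) \<le> G' * (norm (z gchoose n) * r ^ n)" if "u \<in> space M" for n u
    proof -
      have "norm (f n u) = norm (g u * complex_of_real (q u) ^ n) * norm (z gchoose n)"
        by (simp only: f_def norm_mult)
      also have "\<dots> \<le> G' * r ^ n * norm (z gchoose n)"
        by (intro mult_right_mono le that) auto
      finally show ?thesis by (simp add: mult_ac)
    qed
    have sum_f: "summable (\<lambda>n. G' * (norm (z gchoose n) * r ^ n))"
      by (intro summable_mult summable_norm_gchoose r)
    have "(\<lambda>n. LINT u|M. f n u) sums (LINT u|M. (\<Sum>n. f n u))"
    proof (rule sums_integral)
      show "integrable M (f n)" for n
        unfolding f_def by (intro integrable_mult_left int)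
      show "AE u in M. summable (\<lambda>n. norm (f n u))"
        using f_le by (intro AE_I2 summable_comparison_test'[OF sum_f]) auto
      have "summable (\<lambda>n. measure M (space M) * (G' * (norm (z gchoose n) * r ^ n)))"
        by (intro summable_mult sum_f)
      then show "summable (\<lambda>n. LINT u|M. norm (f n u))"
      proof (rule summable_comparison_test'[where N = 0])
        fix n
        have "(LINT u|M. norm (f n u)) \<le> (LINT u|M. G' * (norm (z gchoose n) * r ^ n))"
          unfolding f_def
          by (intro integral_mono integrable_norm integrable_mult_left int f_le[unfolded f_def]) auto
        then show "norm (LINT u|M. norm (f n u)) \<le> measure M (space M) * (G' * (norm (z gchoose n) * r ^ n))"
          by simp
      qed
    qed
    moreover have "(\<lambda>n. LINT u|M. f n u) = (\<lambda>n. d n * (z gchoose n))"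
      by (simp add: f_def d_def fun_eq_iff)
    moreover have "(LINT u|M. (\<Sum>n. f n u)) =
        (LINT u|M. g u * complex_of_real (D u) powr z * exp (- z * of_real (ln \<gamma>)))"
    proof (intro Bochner_Integration.integral_cong refl)
      fix u assume u: "u \<in> space M"
      have "norm (complex_of_real (q u)) < 1" using q[OF u] r by simp
      from sums_mult[OF gen_binomial_complex[OF this, of z], of "g u"]
      have "(\<Sum>n. f n u) = g u * (1 + complex_of_real (q u)) powr z"
        by (simp add: f_def sums_iff mult_ac)
      moreover have "1 + complex_of_real (q u) = complex_of_real (D u / \<gamma>)"
        by (simp add: q_def)
      moreover have "D u > 0" using bounds[OF u] m by linarith
      then have "complex_of_real (D u / \<gamma>) powr z = complex_of_real (D u) powr z * exp (- z * of_real (ln \<gamma>))"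
        using \<gamma> by (simp only: powr_of_real_exp divide_pos_pos ln_div)
          (simp add: exp_add[symmetric] algebra_simps)
      ultimately show "(\<Sum>n. f n u) = g u * complex_of_real (D u) powr z * exp (- z * of_real (ln \<gamma>))"
        by simp
    qed
    ultimately show ?thesis by simp
  qed
  then show ?thesis using geo \<gamma> unfolding newton_series_at_def by blast
qed

text \<open>A single power is an integral over a one-point space.\<close>

lemma newton_series_at_powr:
  assumes b: "0 < b" "b < 2 * \<gamma>"
  shows "newton_series_at \<gamma> (\<lambda>z. complex_of_real b powr z)"
proof -
  define M where "M = return (count_space UNIV) ()"
  have M: "prob_space M" by (simp add: M_def prob_space_return)
  have meas: "bounded_measurable M (\<lambda>u. c)" for c by (rule bounded_measurable_const)
  have "newton_series_at \<gamma> (\<lambda>z. LINT u|M. 1 * complex_of_real b powr z)"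
    using b prob_space.finite_measure[OF M] meas
    by (intro newton_series_at_integral[where m = b and B = b]) auto
  then show ?thesis using prob_space.prob_space[OF M] by simp
qed

text \<open>At \<open>z = k\<close> the terms with \<open>n > k\<close> vanish, so the values at
  natural numbers depend on the coefficients through a triangular system.\<close>

lemma newton_series_at_unique:
  assumes f: "newton_series_at \<gamma> f" and zero: "\<And>k. f (of_nat k) = 0"
  shows "f z = 0"
proof -
  obtain d where d: "\<And>z. (\<lambda>n. d n * (z gchoose n)) sums (f z * exp (- z * of_real (ln \<gamma>)))"
    using f unfolding newton_series_at_def by blast
  have "d k = 0" for k
  proof (induction k rule: less_induct)
    case (less k)
    have "(\<lambda>n. d n * (of_nat k gchoose n)) sums (\<Sum>n\<in>{k}. d n * (of_nat k gchoose n))"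
    proof (rule sums_finite)
      fix n assume "n \<notin> {k}"
      then consider "n < k" | "k < n" by force
      then show "d n * (of_nat k gchoose n) = 0"
        by cases (use less in \<open>auto simp flip: binomial_gbinomial\<close>)
    qed simp
    moreover have "(\<lambda>n. d n * (of_nat k gchoose n)) sums 0"
      using d[of "of_nat k"] zero[of k] by simp
    ultimately have "(\<Sum>n\<in>{k}. d n * (of_nat k gchoose n)) = 0" by (rule sums_unique2)
    then show ?case by (simp flip: binomial_gbinomial)
  qed
  then have "f z * exp (- z * of_real (ln \<gamma>)) = 0"
    using d[of z] sums_unique2[OF sums_zero, of "f z * exp (- z * of_real (ln \<gamma>))"] by simp
  then show ?thesis by simp
qed

text \<open>Each function has its own range of admissible \<gamma>; asking for all large ones
  provides a common \<gamma> for sums.\<close>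

definition newton_class :: "(complex \<Rightarrow> complex) \<Rightarrow> bool" where
  "newton_class f \<longleftrightarrow> (\<forall>\<^sub>F \<gamma> in at_top. newton_series_at \<gamma> f)"

lemma newton_class_add: "newton_class f \<Longrightarrow> newton_class g \<Longrightarrow> newton_class (\<lambda>z. f z + g z)"
  unfolding newton_class_def by (erule (1) eventually_elim2) (rule newton_series_at_add)

lemma newton_class_cmult: "newton_class f \<Longrightarrow> newton_class (\<lambda>z. c * f z)"
  unfolding newton_class_def by (elim eventually_mono) (rule newton_series_at_cmult)

lemma newton_class_mult_id: "newton_class f \<Longrightarrow> newton_class (\<lambda>z. z * f z)"
  unfolding newton_class_def by (elim eventually_mono) (rule newton_series_at_mult_id)

lemma newton_class_diff: "newton_class f \<Longrightarrow> newton_class g \<Longrightarrow> newton_class (\<lambda>z. f z - g z)"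
  using newton_class_add[OF _ newton_class_cmult[of g "- 1"], of f] by simp

lemma newton_class_unique:
  assumes "newton_class f" "\<And>k. f (of_nat k) = 0"
  shows "f z = 0"
proof -
  have "\<exists>\<gamma>. newton_series_at \<gamma> f"
    using assms(1) unfolding newton_class_def
    by (intro eventually_happens'[OF trivial_limit_at_top_linorder])
  then obtain \<gamma> where "newton_series_at \<gamma> f" ..
  then show ?thesis by (rule newton_series_at_unique) (rule assms(2))
qed

lemma newton_class_powr:
  assumes "0 < b"
  shows "newton_class (\<lambda>z. complex_of_real b powr z)"
  unfolding newton_class_def
  using eventually_gt_at_top[of b]
  by eventually_elim (rule newton_series_at_powr, use assms in auto)

lemma newton_class_sum:
  assumes "finite I" "\<And>i. i \<in> I \<Longrightarrow> newton_class (f i)"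
  shows "newton_class (\<lambda>z. \<Sum>i\<in>I. f i z)"
  using assms
proof (induction I)
  case empty
  then show ?case using newton_class_cmult[OF newton_class_powr[of 1], of 0] by simp
qed (simp add: newton_class_add)

text \<open>Polynomial factors act as operators on the class, so that two Newton series never have
  to be multiplied.\<close>

definition newton_multiplier :: "(complex \<Rightarrow> complex) \<Rightarrow> bool" where
  "newton_multiplier g \<longleftrightarrow> (\<forall>f. newton_class f \<longrightarrow> newton_class (\<lambda>z. g z * f z))"

lemma newton_multiplier_affine: "newton_multiplier (\<lambda>z. \<alpha> + \<beta> * z)"
  unfolding newton_multiplier_def
proof (intro allI impI)
  fix f assume f: "newton_class f"
  have "newton_class (\<lambda>z. \<alpha> * f z + \<beta> * (z * f z))"
    by (intro newton_class_add newton_class_cmult newton_class_mult_id f)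
  then show "newton_class (\<lambda>z. (\<alpha> + \<beta> * z) * f z)" by (simp add: distrib_right mult.assoc)
qed

lemma newton_multiplier_prod:
  "(\<And>i. i \<in> I \<Longrightarrow> newton_multiplier (g i)) \<Longrightarrow> newton_multiplier (\<lambda>z. \<Prod>i\<in>I. g i z)"
proof (induction I rule: infinite_finite_induct)
  case (insert i I)
  then show ?case unfolding newton_multiplier_def by (simp add: mult.assoc)
qed (simp_all add: newton_multiplier_def)

text \<open>The terms of the Leibniz expansion of the determinant have this form in each variable.
  They are multiplied among themselves first, and only their sums are formed in
  \<open>newton_class\<close>.\<close>

definition exponential_monomial :: "(complex \<Rightarrow> complex) \<Rightarrow> bool" where
  "exponential_monomial g \<longleftrightarrow> (\<exists>c b. 0 < b \<and> g = (\<lambda>z. c * complex_of_real b powr z))"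

lemma exponential_monomial_mult:
  assumes "exponential_monomial f" "exponential_monomial g"
  shows "exponential_monomial (\<lambda>z. f z * g z)"
proof -
  obtain c b d e where f: "0 < b" "f = (\<lambda>z. c * complex_of_real b powr z)"
    and g: "0 < e" "g = (\<lambda>z. d * complex_of_real e powr z)"
    using assms unfolding exponential_monomial_def by blast
  have "f z * g z = c * d * complex_of_real (b * e) powr z" for z
  proof -
    have "complex_of_real (b * e) powr z = complex_of_real b powr z * complex_of_real e powr z"
      using f(1) g(1) by (simp only: powr_of_real_exp mult_pos_pos ln_mult)
        (simp add: exp_add[symmetric] distrib_left)
    then show ?thesis by (simp add: f g)
  qed
  then show ?thesis
    unfolding exponential_monomial_def using f(1) g(1) by (intro exI[of _ "c * d"] exI[of _ "b * e"]) auto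
qed

lemma exponential_monomial_prod:
  "(\<And>i. i \<in> I \<Longrightarrow> exponential_monomial (g i)) \<Longrightarrow> exponential_monomial (\<lambda>z. \<Prod>i\<in>I. g i z)"
proof (induction I rule: infinite_finite_induct)
  case (insert i I)
  then show ?case by (simp add: exponential_monomial_mult)
qed (auto simp: exponential_monomial_def intro!: exI[of _ "1 :: complex"] exI[of _ "1 :: real"])

lemma exponential_monomial_newton_class: "exponential_monomial g \<Longrightarrow> newton_class g"
  unfolding exponential_monomial_def by (auto intro: newton_class_cmult newton_class_powr)

text \<open>The slope is 0 or 1 because a variable occurs at most once in an exponent sum; slope 0
  corresponds to the base 1.\<close>

lemma exponential_monomial_powr_affine:
  assumes "0 < b" "\<beta> = 0 \<or> \<beta> = 1"
  shows "exponential_monomial (\<lambda>z. complex_of_real b powr (\<alpha> + \<beta> * z))"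
proof -
  have "complex_of_real b powr (\<alpha> + \<beta> * z) =
      complex_of_real b powr \<alpha> * complex_of_real (if \<beta> = 0 then 1 else b) powr z" for z
    using assms by (auto simp: powr_add)
  then show ?thesis
    unfolding exponential_monomial_def using assms(1)
    by (intro exI[of _ "complex_of_real b powr \<alpha>"] exI[of _ "if \<beta> = 0 then 1 else b"]) auto
qed

text \<open>Several complex variables are treated one at a time, the others being fixed at
  arbitrary complex or at natural values.\<close>

lemma newton_vanish:
  fixes F :: "(nat \<Rightarrow> complex) \<Rightarrow> complex"
  assumes newton: "\<And>j a. j \<in> I \<Longrightarrow> newton_class (\<lambda>z. F (a(j := z)))"
    and zero: "\<And>b. F (\<lambda>j. of_nat (b j)) = 0"
    and J: "finite J" "J \<subseteq> I" "\<And>j. j \<notin> J \<Longrightarrow> a j \<in> \<nat>"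
  shows "F a = 0"
  using J
\<comment> \<open>\<open>J\<close> contains the variables whose values may be non-natural. One of
  them is varied: at its natural values the induction hypothesis applies, and uniqueness extends the
  vanishing to all others.\<close>
proof (induction J arbitrary: a)
  case empty
  then have "\<forall>j. \<exists>k. a j = of_nat k" by (auto elim: Nats_cases)
  then obtain b where "a = (\<lambda>j. of_nat (b j))" by metis
  then show ?case using zero by simp
next
  case (insert j J)
  have "F (a(j := z)) = 0" for z
  proof (rule newton_class_unique[of "\<lambda>z. F (a(j := z))"])
    show "newton_class (\<lambda>z. F (a(j := z)))" using insert.prems by (intro newton) auto
    show "F (a(j := of_nat k)) = 0" for k
      using insert.prems by (intro insert.IH) auto
  qed
  from this[of "a j"] show ?case by simp
qed

text \<open>The explicit bound depends on \<open>z\<close> only through the absolute value of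
  \<open>Re z\<close>, which later yields one majorant for a convergent sequence of
  exponents.\<close>

lemma bounded_measurable_powr:
  fixes D :: "'a \<Rightarrow> real"
  assumes D: "bounded_measurable M (\<lambda>u. complex_of_real (D u))"
    and m: "0 < m" and bounds: "\<And>u. u \<in> space M \<Longrightarrow> m \<le> D u \<and> D u \<le> B"
  shows "bounded_measurable M (\<lambda>u. complex_of_real (D u) powr z)"
    and "u \<in> space M \<Longrightarrow> norm (complex_of_real (D u) powr z) \<le> exp (\<bar>Re z\<bar> * max \<bar>ln m\<bar> \<bar>ln B\<bar>)"
proof -
  have le: "norm (complex_of_real (D u) powr z) \<le> exp (\<bar>Re z\<bar> * max \<bar>ln m\<bar> \<bar>ln B\<bar>)" if "u \<in> space M" for u
  proof -
    have D: "0 < D u" "m \<le> D u" "D u \<le> B" using bounds[OF that] m by auto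
    then have "ln m \<le> ln (D u)" "ln (D u) \<le> ln B" using m by auto
    then have "\<bar>ln (D u)\<bar> \<le> max \<bar>ln m\<bar> \<bar>ln B\<bar>" by linarith
    then have "\<bar>Re z\<bar> * \<bar>ln (D u)\<bar> \<le> \<bar>Re z\<bar> * max \<bar>ln m\<bar> \<bar>ln B\<bar>"
      by (rule mult_left_mono) simp
    moreover have "Re z * ln (D u) \<le> \<bar>Re z\<bar> * \<bar>ln (D u)\<bar>"
      by (metis abs_ge_self abs_mult)
    ultimately show ?thesis
      using D(1) by (simp add: powr_of_real_exp)
  qed
  have [measurable]: "D \<in> borel_measurable M"
    using D by (simp add: bounded_measurable_def borel_measurable_complex_iff)
  have "(\<lambda>u. exp (z * complex_of_real (ln (D u)))) \<in> borel_measurable M"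
    by measurable
  then have "(\<lambda>u. complex_of_real (D u) powr z) \<in> borel_measurable M"
  proof (rule measurable_cong[THEN iffD1, rotated])
    fix u assume "u \<in> space M"
    then have "0 < D u" using bounds m by force
    then show "exp (z * complex_of_real (ln (D u))) = complex_of_real (D u) powr z"
      by (simp add: powr_of_real_exp)
  qed
  then show "bounded_measurable M (\<lambda>u. complex_of_real (D u) powr z)"
    using le unfolding bounded_measurable_def by blast
  show "norm (complex_of_real (D u) powr z) \<le> exp (\<bar>Re z\<bar> * max \<bar>ln m\<bar> \<bar>ln B\<bar>)" if "u \<in> space M"
    by (rule le[OF that])
qed

section \<open>The determinant formula\<close>

definition exponent_sum :: "(nat \<Rightarrow> complex) \<Rightarrow> nat \<Rightarrow> nat \<Rightarrow> complex" where
  "exponent_sum a k i = of_nat i + (\<Sum>j\<in>{k - i..k}. a j)"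

lemma exponent_sum_of_nat: "exponent_sum (\<lambda>j. of_nat (b j)) k i = of_nat (minor_exponent b k i)"
  by (simp add: exponent_sum_def minor_exponent_def)

lemma exponent_sum_update:
  "\<exists>\<alpha> \<beta>. (\<beta> = 0 \<or> \<beta> = 1) \<and> (\<forall>z. exponent_sum (a(j := z)) k i = \<alpha> + \<beta> * z)"
proof (cases "j \<in> {k - i..k}")
  case True
  have "(\<Sum>m\<in>{k - i..k}. (a(j := z)) m) = z + (\<Sum>m\<in>{k - i..k} - {j}. (a(j := z)) m)" for z
    using True by (subst sum.remove[of _ j]) auto
  moreover have "(\<Sum>m\<in>{k - i..k} - {j}. (a(j := z)) m) = (\<Sum>m\<in>{k - i..k} - {j}. a m)" for z
    by (rule sum.cong) auto
  ultimately have "exponent_sum (a(j := z)) k i = (of_nat i + (\<Sum>m\<in>{k - i..k} - {j}. a m)) + 1 * z" for z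
    by (simp only: exponent_sum_def) simp
  then show ?thesis by blast
next
  case False
  have "(\<Sum>m\<in>{k - i..k}. (a(j := z)) m) = (\<Sum>m\<in>{k - i..k}. a m)" for z
    by (rule sum.cong) (use False in auto)
  then have "exponent_sum (a(j := z)) k i = (of_nat i + (\<Sum>m\<in>{k - i..k}. a m)) + 0 * z" for z
    by (simp add: exponent_sum_def)
  then show ?thesis by blast
qed

section \<open>Moments of the minors with complex exponents\<close>

locale positive_haar_orbit = haar_orbit +
  fixes m B :: real
  assumes m: "0 < m" and bounds: "form_bounds N x m B"
begin

definition minor :: "nat \<Rightarrow> complex mat \<Rightarrow> real" where
  "minor k u = Re (leading_minor k (orbit u))"

lemma minor:
  assumes "k \<le> N" "u \<in> space \<mu>"
  shows "leading_minor k (orbit u) = complex_of_real (minor k u)"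
    and "m ^ k \<le> minor k u" "minor k u \<le> B ^ k"
proof -
  have u: "u \<in> unitary_group N" using assms(2) by (simp add: space_haar)
  obtain d where "leading_minor k (orbit u) = complex_of_real d" "m ^ k \<le> d" "d \<le> B ^ k"
    using leading_minor_bounds[OF u x bounds _ assms(1)] m unfolding orbit_def by auto
  then show "leading_minor k (orbit u) = complex_of_real (minor k u)"
    "m ^ k \<le> minor k u" "minor k u \<le> B ^ k"
    by (simp_all add: minor_def)
qed

lemma minor_positive: "k \<le> N \<Longrightarrow> u \<in> space \<mu> \<Longrightarrow> 0 < minor k u"
  using minor(2)[of k u] zero_less_power[OF m, of k] by linarith

lemma bounded_measurable_minor:
  assumes "k \<le> N"
  shows "bounded_measurable \<mu> (\<lambda>u. complex_of_real (minor k u))"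
  using bounded_measurable_leading_minor[OF assms]
  by (rule bounded_measurable_eq) (simp add: minor(1)[OF assms])

lemma bounded_measurable_minor_powr:
  assumes "k \<le> N"
  shows "bounded_measurable \<mu> (\<lambda>u. complex_of_real (minor k u) powr z)"
  using assms minor[OF assms] m
  by (intro bounded_measurable_powr(1)[where m = "m ^ k" and B = "B ^ k"] bounded_measurable_minor) auto

definition mixed_moment :: "(nat \<Rightarrow> complex) \<Rightarrow> complex" where
  "mixed_moment a = (LINT u|\<mu>. (\<Prod>j\<in>{1..N}. complex_of_real (minor j u) powr a j))"

lemma mixed_moment_of_nat:
  "mixed_moment (\<lambda>j. of_nat (b j)) = (LINT u|\<mu>. (\<Prod>j\<in>{1..N}. leading_minor j (orbit u) ^ b j))"
  unfolding mixed_moment_def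
proof (intro Bochner_Integration.integral_cong refl prod.cong)
  fix u j assume "u \<in> space \<mu>" "j \<in> {1..N}"
  then show "complex_of_real (minor j u) powr of_nat (b j) = leading_minor j (orbit u) ^ b j"
    using minor(1)[of j u] minor_positive[of j u] by (simp add: powr_nat')
qed

text \<open>The powers of the other minors form a bounded weight, and every positive \<gamma> above
  \<open>B ^ j\<close> is admissible in \<open>newton_series_at_integral\<close>.\<close>

lemma newton_class_mixed_moment:
  assumes j: "j \<in> {1..N}"
  shows "newton_class (\<lambda>z. mixed_moment (a(j := z)))"
proof -
  let ?g = "\<lambda>u. \<Prod>i\<in>{1..N} - {j}. complex_of_real (minor i u) powr a i"
  have "mixed_moment (a(j := z)) = (LINT u|\<mu>. ?g u * complex_of_real (minor j u) powr z)" for z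
  proof -
    have "(\<Prod>i\<in>{1..N}. complex_of_real (minor i u) powr (a(j := z)) i) =
        ?g u * complex_of_real (minor j u) powr z" for u
    proof -
      have "(\<Prod>i\<in>{1..N}. complex_of_real (minor i u) powr (a(j := z)) i) =
          complex_of_real (minor j u) powr (a(j := z)) j *
          (\<Prod>i\<in>{1..N} - {j}. complex_of_real (minor i u) powr (a(j := z)) i)"
        using j by (intro prod.remove) auto
      also have "(\<Prod>i\<in>{1..N} - {j}. complex_of_real (minor i u) powr (a(j := z)) i) = ?g u"
        by (rule prod.cong) auto
      finally show ?thesis by simp
    qed
    then show ?thesis by (simp add: mixed_moment_def)
  qed
  moreover have "newton_class (\<lambda>z. LINT u|\<mu>. ?g u * complex_of_real (minor j u) powr z)"
    unfolding newton_class_def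
    using eventually_gt_at_top[of "max 0 (B ^ j)"]
  proof eventually_elim
    case (elim \<gamma>)
    show ?case
    proof (rule newton_series_at_integral)
      show "finite_measure \<mu>" by (rule finite_measure_axioms)
      show "bounded_measurable \<mu> ?g"
        by (intro bounded_measurable_prod bounded_measurable_minor_powr) auto
      show "bounded_measurable \<mu> (\<lambda>u. complex_of_real (minor j u))"
        using j by (intro bounded_measurable_minor) auto
      show "0 < m ^ j" using m by simp
      show "m ^ j \<le> minor j u \<and> minor j u \<le> B ^ j" if "u \<in> space \<mu>" for u
        using minor[of j u] that j by auto
    qed (use elim in auto)
  qed
  ultimately show ?thesis by simp
qed

text \<open>With all denominators cleared, the difference \<open>F\<close> of the two sides belongs
  to \<open>newton_class\<close> in each variable. At natural exponents it vanishes by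
  \<open>integer_moments\<close> and \<open>power_rows_det_vandermonde\<close>. When two values of
  \<rho> coincide, both sides are 0.\<close>

lemma mixed_moment_formula:
  assumes \<rho>: "\<And>i. i < N \<Longrightarrow> 0 < \<rho> i"
    and cp: "char_poly x = (\<Prod>i<N. [:- complex_of_real (\<rho> i), 1:])"
    and outside: "\<And>j. j \<notin> {1..N} \<Longrightarrow> a j = 0"
  shows "(\<Prod>K<N. \<Prod>i<K. 1 + exponent_sum a K i) *
      ((\<Prod>j<N. \<Prod>i<j. complex_of_real (\<rho> j) - of_real (\<rho> i)) * mixed_moment a) =
    (\<Prod>K<N. fact K) *
      Determinant.det (Matrix.mat N N (\<lambda>(i, j). complex_of_real (\<rho> j) powr exponent_sum a N i))"
proof -
  let ?V = "\<Prod>j<N. \<Prod>i<j. complex_of_real (\<rho> j) - of_real (\<rho> i)"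
  define F where "F a = (\<Prod>K<N. \<Prod>i<K. 1 + exponent_sum a K i) * (?V * mixed_moment a) -
    (\<Prod>K<N. fact K) *
      Determinant.det (Matrix.mat N N (\<lambda>(i, j). complex_of_real (\<rho> j) powr exponent_sum a N i))" for a
  have "F a = 0"
  proof (rule newton_vanish[of "{1..N}" F "{1..N}"])
    fix j a assume j: "j \<in> {1..N}"
    have "newton_multiplier (\<lambda>z. 1 + exponent_sum (a(j := z)) K i)" for K i
    proof -
      obtain \<alpha> \<beta> where "\<And>z. exponent_sum (a(j := z)) K i = \<alpha> + \<beta> * z"
        using exponent_sum_update by metis
      then show ?thesis
        using newton_multiplier_affine[of "1 + \<alpha>" \<beta>] by (simp add: add.assoc)
    qed
    then have "newton_multiplier (\<lambda>z. \<Prod>K<N. \<Prod>i<K. 1 + exponent_sum (a(j := z)) K i)"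
      by (intro newton_multiplier_prod)
    moreover have "newton_class (\<lambda>z. ?V * mixed_moment (a(j := z)))"
      by (intro newton_class_cmult newton_class_mixed_moment j)
    ultimately have lhs: "newton_class (\<lambda>z. (\<Prod>K<N. \<Prod>i<K. 1 + exponent_sum (a(j := z)) K i) *
        (?V * mixed_moment (a(j := z))))"
      unfolding newton_multiplier_def by blast
    have "newton_class (\<lambda>z. \<Sum>p\<in>{p. p permutes {0..<N}}. signof p *
        (\<Prod>i = 0..<N. complex_of_real (\<rho> (p i)) powr exponent_sum (a(j := z)) N i))"
    proof (intro newton_class_sum newton_class_cmult exponential_monomial_newton_class exponential_monomial_prod)
      show "finite {p. p permutes {0..<N}}" by (rule finite_permutations) simp
      fix p i assume "p \<in> {p. p permutes {0..<N}}" "i \<in> {0..<N}"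
      then have "p i < N" using permutes_in_image[of p "{0..<N}" i] by auto
      then show "exponential_monomial (\<lambda>z. complex_of_real (\<rho> (p i)) powr exponent_sum (a(j := z)) N i)"
      proof -
        obtain \<alpha> \<beta> where ab: "\<beta> = 0 \<or> \<beta> = 1" "\<And>z. exponent_sum (a(j := z)) N i = \<alpha> + \<beta> * z"
          using exponent_sum_update by metis
        have "exponential_monomial (\<lambda>z. complex_of_real (\<rho> (p i)) powr (\<alpha> + \<beta> * z))"
          by (rule exponential_monomial_powr_affine[OF \<rho>[OF \<open>p i < N\<close>] ab(1)])
        then show ?thesis by (simp only: ab(2))
      qed
    qed
    moreover have "Determinant.det (Matrix.mat N N (\<lambda>(i, l). complex_of_real (\<rho> l) powr exponent_sum (a(j := z)) N i)) =
        (\<Sum>p\<in>{p. p permutes {0..<N}}. signof p *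
          (\<Prod>i = 0..<N. complex_of_real (\<rho> (p i)) powr exponent_sum (a(j := z)) N i))" for z
    proof (subst det_def'[where n = N], simp, intro sum.cong refl arg_cong2[where f = "(*)"] prod.cong)
      fix p i assume "p \<in> {p. p permutes {0..<N}}" "i \<in> {0..<N}"
      then have "i < N" "p i < N" using permutes_in_image[of p "{0..<N}" i] by auto
      then show "Matrix.mat N N (\<lambda>(i, l). complex_of_real (\<rho> l) powr exponent_sum (a(j := z)) N i) $$ (i, p i) =
          complex_of_real (\<rho> (p i)) powr exponent_sum (a(j := z)) N i"
        by simp
    qed
    ultimately show "newton_class (\<lambda>z. F (a(j := z)))"
      unfolding F_def by (intro newton_class_diff[OF lhs] newton_class_cmult) simp
  next
    fix b :: "nat \<Rightarrow> nat"
    have "minor_exponent b N i < N + (\<Sum>j\<in>{1..N}. b j)" if "i < N" for i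
    proof -
      have "(\<Sum>j\<in>{N - i..N}. b j) \<le> (\<Sum>j\<in>{1..N}. b j)"
        using that by (intro sum_mono2) auto
      then show ?thesis using that by (simp add: minor_exponent_def)
    qed
    from power_rows_det_vandermonde[OF this, where \<rho> = "\<lambda>i. complex_of_real (\<rho> i)"]
    have vand: "power_rows_det N (\<Sum>j\<in>{1..N}. b j) (minor_exponent b N) (char_poly x) * ?V =
        Determinant.det (Matrix.mat N N (\<lambda>(i, j). complex_of_real (\<rho> j) ^ minor_exponent b N i))"
      by (simp add: cp)
    have "(\<Prod>K<N. \<Prod>i<K. 1 + exponent_sum (\<lambda>j. of_nat (b j)) K i) =
        (\<Prod>K<N. \<Prod>i<K. of_nat (Suc (minor_exponent b K i)))"
      by (simp add: exponent_sum_of_nat)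
    then have "(\<Prod>K<N. \<Prod>i<K. 1 + exponent_sum (\<lambda>j. of_nat (b j)) K i) * (?V * mixed_moment (\<lambda>j. of_nat (b j))) =
        ?V * ((\<Prod>K<N. \<Prod>i<K. of_nat (Suc (minor_exponent b K i))) *
          (LINT u|\<mu>. (\<Prod>j\<in>{1..N}. leading_minor j (orbit u) ^ b j)))"
      by (simp only: mixed_moment_of_nat mult.left_commute)
    also have "\<dots> = (\<Prod>K<N. fact K) * (power_rows_det N (\<Sum>j\<in>{1..N}. b j) (minor_exponent b N) (char_poly x) * ?V)"
      unfolding integer_moments by (simp only: mult_ac)
    also have "\<dots> = (\<Prod>K<N. fact K) *
        Determinant.det (Matrix.mat N N (\<lambda>(i, j). complex_of_real (\<rho> j) powr exponent_sum (\<lambda>j. of_nat (b j)) N i))"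
      unfolding vand exponent_sum_of_nat
    proof (intro arg_cong2[where f = "(*)"] refl arg_cong[where f = Determinant.det] eq_matI; simp)
      fix i j assume "j < N"
      then show "complex_of_real (\<rho> j) ^ minor_exponent b N i = complex_of_real (\<rho> j) powr of_nat (minor_exponent b N i)"
        using \<rho>[of j] by (simp add: powr_nat')
    qed
    finally show "F (\<lambda>j. of_nat (b j)) = 0" by (simp add: F_def)
  qed (use outside in auto)
  then show ?thesis by (simp add: F_def)
qed

end

text \<open>\<open>mixed_moment_formula\<close> does not determine the moment at coinciding
  eigenvalues. The natural moments, however, are given by the characteristic polynomial directly,
  and uniqueness of Newton series carries this over to complex exponents. Thus \<open>x\<close> can
  be exchanged for a diagonal matrix without being diagonalised.\<close>

lemma mixed_moment_char_poly:
  assumes 1: "positive_haar_orbit N \<mu> x m B" and 2: "positive_haar_orbit N \<mu> x' m' B'"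
    and cp: "char_poly x = char_poly x'"
    and outside: "\<And>j. j \<notin> {1..N} \<Longrightarrow> a j = 0"
  shows "positive_haar_orbit.mixed_moment N \<mu> x a = positive_haar_orbit.mixed_moment N \<mu> x' a"
proof -
  interpret A: positive_haar_orbit N \<mu> x m B by (rule 1)
  interpret B: positive_haar_orbit N \<mu> x' m' B' by (rule 2)
  have "A.mixed_moment a - B.mixed_moment a = 0"
  proof (rule newton_vanish[of "{1..N}" "\<lambda>a. A.mixed_moment a - B.mixed_moment a" "{1..N}"])
    fix j a assume "j \<in> {1..N}"
    then show "newton_class (\<lambda>z. A.mixed_moment (a(j := z)) - B.mixed_moment (a(j := z)))"
      by (intro newton_class_diff A.newton_class_mixed_moment B.newton_class_mixed_moment)
  next
    fix b :: "nat \<Rightarrow> nat"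
    let ?P = "\<Prod>K<N. \<Prod>i<K. complex_of_nat (Suc (minor_exponent b K i))"
    have "?P \<noteq> 0" by (simp add: prod_zero_iff del: of_nat_Suc)
    moreover have "?P * A.mixed_moment (\<lambda>j. of_nat (b j)) = ?P * B.mixed_moment (\<lambda>j. of_nat (b j))"
      unfolding A.mixed_moment_of_nat B.mixed_moment_of_nat A.integer_moments B.integer_moments cp ..
    ultimately show "A.mixed_moment (\<lambda>j. of_nat (b j)) - B.mixed_moment (\<lambda>j. of_nat (b j)) = 0"
      by simp
  qed (use outside in auto)
  then show ?thesis by simp
qed

text \<open>The exponents of the leading minors in the power function at \<open>lam + delta\<close>.\<close>

definition minor_powers :: "nat \<Rightarrow> (nat \<Rightarrow> complex) \<Rightarrow> nat \<Rightarrow> complex" where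
  "minor_powers N lam k =
     (if k \<in> {1..<N} then (lam k + delta N k) - (lam (Suc k) + delta N (Suc k))
      else if k = N then lam N + delta N N else 0)"

lemma power_function_eq_prod:
  assumes "N \<ge> 1"
  shows "power_function N (\<lambda>k. lam k + delta N k) Y =
    (\<Prod>j\<in>{1..N}. leading_minor j Y powr minor_powers N lam j)"
proof -
  have "{1..N} = insert N {1..<N}" using assms by auto
  then show ?thesis
    by (simp add: power_function_def minor_powers_def mult.commute)
qed

text \<open>Telescoping; the convention \<open>s (Suc N) = 0\<close> makes the last exponent, which
  is no difference, follow the same rule.\<close>

lemma sum_minor_powers:
  fixes lam :: "nat \<Rightarrow> complex"
  assumes "p \<ge> 1" "p \<le> Suc K" "K \<le> N"
  defines "s \<equiv> \<lambda>k. if k \<le> N then lam k + delta N k else 0"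
  shows "(\<Sum>j\<in>{p..K}. minor_powers N lam j) = s p - s (Suc K)"
proof -
  have "minor_powers N lam j = - (s (Suc j) - s j)" if "1 \<le> j" "j \<le> N" for j
    using that by (cases "j = N") (auto simp: minor_powers_def s_def)
  then have "(\<Sum>j\<in>{p..K}. minor_powers N lam j) = (\<Sum>j\<in>{p..K}. - (s (Suc j) - s j))"
    using assms(1-3) by (intro sum.cong) auto
  also have "\<dots> = - (s (Suc K) - s p)"
    unfolding sum_negf by (subst sum_Suc_diff[OF assms(2)]) simp
  finally show ?thesis by simp
qed

text \<open>The half-integral shift is made for this:
  \<open>delta N (K - i) - delta N (Suc K) = - i - 1\<close> cancels the staircase, leaving
  differences of the parameters.\<close>

lemma exponent_sum_minor_powers:
  assumes "i < K" "K < N"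
  shows "1 + exponent_sum (minor_powers N lam) K i = lam (K - i) - lam (Suc K)"
proof -
  have "(\<Sum>j\<in>{K - i..K}. minor_powers N lam j) =
      (lam (K - i) + delta N (K - i)) - (lam (Suc K) + delta N (Suc K))"
    using assms by (subst sum_minor_powers) auto
  then have "1 + exponent_sum (minor_powers N lam) K i =
      lam (K - i) - lam (Suc K) + (1 + of_nat i + (delta N (K - i) - delta N (Suc K)))"
    unfolding exponent_sum_def by (simp add: algebra_simps)
  also have "delta N (K - i) - delta N (Suc K) = - of_nat i - 1"
    using assms by (simp add: delta_def of_nat_diff field_simps)
  finally show ?thesis by simp
qed

text \<open>Here staircase and shift add up to the same constant \<open>(N - 1) / 2\<close> in every
  row.\<close>

lemma exponent_sum_minor_powers_full:
  assumes "i < N"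
  shows "exponent_sum (minor_powers N lam) N i = lam (N - i) + (of_nat N - 1) / 2"
proof -
  have "(\<Sum>j\<in>{N - i..N}. minor_powers N lam j) = lam (N - i) + delta N (N - i)"
    using assms by (subst sum_minor_powers) auto
  then show ?thesis
    using assms by (simp add: exponent_sum_def delta_def of_nat_diff field_simps)
qed

text \<open>The same sign relates the two Vandermonde products and the two determinants of powers, so that
  its value does not matter.\<close>

lemma det_reverse_columns:
  "\<exists>\<epsilon>::complex. \<epsilon> \<noteq> 0 \<and> (\<forall>f. Determinant.det (Matrix.mat N N (\<lambda>(i, j). f i (N - 1 - j))) =
    \<epsilon> * Determinant.det (Matrix.mat N N (\<lambda>(i, j). f i j)))"
proof -
  let ?J = "Matrix.mat N N (\<lambda>(i, j). if i + j + 1 = N then 1 else 0 :: complex)"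
  have rev: "Determinant.det (Matrix.mat N N (\<lambda>(i, j). f i (N - 1 - j))) =
      Determinant.det ?J * Determinant.det (Matrix.mat N N (\<lambda>(i, j). f i j))" for f
  proof -
    let ?A = "Matrix.mat N N (\<lambda>(i, j). f i j)"
    have "?A * ?J = Matrix.mat N N (\<lambda>(i, j). f i (N - 1 - j))" (is "_ = ?B")
    proof (rule eq_matI)
      fix i j assume "i < dim_row ?B" "j < dim_col ?B"
      then have ij: "i < N" "j < N" by auto
      have "(?A * ?J) $$ (i, j) = (\<Sum>k<N. ?A $$ (i, k) * ?J $$ (k, j))"
        by (rule product_index) (use ij in auto)
      also have "\<dots> = (\<Sum>k\<in>{N - 1 - j}. ?A $$ (i, k) * ?J $$ (k, j))"
        by (rule sum.mono_neutral_right) (use ij in auto)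
      also have "\<dots> = ?B $$ (i, j)" using ij by simp
      finally show "(?A * ?J) $$ (i, j) = ?B $$ (i, j)" .
    qed auto
    then show ?thesis using det_mult[of ?A N ?J] by (simp add: mult.commute)
  qed
  \<comment> \<open>Reversing the columns of \<open>?J\<close> gives the identity, so the formula
    applied to \<open>?J\<close> shows that its determinant is nonzero.\<close>
  have "Matrix.mat N N (\<lambda>(i, j). if i + (N - 1 - j) + 1 = N then 1 else 0) = (1\<^sub>m N :: complex mat)"
    by (intro eq_matI) auto
  then have "Determinant.det ?J \<noteq> 0"
    using rev[of "\<lambda>i j. if i + j + 1 = N then 1 else 0"] by auto
  then show ?thesis using rev by blast
qed

lemma vandermonde_eq_det:
  "vandermonde N c = Determinant.det (Matrix.mat N N (\<lambda>(i, j). c (Suc j) ^ i))"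
proof -
  have "vandermonde N c = (\<Prod>(k, l)\<in>(SIGMA k:{1..N}. {k<..N}). c l - c k)"
    unfolding vandermonde_def by (rule prod.Sigma) auto
  also have "\<dots> = (\<Prod>(j, i)\<in>(SIGMA j:{..<N}. {..<j}). c (Suc j) - c (Suc i))"
    by (rule prod.reindex_bij_witness[of _ "\<lambda>(j, i). (Suc i, Suc j)" "\<lambda>(k, l). (l - 1, k - 1)"]) auto
  also have "\<dots> = (\<Prod>j<N. \<Prod>i<j. c (Suc j) - c (Suc i))"
    by (rule prod.Sigma[symmetric]) auto
  finally show ?thesis by (simp add: det_vandermonde)
qed

text \<open>The pairs \<open>(K - i, Suc K)\<close> run through all pairs of indices, with the
  smaller one first in the difference. Reversing the order of the parameters turns this into a
  Vandermonde product.\<close>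

lemma prod_exponent_differences:
  fixes lam :: "nat \<Rightarrow> complex"
  shows "(\<Prod>K<N. \<Prod>i<K. lam (K - i) - lam (Suc K)) =
    Determinant.det (Matrix.mat N N (\<lambda>(i, j). lam (Suc (N - 1 - j)) ^ i))"
proof -
  have "(\<Prod>K<N. \<Prod>i<K. lam (K - i) - lam (Suc K)) =
      (\<Prod>(K, i)\<in>(SIGMA K:{..<N}. {..<K}). lam (K - i) - lam (Suc K))"
    by (rule prod.Sigma) auto
  also have "\<dots> = (\<Prod>(j, i)\<in>(SIGMA j:{..<N}. {..<j}). lam (Suc (N - 1 - j)) - lam (Suc (N - 1 - i)))"
    by (rule prod.reindex_bij_witness[of _ "\<lambda>(j, i). (N - 1 - i, j - i - 1)" "\<lambda>(K, i). (i + N - K, N - 1 - K)"])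
      (auto simp: Suc_diff_Suc)
  also have "\<dots> = (\<Prod>j<N. \<Prod>i<j. lam (Suc (N - 1 - j)) - lam (Suc (N - 1 - i)))"
    by (rule prod.Sigma[symmetric]) auto
  finally show ?thesis by (simp add: det_vandermonde)
qed

lemma char_poly_has_eigenvalues:
  assumes "has_eigenvalues N x rho"
  shows "char_poly x = (\<Prod>i<N. [:- complex_of_real (rho (Suc i)), 1:])"
proof -
  have "char_poly x = (\<Prod>k\<in>{1..N}. [:- complex_of_real (rho k), 1:])"
    using assms by (simp add: has_eigenvalues_def)
  also have "\<dots> = (\<Prod>i<N. [:- complex_of_real (rho (Suc i)), 1:])"
    by (rule prod.reindex_bij_witness[of _ Suc "\<lambda>k. k - 1"]) auto
  finally show ?thesis .
qed

section \<open>The spherical function at regular parameters\<close>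

context positive_haar_orbit
begin

lemma spherical_function_eq_integral:
  assumes "N \<ge> 1"
  shows "spherical_function N \<mu> lam x =
    (LINT u|\<mu>. (\<Prod>j\<in>{1..N}. leading_minor j (orbit u) powr minor_powers N lam j))"
  unfolding spherical_function_def power_function_eq_prod[OF assms] orbit_def ..

lemma spherical_function_eq_mixed_moment:
  assumes "N \<ge> 1"
  shows "spherical_function N \<mu> lam x = mixed_moment (minor_powers N lam)"
  unfolding spherical_function_eq_integral[OF assms] mixed_moment_def
  by (intro Bochner_Integration.integral_cong refl prod.cong) (simp add: minor(1))

lemma eigenvalue_positive:
  assumes "has_eigenvalues N x rho" "k \<in> {1..N}"
  shows "0 < rho k"
proof -
  have "poly (char_poly x) (complex_of_real (rho k)) = 0"
    using assms unfolding has_eigenvalues_def by (auto simp: poly_prod intro!: prod_zero)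
  from eigenvalue_bounds(2)[OF x bounds this] show ?thesis using m by simp
qed

text \<open>The moment formula at \<open>minor_powers\<close>. Transposition and a reversal of
  columns give the determinant its final shape; the same reversal occurs in the product of parameter
  differences, and its sign cancels.\<close>

lemma spherical_function_det:
  assumes N: "N \<ge> 1" and ev: "has_eigenvalues N x rho"
  shows "vandermonde N lam * vandermonde N (\<lambda>k. of_real (rho k)) * spherical_function N \<mu> lam x =
    (\<Prod>k\<in>{1..N - 1}. fact k) * Determinant.det (Matrix.mat N N
      (\<lambda>(k, l). of_real (rho (Suc k)) powr (lam (Suc l) + (of_nat N - 1) / 2)))"
proof -
  let ?a = "minor_powers N lam"
  let ?c = "(of_nat N - 1) / 2 :: complex"
  let ?V = "\<Prod>j<N. \<Prod>i<j. complex_of_real (rho (Suc j)) - of_real (rho (Suc i))"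
  obtain \<epsilon> :: complex where \<epsilon>: "\<epsilon> \<noteq> 0"
    "\<And>f. Determinant.det (Matrix.mat N N (\<lambda>(i, j). f i (N - 1 - j))) =
      \<epsilon> * Determinant.det (Matrix.mat N N (\<lambda>(i, j). f i j))"
    using det_reverse_columns[of N] by blast
  have V: "?V = vandermonde N (\<lambda>k. of_real (rho k))"
    by (simp add: vandermonde_eq_det det_vandermonde)
  have lam_prod: "(\<Prod>K<N. \<Prod>i<K. 1 + exponent_sum ?a K i) = \<epsilon> * vandermonde N lam"
  proof -
    have "(\<Prod>K<N. \<Prod>i<K. 1 + exponent_sum ?a K i) = (\<Prod>K<N. \<Prod>i<K. lam (K - i) - lam (Suc K))"
      by (intro prod.cong refl exponent_sum_minor_powers) auto
    also have "\<dots> = \<epsilon> * Determinant.det (Matrix.mat N N (\<lambda>(i, j). lam (Suc j) ^ i))"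
      unfolding prod_exponent_differences by (rule \<epsilon>(2)[of "\<lambda>i j. lam (Suc j) ^ i"])
    finally show ?thesis by (simp add: vandermonde_eq_det)
  qed
  have det: "Determinant.det (Matrix.mat N N (\<lambda>(i, j). complex_of_real (rho (Suc j)) powr exponent_sum ?a N i)) =
      \<epsilon> * Determinant.det (Matrix.mat N N
        (\<lambda>(k, l). complex_of_real (rho (Suc k)) powr (lam (Suc l) + ?c)))"
  proof -
    let ?A = "Matrix.mat N N (\<lambda>(i, j). complex_of_real (rho (Suc j)) powr exponent_sum ?a N i)"
    have "Determinant.det ?A = Determinant.det (transpose_mat ?A)"
      by (rule det_transpose[symmetric, where n = N]) simp
    also have "transpose_mat ?A = Matrix.mat N N (\<lambda>(k, l). complex_of_real (rho (Suc k)) powr (lam (Suc (N - 1 - l)) + ?c))"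
      by (intro eq_matI) (auto simp: exponent_sum_minor_powers_full Suc_diff_Suc)
    also have "Determinant.det \<dots> = \<epsilon> * Determinant.det (Matrix.mat N N
        (\<lambda>(k, l). complex_of_real (rho (Suc k)) powr (lam (Suc l) + ?c)))"
      by (rule \<epsilon>(2)[of "\<lambda>k l. complex_of_real (rho (Suc k)) powr (lam (Suc l) + ?c)"])
    finally show ?thesis .
  qed
  have fact: "(\<Prod>K<N. fact K :: complex) = (\<Prod>k\<in>{1..N - 1}. fact k)"
    by (rule prod.mono_neutral_right) (use N in \<open>auto simp: not_le\<close>)
  have "(\<Prod>K<N. \<Prod>i<K. 1 + exponent_sum ?a K i) * (?V * mixed_moment ?a) =
    (\<Prod>K<N. fact K) *
      Determinant.det (Matrix.mat N N (\<lambda>(i, j). complex_of_real (rho (Suc j)) powr exponent_sum ?a N i))"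
    by (rule mixed_moment_formula[OF _ char_poly_has_eigenvalues[OF ev]])
      (use eigenvalue_positive[OF ev] N in \<open>auto simp: minor_powers_def\<close>)
  then have "\<epsilon> * (vandermonde N lam * vandermonde N (\<lambda>k. of_real (rho k)) * spherical_function N \<mu> lam x) =
      \<epsilon> * ((\<Prod>k\<in>{1..N - 1}. fact k) * Determinant.det (Matrix.mat N N
      (\<lambda>(k, l). of_real (rho (Suc k)) powr (lam (Suc l) + ?c))))"
    unfolding lam_prod V det fact spherical_function_eq_mixed_moment[OF N] by (simp only: mult_ac)
  then show ?thesis using \<epsilon>(1) by simp
qed

lemma spherical_function_regular:
  assumes N: "N \<ge> 1" and ev: "has_eigenvalues N x rho" and reg: "(lam, rho) \<in> regular_parameters N"
  shows "spherical_function N \<mu> lam x = gelfand_naimark_quotient N lam rho"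
proof -
  have "vandermonde N c \<noteq> 0" if inj: "inj_on c {1..N}" for c :: "nat \<Rightarrow> complex"
  proof
    assume "vandermonde N c = 0"
    then obtain k l where "k \<in> {1..N}" "l \<in> {k<..N}" "c l = c k"
      by (auto simp: vandermonde_def prod_zero_iff)
    then show False using inj_onD[OF inj, of l k] by auto
  qed
  moreover have inj: "inj_on lam {1..N}" "inj_on rho {1..N}"
    using reg by (simp_all add: regular_parameters_def)
  moreover from inj(2) have "inj_on (\<lambda>k. complex_of_real (rho k)) {1..N}"
    unfolding inj_on_def of_real_eq_iff .
  ultimately have "vandermonde N lam * vandermonde N (\<lambda>k. of_real (rho k)) \<noteq> 0"
    by simp
  then show ?thesis
    using spherical_function_det[OF N ev, of lam]
    unfolding gelfand_naimark_quotient_def times_divide_eq_right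
    by (simp add: nonzero_eq_divide_eq mult.commute)
qed

lemma bounded_measurable_integrand:
  shows "bounded_measurable \<mu> (\<lambda>u. \<Prod>j\<in>{1..N}. leading_minor j (orbit u) powr a j)"
    and "u \<in> space \<mu> \<Longrightarrow> norm (\<Prod>j\<in>{1..N}. leading_minor j (orbit u) powr a j) \<le>
      (\<Prod>j\<in>{1..N}. exp (\<bar>Re (a j)\<bar> * max \<bar>ln (m ^ j)\<bar> \<bar>ln (B ^ j)\<bar>))"
proof -
  have "bounded_measurable \<mu> (\<lambda>u. \<Prod>j\<in>{1..N}. complex_of_real (minor j u) powr a j)"
    by (intro bounded_measurable_prod bounded_measurable_minor_powr) auto
  then show "bounded_measurable \<mu> (\<lambda>u. \<Prod>j\<in>{1..N}. leading_minor j (orbit u) powr a j)"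
    by (rule bounded_measurable_eq) (simp add: minor(1))
  show "norm (\<Prod>j\<in>{1..N}. leading_minor j (orbit u) powr a j) \<le>
      (\<Prod>j\<in>{1..N}. exp (\<bar>Re (a j)\<bar> * max \<bar>ln (m ^ j)\<bar> \<bar>ln (B ^ j)\<bar>))" if u: "u \<in> space \<mu>"
    unfolding prod_norm[symmetric]
  proof (intro prod_mono conjI norm_ge_zero)
    fix j assume "j \<in> {1..N}"
    then have j: "j \<le> N" by simp
    show "norm (leading_minor j (orbit u) powr a j) \<le> exp (\<bar>Re (a j)\<bar> * max \<bar>ln (m ^ j)\<bar> \<bar>ln (B ^ j)\<bar>)"
      unfolding minor(1)[OF j u]
      by (rule bounded_measurable_powr(2)[OF bounded_measurable_minor[OF j] _ _ u])
        (use m minor[OF j] in auto)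
  qed
qed

end

section \<open>Continuity along diagonal matrices\<close>

definition diagonal :: "nat \<Rightarrow> (nat \<Rightarrow> real) \<Rightarrow> complex mat" where
  "diagonal N r = Matrix.mat N N (\<lambda>(i, j). if i = j then of_real (r (Suc i)) else 0)"

lemma diagonal_carrier [simp]: "diagonal N r \<in> carrier_mat N N"
  by (simp add: diagonal_def)

lemma has_eigenvalues_diagonal: "has_eigenvalues N (diagonal N r) r"
proof -
  have "char_poly (diagonal N r) = (\<Prod>a\<leftarrow>diag_mat (diagonal N r). [:- a, 1:])"
    by (rule char_poly_upper_triangular[of _ N]) (auto simp: diagonal_def)
  also have "\<dots> = (\<Prod>i<N. [:- complex_of_real (r (Suc i)), 1:])"
    by (simp add: diag_mat_def diagonal_def prod.list_conv_set_nth atLeast0LessThan)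
  also have "\<dots> = (\<Prod>k\<in>{1..N}. [:- complex_of_real (r k), 1:])"
    by (rule prod.reindex_bij_witness[of _ "\<lambda>k. k - 1" Suc]) auto
  finally show ?thesis by (simp add: has_eigenvalues_def)
qed

lemma positive_haar_orbit_diagonal:
  assumes "normalized_haar N \<mu>" "0 < m" "\<And>k. k \<in> {1..N} \<Longrightarrow> m \<le> r k \<and> r k \<le> B"
  shows "positive_haar_orbit N \<mu> (diagonal N r) m B"
proof
  show "form_bounds N (diagonal N r) m B"
    unfolding diagonal_def by (rule form_bounds_diagonal) (use assms(3) in auto)
qed (use assms in auto)

lemma tendsto_det:
  fixes A :: "'b \<Rightarrow> nat \<Rightarrow> nat \<Rightarrow> complex"
  assumes "\<And>i j. i < k \<Longrightarrow> j < k \<Longrightarrow> ((\<lambda>n. A n i j) \<longlongrightarrow> L i j) F"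
  shows "((\<lambda>n. Determinant.det (Matrix.mat k k (\<lambda>(i, j). A n i j))) \<longlongrightarrow>
    Determinant.det (Matrix.mat k k (\<lambda>(i, j). L i j))) F"
proof -
  have det: "Determinant.det (Matrix.mat k k (\<lambda>(i, j). A i j)) =
      (\<Sum>p\<in>{p. p permutes {0..<k}}. signof p * (\<Prod>i = 0..<k. A i (p i)))" for A :: "nat \<Rightarrow> nat \<Rightarrow> complex"
    by (subst det_def'[where n = k], simp, intro sum.cong refl arg_cong2[where f = "(*)"] prod.cong)
      (auto simp: permutes_in_image[of _ "{0..<k}", simplified])
  show ?thesis
    unfolding det using permutes_in_image[of _ "{0..<k}"]
    by (intro tendsto_sum tendsto_mult tendsto_const tendsto_prod assms) auto
qed

lemma tendsto_leading_minor_diagonal: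
  assumes u: "u \<in> carrier_mat N N" and k: "k \<le> N"
    and r: "\<And>j. j \<in> {1..N} \<Longrightarrow> ((\<lambda>n. r n j) \<longlongrightarrow> rho j) F"
  shows "((\<lambda>n. leading_minor k (u * diagonal N (r n) * mat_adjoint u)) \<longlongrightarrow>
    leading_minor k (u * diagonal N rho * mat_adjoint u)) F"
  unfolding leading_minor_def
proof (rule tendsto_det)
  fix i j assume "i < k" "j < k"
  then have ij: "i < N" "j < N" using k by auto
  have index: "(u * diagonal N s * mat_adjoint u) $$ (i, j) =
      (\<Sum>b<N. (\<Sum>a<N. u $$ (i, a) * (if a = b then of_real (s (Suc a)) else 0)) * cnj (u $$ (j, b)))" for s
  proof -
    have "(u * diagonal N s * mat_adjoint u) $$ (i, j) =
        (\<Sum>b<N. (\<Sum>a<N. u $$ (i, a) * diagonal N s $$ (a, b)) * mat_adjoint u $$ (b, j))"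
      using u ij by (intro triple_product_index) auto
    also have "\<dots> = (\<Sum>b<N. (\<Sum>a<N. u $$ (i, a) * (if a = b then of_real (s (Suc a)) else 0)) * cnj (u $$ (j, b)))"
      using u ij by (intro sum.cong refl arg_cong2[where f = "(*)"]) (auto simp: diagonal_def)
    finally show ?thesis .
  qed
  have "((\<lambda>n. if a = b then complex_of_real (r n (Suc a)) else 0) \<longlongrightarrow>
      (if a = b then of_real (rho (Suc a)) else 0)) F" if "a < N" for a b
    using r[of "Suc a"] that by (auto intro: tendsto_of_real)
  then show "((\<lambda>n. (u * diagonal N (r n) * mat_adjoint u) $$ (i, j)) \<longlongrightarrow>
      (u * diagonal N rho * mat_adjoint u) $$ (i, j)) F"
    unfolding index by (intro tendsto_sum tendsto_mult tendsto_const) auto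
qed

lemma tendsto_spherical_function_diagonal:
  fixes r :: "nat \<Rightarrow> nat \<Rightarrow> real" and l :: "nat \<Rightarrow> nat \<Rightarrow> complex"
  assumes N: "N \<ge> 1" and haar: "normalized_haar N \<mu>"
    and pos: "\<And>k. k \<in> {1..N} \<Longrightarrow> 0 < rho k"
    and r: "\<And>k. (\<lambda>n. r n k) \<longlonglongrightarrow> rho k" and l: "\<And>k. (\<lambda>n. l n k) \<longlonglongrightarrow> lam k"
  shows "(\<lambda>n. spherical_function N \<mu> (l n) (diagonal N (r n))) \<longlonglongrightarrow>
    spherical_function N \<mu> lam (diagonal N rho)"
proof -
  \<comment> \<open>Half the minimum, and the maximum plus 1 for \<open>B\<close>, leave a margin,
    so that all diagonals from some \<open>n0\<close> on obey the same bounds.\<close>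
  define m where "m = Min (rho ` {1..N}) / 2"
  define B where "B = Max (rho ` {1..N}) + 1"
  have ne: "rho ` {1..N} \<noteq> {}" using N by simp
  have m: "0 < m" unfolding m_def using ne pos by simp
  have in_bounds: "m < rho k" "rho k < B" if "k \<in> {1..N}" for k
  proof -
    have "Min (rho ` {1..N}) \<le> rho k" "rho k \<le> Max (rho ` {1..N})" using that by auto
    then show "m < rho k" "rho k < B" using pos[OF that] m by (auto simp: m_def B_def)
  qed
  have "\<forall>\<^sub>F n in sequentially. m \<le> r n k \<and> r n k \<le> B" if "k \<in> {1..N}" for k
    using order_tendstoD(1)[OF r in_bounds(1)[OF that]] order_tendstoD(2)[OF r in_bounds(2)[OF that]]
    by eventually_elim simp
  then have "\<forall>\<^sub>F n in sequentially. \<forall>k\<in>{1..N}. m \<le> r n k \<and> r n k \<le> B"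
    by (intro eventually_ball_finite) auto
  then obtain n0 where n0: "\<forall>n\<ge>n0. \<forall>k\<in>{1..N}. m \<le> r n k \<and> r n k \<le> B"
    unfolding eventually_sequentially by blast
  have a: "(\<lambda>n. minor_powers N (l n) k) \<longlonglongrightarrow> minor_powers N lam k" for k
    unfolding minor_powers_def by (auto intro!: tendsto_intros l)
  have "Bseq (\<lambda>n. minor_powers N (l n) k)" for k
    using a by (intro convergent_imp_Bseq) (auto simp: convergent_def)
  then obtain A where A: "\<And>k n. norm (minor_powers N (l n) k) \<le> A k"
    unfolding Bseq_def by metis
  define W where "W = (\<Prod>j\<in>{1..N}. exp (A j * max \<bar>ln (m ^ j)\<bar> \<bar>ln (B ^ j)\<bar>))"
  let ?g = "\<lambda>n u. \<Prod>j\<in>{1..N}. leading_minor j (u * diagonal N (r n) * mat_adjoint u) powr minor_powers N (l n) j"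
  let ?h = "\<lambda>u. \<Prod>j\<in>{1..N}. leading_minor j (u * diagonal N rho * mat_adjoint u) powr minor_powers N lam j"
  interpret lim: positive_haar_orbit N \<mu> "diagonal N rho" m B
    by (rule positive_haar_orbit_diagonal[OF haar m]) (use in_bounds in force)
  have orb: "positive_haar_orbit N \<mu> (diagonal N (r (n + n0))) m B" for n
    by (rule positive_haar_orbit_diagonal[OF haar m]) (use n0 in auto)
  have "(\<lambda>n. LINT u|\<mu>. ?g (n + n0) u) \<longlonglongrightarrow> (LINT u|\<mu>. ?h u)"
  proof (rule integral_dominated_convergence[where w = "\<lambda>_. W"])
    show "?h \<in> borel_measurable \<mu>"
      using lim.bounded_measurable_integrand(1)[of "minor_powers N lam"]
      by (simp add: bounded_measurable_def lim.orbit_def)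
    show "?g (n + n0) \<in> borel_measurable \<mu>" for n
      using positive_haar_orbit.bounded_measurable_integrand(1)[OF orb, where a = "minor_powers N (l (n + n0))"]
      by (simp add: bounded_measurable_def haar_orbit.orbit_def[OF positive_haar_orbit.axioms(1)[OF orb]])
    show "integrable \<mu> (\<lambda>_. W)" by simp
    show "AE u in \<mu>. (\<lambda>n. ?g (n + n0) u) \<longlonglongrightarrow> ?h u"
    proof (rule AE_I2)
      fix u assume u: "u \<in> space \<mu>"
      then have uc: "u \<in> carrier_mat N N"
        by (simp add: lim.space_haar unitary_group_def)
      have "(\<lambda>n. ?g n u) \<longlonglongrightarrow> ?h u"
      proof (intro tendsto_prod tendsto_powr_complex a)
        fix j assume "j \<in> {1..N}"
        then have j: "j \<le> N" by simp
        \<comment> \<open>The principal branch is continuous off the nonpositive reals, and the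
          limiting minors are positive.\<close>
        show "leading_minor j (u * diagonal N rho * mat_adjoint u) \<notin> \<real>\<^sub>\<le>\<^sub>0"
          using lim.minor(1)[OF j u] lim.minor_positive[OF j u]
          by (simp add: lim.orbit_def complex_nonpos_Reals_iff)
        show "(\<lambda>n. leading_minor j (u * diagonal N (r n) * mat_adjoint u)) \<longlonglongrightarrow>
            leading_minor j (u * diagonal N rho * mat_adjoint u)"
          by (rule tendsto_leading_minor_diagonal[OF uc j r])
      qed
      then show "(\<lambda>n. ?g (n + n0) u) \<longlonglongrightarrow> ?h u" by (rule LIMSEQ_ignore_initial_segment)
    qed
    show "AE u in \<mu>. norm (?g (n + n0) u) \<le> W" for n
    proof (rule AE_I2)
      fix u assume u: "u \<in> space \<mu>"
      have "norm (?g (n + n0) u) \<le> (\<Prod>j\<in>{1..N}.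
          exp (\<bar>Re (minor_powers N (l (n + n0)) j)\<bar> * max \<bar>ln (m ^ j)\<bar> \<bar>ln (B ^ j)\<bar>))"
        using positive_haar_orbit.bounded_measurable_integrand(2)[OF orb u, where a = "minor_powers N (l (n + n0))"]
        by (simp add: haar_orbit.orbit_def[OF positive_haar_orbit.axioms(1)[OF orb]])
      also have "\<dots> \<le> W"
        unfolding W_def
        by (intro prod_mono conjI) (auto intro!: mult_right_mono order.trans[OF abs_Re_le_cmod A])
      finally show "norm (?g (n + n0) u) \<le> W" .
    qed
  qed
  then have "(\<lambda>n. LINT u|\<mu>. ?g n u) \<longlonglongrightarrow> (LINT u|\<mu>. ?h u)"
    by (rule LIMSEQ_offset)
  then show ?thesis
    by (simp add: spherical_function_def power_function_eq_prod[OF N])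
qed

text \<open>At regular parameters the quotient is the spherical function of a diagonal matrix, and
  at the limit \<open>x\<close> may be exchanged for \<open>diagonal N rho\<close>. What is left is
  continuity in diagonal entries and parameters; no matrices approximating \<open>x\<close> itself
  are constructed.\<close>

lemma spherical_function_limit:
  assumes N: "N \<ge> 1" and orb: "positive_haar_orbit N \<mu> x m B" and ev: "has_eigenvalues N x rho"
  shows "((\<lambda>(lam', rho'). gelfand_naimark_quotient N lam' rho') \<longlongrightarrow>
    spherical_function N \<mu> lam x) (at (lam, rho) within regular_parameters N)"
  unfolding tendsto_at_iff_sequentially
proof (intro allI impI)
  fix X :: "nat \<Rightarrow> (nat \<Rightarrow> complex) \<times> (nat \<Rightarrow> real)"
  assume X: "\<forall>n. X n \<in> regular_parameters N - {(lam, rho)}" and lim: "X \<longlonglongrightarrow> (lam, rho)"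
  interpret positive_haar_orbit N \<mu> x m B by (rule orb)
  have pos: "0 < rho k" if "k \<in> {1..N}" for k
    using eigenvalue_positive[OF ev that] .
  have l: "(\<lambda>n. fst (X n) k) \<longlonglongrightarrow> lam k" for k
    using continuous_on_tendsto_compose[OF continuous_on_product_coordinates[of k] tendsto_fst[OF lim]]
    by simp
  have r: "(\<lambda>n. snd (X n) k) \<longlonglongrightarrow> rho k" for k
    using continuous_on_tendsto_compose[OF continuous_on_product_coordinates[of k] tendsto_snd[OF lim]]
    by simp
  define b where "b = Min (rho ` {1..N})"
  have b: "0 < b" using pos N by (simp add: b_def)
  have orb': "positive_haar_orbit N \<mu> (diagonal N rho) b (Max (rho ` {1..N}))"
    by (rule positive_haar_orbit_diagonal[OF haar b]) (auto simp: b_def)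
  have "spherical_function N \<mu> lam x = spherical_function N \<mu> lam (diagonal N rho)"
    unfolding spherical_function_eq_mixed_moment[OF N]
      positive_haar_orbit.spherical_function_eq_mixed_moment[OF orb' N]
  proof (rule mixed_moment_char_poly[OF orb orb'])
    show "char_poly x = char_poly (diagonal N rho)"
      using ev has_eigenvalues_diagonal[of N rho] by (simp add: has_eigenvalues_def)
  qed (use N in \<open>auto simp: minor_powers_def\<close>)
  moreover have "gelfand_naimark_quotient N (fst (X n)) (snd (X n)) =
      spherical_function N \<mu> (fst (X n)) (diagonal N (snd (X n)))" for n
  proof -
    have reg: "(fst (X n), snd (X n)) \<in> regular_parameters N" using X by simp
    then have pos: "0 < snd (X n) k" if "k \<in> {1..N}" for k
      using that unfolding regular_parameters_def by (auto simp del: prod.collapse)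
    define c where "c = Min (snd (X n) ` {1..N})"
    have c: "0 < c" using pos N by (simp add: c_def)
    have "positive_haar_orbit N \<mu> (diagonal N (snd (X n))) c (Max (snd (X n) ` {1..N}))"
      by (rule positive_haar_orbit_diagonal[OF haar c]) (auto simp: c_def)
    from positive_haar_orbit.spherical_function_regular[OF this N has_eigenvalues_diagonal reg]
    show ?thesis ..
  qed
  ultimately show "((\<lambda>(lam', rho'). gelfand_naimark_quotient N lam' rho') \<circ> X) \<longlonglongrightarrow> spherical_function N \<mu> lam x"
    using tendsto_spherical_function_diagonal[OF N haar pos r l]
    by (simp add: comp_def case_prod_beta)
qed

theorem proposition2:
  fixes N :: nat and \<mu> :: "complex mat measure"
    and lam :: "nat \<Rightarrow> complex" and x :: "complex mat" and rho :: "nat \<Rightarrow> real"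
  assumes "N \<ge> 1"
    and "normalized_haar N \<mu>"
    and "x \<in> hermitian_pos_def N"
    and "has_eigenvalues N x rho"
  shows "((lam, rho) \<in> regular_parameters N \<longrightarrow>
            spherical_function N \<mu> lam x = gelfand_naimark_quotient N lam rho) \<and>
         ((\<lambda>(lam', rho'). gelfand_naimark_quotient N lam' rho') \<longlongrightarrow>
            spherical_function N \<mu> lam x) (at (lam, rho) within regular_parameters N)"
proof -
  obtain m B where "0 < m" "form_bounds N x m B"
    using hermitian_pos_def_form_bounds[OF assms(3)] by blast
  then have orb: "positive_haar_orbit N \<mu> x m B"
    using assms(2,3) by unfold_locales (auto simp: hermitian_pos_def_def)
  show ?thesis
    using positive_haar_orbit.spherical_function_regular[OF orb assms(1,4)]
      spherical_function_limit[OF assms(1) orb assms(4)]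
    by blast
qed

end
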